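(* Let $0<\epsilon<1$ and $0<\delta<1$. There is a streaming algorithm for insertion-only streams $p_1,\dots,p_m\in[n]$ that outputs at each time $t$ a value $\hat F_2^{(t)}$ such that \[\Pr\big(|\hat F_2^{(t)}-F_2^{(t)}|\le\epsilon F_2\ \text{ for all }0\le t\le m\big)\ge1-\delta.\] The algorithm uses $O(\frac1{\epsilon^2}\log\frac1{\delta\epsilon})$ words of storage and has $O(\frac1{\epsilon^2}\log\frac1{\delta\epsilon})$ update time.
   Context: $f^{(t)}_j=\#\{i\le t:p_i=j\}$, $F_2^{(t)}=\sum_j(f^{(t)}_j)^2$, and $F_2=F_2^{(m)}$. A word has at least $\log_2\max\{n,m\}$ bits. *)

theory Defs
  imports "HOL-Probability.Probability" "HOL-Library.Log_Nat"
begin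

section \<open>Frequencies and the second frequency moment\<close>

text \<open>
  The stream \<open>p\<^sub>1, \<dots>, p\<^sub>m\<close> is a list \<open>ps\<close> of length \<open>m\<close>; since lists are indexed from 0,
  \<open>p\<^sub>i\<close> is \<open>ps ! (i - 1)\<close>.
\<close>

definition freq :: "nat list \<Rightarrow> nat \<Rightarrow> nat \<Rightarrow> nat" where
  "freq ps t j = card {i \<in> {1..t}. ps ! (i - 1) = j}"

definition F2 :: "nat \<Rightarrow> nat list \<Rightarrow> nat \<Rightarrow> nat" where
  "F2 n ps t = (\<Sum>j = 1..n. (freq ps t j)\<^sup>2)"


section \<open>A randomised random-access machine with words of \<open>w\<close> bits\<close>

text \<open>
  Memory cells hold integers of any size, but an integer that needs \<open>j\<close> words of \<open>w\<close> bits
  (one bit being used for the sign) occupies \<open>j\<close> words of storage, and an operation on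
  integers of \<open>j\<close> and \<open>k\<close> words takes \<open>j * k\<close> units of time, as in schoolbook multiplication and
  division.  So the machine amounts to a word RAM with explicit multi-word arithmetic.
  Every cell, even one that contains 0, occupies at least one word.
\<close>

definition words :: "nat \<Rightarrow> int \<Rightarrow> nat" where
  "words w x = nat \<lceil>real_of_int (bitlen \<bar>x\<bar> + 1) / real w\<rceil>"

abbreviation awords :: "nat \<Rightarrow> nat \<Rightarrow> nat" where
  "awords w a \<equiv> words w (int a)"

type_synonym memory = "int list"

definition rd :: "memory \<Rightarrow> nat \<Rightarrow> int" where
  "rd M a = (if a < length M then M ! a else 0)"

definition mem_words :: "nat \<Rightarrow> memory \<Rightarrow> nat" where
  "mem_words w M = (\<Sum>x\<leftarrow>M. words w x)"

datatype arith_op = Plus | Minus | Times | Quot | Rem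

primrec arith :: "arith_op \<Rightarrow> int \<Rightarrow> int \<Rightarrow> int" where
  "arith Plus x y = x + y"
| "arith Minus x y = x - y"
| "arith Times x y = x * y"
| "arith Quot x y = x div y"
| "arith Rem x y = x mod y"

datatype instr =
    Const nat int                 \<comment> \<open>\<open>M[a] := c\<close>\<close>
  | Arith arith_op nat nat nat    \<comment> \<open>\<open>M[a] := M[b] op M[c]\<close>\<close>
  | Load nat nat                  \<comment> \<open>\<open>M[a] := M[M[b]]\<close>\<close>
  | Store nat nat                 \<comment> \<open>\<open>M[M[a]] := M[b]\<close>\<close>
  | Rand nat nat                  \<comment> \<open>\<open>M[a] :=\<close> fresh uniform element of \<open>{0..<M[b]}\<close>\<close>

datatype com =
    Skip
  | Instr instr
  | Seq com com
  | Cond nat com com              \<comment> \<open>if \<open>M[a] > 0\<close> then \<open>\<dots>\<close> else \<open>\<dots>\<close>\<close>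
  | While nat com                 \<comment> \<open>while \<open>M[a] > 0\<close> do \<open>\<dots>\<close>\<close>

text \<open>Program text is measured in words, too: one word per operation code, plus its operands.\<close>

primrec instr_words :: "nat \<Rightarrow> instr \<Rightarrow> nat" where
  "instr_words w (Const a c) = 1 + awords w a + words w c"
| "instr_words w (Arith f a b c) = 1 + awords w a + awords w b + awords w c"
| "instr_words w (Load a b) = 1 + awords w a + awords w b"
| "instr_words w (Store a b) = 1 + awords w a + awords w b"
| "instr_words w (Rand a b) = 1 + awords w a + awords w b"

primrec com_words :: "nat \<Rightarrow> com \<Rightarrow> nat" where
  "com_words w Skip = 1"
| "com_words w (Instr i) = instr_words w i"
| "com_words w (Seq c d) = com_words w c + com_words w d"
| "com_words w (Cond a c d) = 1 + awords w a + com_words w c + com_words w d"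
| "com_words w (While a c) = 1 + awords w a + com_words w c"

text \<open>
  The effect of one instruction.  Writes to cells that do not exist have no effect, reads from
  them give 0, and a negative address stands for 0.
\<close>

primrec instr_sem :: "instr \<Rightarrow> memory \<Rightarrow> memory spmf" where
  "instr_sem (Const a c) M = return_spmf (M[a := c])"
| "instr_sem (Arith f a b c) M = return_spmf (M[a := arith f (rd M b) (rd M c)])"
| "instr_sem (Load a b) M = return_spmf (M[a := rd M (nat (rd M b))])"
| "instr_sem (Store a b) M = return_spmf (M[nat (rd M a) := rd M b])"
| "instr_sem (Rand a b) M =
     (if rd M b > 0 then map_spmf (\<lambda>x. M[a := x]) (spmf_of_set {0..<rd M b})
      else return_spmf (M[a := 0]))"

text \<open>The time of one instruction: reading its text, and handling the data.\<close>

primrec data_cost :: "nat \<Rightarrow> instr \<Rightarrow> memory \<Rightarrow> nat" where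
  "data_cost w (Const a c) M = words w c"
| "data_cost w (Arith f a b c) M = words w (rd M b) * words w (rd M c)"
| "data_cost w (Load a b) M = words w (rd M b) + words w (rd M (nat (rd M b)))"
| "data_cost w (Store a b) M = words w (rd M a) + words w (rd M b)"
| "data_cost w (Rand a b) M = words w (rd M b)"

definition instr_cost :: "nat \<Rightarrow> instr \<Rightarrow> memory \<Rightarrow> nat" where
  "instr_cost w i M = instr_words w i + data_cost w i M"

definition test_cost :: "nat \<Rightarrow> nat \<Rightarrow> memory \<Rightarrow> nat" where
  "test_cost w a M = 1 + awords w a + words w (rd M a)"

text \<open>
  \<open>clock\<close> is the time used so far, and \<open>peak\<close> the largest number of words that the memory has
  occupied so far, after any single instruction.
\<close>

record mstate =
  memo :: memory
  clock :: nat
  peak :: nat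

definition start :: "nat \<Rightarrow> memory \<Rightarrow> mstate" where
  "start w M = \<lparr>memo = M, clock = 0, peak = mem_words w M\<rparr>"

definition advance :: "nat \<Rightarrow> nat \<Rightarrow> memory \<Rightarrow> mstate \<Rightarrow> mstate" where
  "advance w k M s = \<lparr>memo = M, clock = clock s + k, peak = max (peak s) (mem_words w M)\<rparr>"

definition positive :: "nat \<Rightarrow> mstate \<Rightarrow> bool" where
  "positive a s \<longleftrightarrow> rd (memo s) a > 0"

definition charge_test :: "nat \<Rightarrow> nat \<Rightarrow> mstate \<Rightarrow> mstate" where
  "charge_test w a s = advance w (test_cost w a (memo s)) (memo s) s"

text \<open>Loops that do not terminate lose probability mass.\<close>

partial_function (spmf) while_spmf :: "('s \<Rightarrow> bool) \<Rightarrow> ('s \<Rightarrow> 's spmf) \<Rightarrow> 's \<Rightarrow> 's spmf" where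
  "while_spmf b f s = (if b s then bind_spmf (f s) (while_spmf b f) else return_spmf s)"

primrec exec :: "nat \<Rightarrow> com \<Rightarrow> mstate \<Rightarrow> mstate spmf" where
  "exec w Skip s = return_spmf s"
| "exec w (Instr i) s =
     map_spmf (\<lambda>M. advance w (instr_cost w i (memo s)) M s) (instr_sem i (memo s))"
| "exec w (Seq c d) s = bind_spmf (exec w c s) (exec w d)"
| "exec w (Cond a c d) s =
     (if positive a s then exec w c (charge_test w a s) else exec w d (charge_test w a s))"
| "exec w (While a c) s =
     map_spmf (charge_test w a)
       (while_spmf (positive a) (\<lambda>s. exec w c (charge_test w a s)) s)"


section \<open>Streaming algorithms\<close>

text \<open>
  A streaming algorithm owns a fixed number of memory cells, initially 0.  Its initialisation
  program is started with the universe size \<open>n\<close> in cell 0.  For each item of the stream the item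
  is put into cell 0 and the update program is run.  The output after the initialisation (time 0)
  and after each update is the rational number given by cells 1 (numerator) and 2 (denominator),
  so that producing the output is a part of the update.  The programs are not told the length of
  the stream nor the word size; the latter affects costs only.
\<close>

record stream_alg =
  cells :: nat
  init_prog :: com
  update_prog :: com

record report =
  estimate :: real
  time :: nat      \<comment> \<open>time used by the run of the initialisation or update program\<close>
  storage :: nat   \<comment> \<open>words of storage, for memory (peak during that run) and program text\<close>

definition report_of :: "stream_alg \<Rightarrow> nat \<Rightarrow> mstate \<Rightarrow> report" where
  "report_of A w s =
     \<lparr>estimate = real_of_int (rd (memo s) 1) / real_of_int (rd (memo s) 2),
      time = clock s,
      storage = peak s + com_words w (init_prog A) + com_words w (update_prog A)\<rparr>"

primrec process :: "stream_alg \<Rightarrow> nat \<Rightarrow> nat list \<Rightarrow> memory \<Rightarrow> report list spmf" where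
  "process A w [] M = return_spmf []"
| "process A w (p # ps) M =
     bind_spmf (exec w (update_prog A) (start w (M[0 := int p])))
       (\<lambda>s. map_spmf ((#) (report_of A w s)) (process A w ps (memo s)))"

text \<open>
  The joint distribution of the reports at times \<open>0, \<dots>, m\<close>: entry \<open>t\<close> of the list is the report
  at time \<open>t\<close>.
\<close>

definition run :: "stream_alg \<Rightarrow> nat \<Rightarrow> nat \<Rightarrow> nat list \<Rightarrow> report list spmf" where
  "run A w n ps =
     bind_spmf (exec w (init_prog A) (start w ((replicate (cells A) 0)[0 := int n])))
       (\<lambda>s. map_spmf ((#) (report_of A w s)) (process A w ps (memo s)))"

text \<open>
  The function inside the \<open>O\<close>.  The maximum with 1 matters only when \<open>\<delta> * \<epsilon> > 1/2\<close>: without it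
  the bound would tend to 0 words as \<open>\<epsilon>\<close> and \<open>\<delta>\<close> tend to 1.
\<close>

definition resource_bound :: "real \<Rightarrow> real \<Rightarrow> real" where
  "resource_bound \<epsilon> \<delta> = 1 / \<epsilon>\<^sup>2 * max 1 (log 2 (1 / (\<delta> * \<epsilon>)))"

end

theory Submission
  imports Defs
begin

text \<open>
  If the universe has at most \<open>K = O(1/\<epsilon>\<^sup>2 log (1/(\<delta>\<epsilon>)))\<close> elements, the algorithm counts exactly.  (For such
  universes a word may be too short for the address of a counter.)  Otherwise it is the sketch of Alon, Matias
  and Szegedy: \<open>K\<close> counters with independent 4-wise independent random signs, divided into \<open>R\<close>
  groups of \<open>O(1/\<epsilon>\<^sup>2)\<close> counters.  The value of a group is the mean of its squared counters, and the
  output is an approximate median of the \<open>R\<close> values.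

  The frequency vectors satisfy \<open>\<parallel>f\<^sup>t - f\<^sup>s\<parallel>\<^sup>2 \<le> F\<^sub>2\<^sup>t - F\<^sub>2\<^sup>s\<close> for \<open>s \<le> t\<close>, since there are only insertions.  Hence the
  fourth moment of an increment of a counter is at most \<open>3 (F\<^sub>2\<^sup>t - F\<^sub>2\<^sup>s)\<^sup>2\<close>, and a Kolmogorov-type maximal inequality
  bounds the expected maximal squared increment over a time interval by a multiple of the growth of
  \<open>F\<^sub>2\<close>.  Divide time into \<open>O(1/\<epsilon>\<^sup>2)\<close> intervals in which \<open>F\<^sub>2\<close> grows by a small multiple of \<open>\<epsilon>\<^sup>2 F\<^sub>2\<^sup>m\<close>.  In each of
  them a group fails with small constant probability to be accurate at all times of the interval
  (Chebyshev at its start, Markov for the maximal increment), so a quarter of the groups fail with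
  probability at most \<open>2\<^sup>-\<^sup>R\<close>, and a union bound over the intervals suffices.
\<close>

section \<open>Digits of random numbers\<close>

text \<open>A union bound over all \<open>m\<close> times would bring log m into the number of
  groups; hence the intervals, whose number depends on \<epsilon> only. The second obstacle is the
  update time: sorting the \<open>R\<close> group values takes time \<open>R\<close> log
  \<open>R\<close>, which for fixed \<epsilon> and \<delta> tending to 0 exceeds the bound. A
  deterministic linear-time selection that distorts ranks slightly takes its place, and to leave
  room for the distortion only a quarter, not a half, of the groups may fail. All randomness is one
  uniform integer. Its base \<open>B\<close> digits are the seeds and its base \<open>B ^ k\<close>
  digits are the groups, so independence is a statement about digits, expectations are finite sums
  and probabilities are cardinalities. The signs are top bits of random cubic polynomials modulo a
  power of two, which the machine finds by doubling; no prime is involved.\<close>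

definition dig :: "int \<Rightarrow> nat \<Rightarrow> int \<Rightarrow> int" where
  "dig B j X = X div B ^ j mod B"

lemma dig_range: "B > 0 \<Longrightarrow> dig B j X \<in> {0..<B}"
  by (simp add: dig_def)

lemma bij_betw_add_mult:
  fixes A B :: int
  assumes "A > 0" "B > 0"
  shows "bij_betw (\<lambda>(X, x). X + A * x) ({0..<A} \<times> {0..<B}) {0..<A * B}"
proof (rule bij_betw_byWitness[where f' = "\<lambda>Y. (Y mod A, Y div A)"])
  show "\<forall>a\<in>{0..<A} \<times> {0..<B}. (\<lambda>Y. (Y mod A, Y div A)) (case a of (X, x) \<Rightarrow> X + A * x) = a"
    using assms by auto
  show "\<forall>a'\<in>{0..<A * B}. (case (a' mod A, a' div A) of (X, x) \<Rightarrow> X + A * x) = a'"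
    by simp
  show "(\<lambda>(X, x). X + A * x) ` ({0..<A} \<times> {0..<B}) \<subseteq> {0..<A * B}"
  proof (intro image_subsetI, unfold split_paired_all prod.case)
    fix X x assume "(X, x) \<in> {0..<A} \<times> {0..<B}"
    then have *: "0 \<le> X" "X < A" "0 \<le> x" "x < B" by auto
    then have "A * x \<le> A * (B - 1)" using assms by (intro mult_left_mono) auto
    with * assms show "X + A * x \<in> {0..<A * B}"
      by (auto simp: algebra_simps)
  qed
  show "(\<lambda>Y. (Y mod A, Y div A)) ` {0..<A * B} \<subseteq> {0..<A} \<times> {0..<B}"
  proof clarsimp
    fix Y assume Y: "0 \<le> Y" "Y < A * B"
    have "A * (Y div A) \<le> Y" using assms pos_mod_sign[of A Y] mult_div_mod_eq[of A Y] by linarith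
    with Y have "A * (Y div A) < A * B" by linarith
    with assms Y show "0 \<le> Y mod A \<and> Y mod A < A \<and> 0 \<le> Y div A \<and> Y div A < B"
      by (simp add: pos_imp_zdiv_nonneg_iff)
  qed
qed

lemma sum_add_mult:
  fixes A B :: int and f :: "int \<Rightarrow> 'a::comm_monoid_add"
  assumes "A > 0" "B > 0"
  shows "(\<Sum>Y\<in>{0..<A * B}. f Y) = (\<Sum>X\<in>{0..<A}. \<Sum>x\<in>{0..<B}. f (X + A * x))"
  using sum.reindex_bij_betw[OF bij_betw_add_mult[OF assms], of f]
  by (simp add: sum.cartesian_product case_prod_unfold)

lemma dig_add_low:
  assumes "B > 0" "j < K"
  shows "dig B j (X + B ^ K * x) = dig B j X"
proof -
  obtain e where e: "K = Suc (j + e)" using assms less_imp_Suc_add by blast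
  have "X + B ^ K * x = X + B ^ j * (B * (B ^ e * x))" by (simp add: e power_add algebra_simps)
  then have "(X + B ^ K * x) div B ^ j = X div B ^ j + B * (B ^ e * x)"
    using assms by (simp only: div_mult_self2) simp
  then show ?thesis by (simp add: dig_def)
qed

lemma dig_add_high:
  assumes "0 \<le> X" "X < B ^ K" "0 \<le> x" "x < B"
  shows "dig B K (X + B ^ K * x) = x"
  using assms by (simp add: dig_def)

text \<open>Independence of the digits of a uniform number, in counting form. The induction splits
  off the leading digit.\<close>

lemma sum_prod_dig:
  fixes \<phi> :: "nat \<Rightarrow> int \<Rightarrow> real"
  assumes "B > 0"
  shows "(\<Sum>X\<in>{0..<B ^ K}. \<Prod>j<K. \<phi> j (dig B j X)) = (\<Prod>j<K. \<Sum>x\<in>{0..<B}. \<phi> j x)"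
proof (induction K)
  case 0
  have "{0..<1} = {0::int}" by auto
  then show ?case by simp
next
  case (Suc K)
  have "(\<Sum>X\<in>{0..<B ^ Suc K}. \<Prod>j<Suc K. \<phi> j (dig B j X))
    = (\<Sum>X\<in>{0..<B ^ K}. \<Sum>x\<in>{0..<B}. \<Prod>j<Suc K. \<phi> j (dig B j (X + B ^ K * x)))"
    using sum_add_mult[of "B ^ K" B "\<lambda>X. \<Prod>j<Suc K. \<phi> j (dig B j X)"] assms
    by (simp add: mult.commute)
  also have "\<dots> = (\<Sum>X\<in>{0..<B ^ K}. \<Sum>x\<in>{0..<B}. (\<Prod>j<K. \<phi> j (dig B j X)) * \<phi> K x)"
    using assms by (intro sum.cong refl) (simp add: dig_add_low dig_add_high)
  also have "\<dots> = (\<Prod>j<Suc K. \<Sum>x\<in>{0..<B}. \<phi> j x)"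
    by (simp add: Suc.IH sum_product[symmetric])
  finally show ?case .
qed

lemma sum_dig:
  fixes \<phi> :: "int \<Rightarrow> real"
  assumes "B > 0" "i < K"
  shows "(\<Sum>X\<in>{0..<B ^ K}. \<phi> (dig B i X)) = real_of_int B ^ K * ((\<Sum>x\<in>{0..<B}. \<phi> x) / B)"
proof -
  have "(\<Sum>X\<in>{0..<B ^ K}. \<phi> (dig B i X))
    = (\<Sum>X\<in>{0..<B ^ K}. \<Prod>j<K. (if j = i then \<phi> (dig B j X) else 1))"
    using assms by (intro sum.cong refl) (simp add: prod.delta)
  also have "\<dots> = (\<Prod>j<K. \<Sum>x\<in>{0..<B}. if j = i then \<phi> x else 1)"
    by (rule sum_prod_dig[OF assms(1)])
  also have "\<dots> = (\<Prod>j<K. if j = i then (\<Sum>x\<in>{0..<B}. \<phi> x) else B)"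
    using assms by (intro prod.cong refl) auto
  also have "\<dots> = (\<Sum>x\<in>{0..<B}. \<phi> x) * real_of_int B ^ (K - 1)"
    using assms by (subst prod.remove[of _ i]) auto
  also have "\<dots> = real_of_int B ^ K * ((\<Sum>x\<in>{0..<B}. \<phi> x) / B)"
    using assms by (cases K) auto
  finally show ?thesis .
qed

text \<open>Different digits are independent, so a centred factor makes the product vanish on
  average. This removes the cross terms in the variance of a group.\<close>

lemma sum_dig_mult_zero:
  fixes \<phi> \<psi> :: "int \<Rightarrow> real"
  assumes "B > 0" "i < K" "l < K" "i \<noteq> l" "(\<Sum>x\<in>{0..<B}. \<phi> x) = 0"
  shows "(\<Sum>X\<in>{0..<B ^ K}. \<phi> (dig B i X) * \<psi> (dig B l X)) = 0"
proof -
  have "(\<Sum>X\<in>{0..<B ^ K}. \<phi> (dig B i X) * \<psi> (dig B l X))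
    = (\<Sum>X\<in>{0..<B ^ K}. \<Prod>j<K. (if j = i then \<phi> (dig B j X) else if j = l then \<psi> (dig B j X) else 1))"
  proof (intro sum.cong refl)
    fix X
    show "\<phi> (dig B i X) * \<psi> (dig B l X) =
      (\<Prod>j<K. (if j = i then \<phi> (dig B j X) else if j = l then \<psi> (dig B j X) else 1))"
      using assms by (subst prod.remove[of _ i], simp, simp, subst prod.remove[of _ l]) auto
  qed
  also have "\<dots> = (\<Prod>j<K. \<Sum>x\<in>{0..<B}. if j = i then \<phi> x else if j = l then \<psi> x else 1)"
    by (rule sum_prod_dig[OF assms(1)])
  also have "\<dots> = 0"
    using assms by (intro prod_zero bexI[of _ i]) auto
  finally show ?thesis .
qed

text \<open>Reading digits in base \<open>B ^ k\<close> first and in base \<open>B\<close>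
  afterwards identifies seed \<open>j\<close> of group \<open>r\<close> with seed
  \<open>r * k + j\<close> of the whole number.\<close>

lemma dig_dig:
  assumes "B > 0" "j < k"
  shows "dig B j (dig (B ^ k) r X) = dig B (r * k + j) X"
proof -
  define Y where "Y = X div B ^ (r * k)"
  have "Y = Y mod B ^ k + B ^ k * (Y div B ^ k)" by simp
  then have "dig B j Y = dig B j (Y mod B ^ k)"
    using dig_add_low[OF assms] by metis
  moreover have "dig B j Y = dig B (r * k + j) X"
    using assms by (simp add: dig_def Y_def power_add zdiv_zmult2_eq)
  moreover have "dig (B ^ k) r X = Y mod B ^ k"
    by (simp add: dig_def Y_def power_mult[symmetric] mult.commute)
  ultimately show ?thesis by simp
qed

section \<open>Four-wise independent signs\<close>

definition coeffs_val :: "int \<Rightarrow> int \<Rightarrow> int \<Rightarrow> int \<Rightarrow> int \<Rightarrow> int" where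
  "coeffs_val a b c d x = ((a * x + b) * x + c) * x + d"

text \<open>The top bit of a random cubic polynomial modulo \<open>2 * h\<close>, with the four
  digits of the seed as coefficients. A power of two as modulus spares the search for a prime, at
  the price that \<open>h\<close> must be at least the cube of the universe size.\<close>

definition hash_sign :: "int \<Rightarrow> int \<Rightarrow> int \<Rightarrow> int" where
  "hash_sign h s x =
     (if coeffs_val (dig (2 * h) 0 s) (dig (2 * h) 1 s) (dig (2 * h) 2 s) (dig (2 * h) 3 s) x mod (2 * h) < h
      then 1 else - 1)"

lemma sum_shift_mod:
  fixes f :: "int \<Rightarrow> 'a::comm_monoid_add"
  assumes "N > 0"
  shows "(\<Sum>d\<in>{0..<N}. f d) = (\<Sum>d\<in>{0..<N}. f ((d + c) mod N))"
proof -
  have "bij_betw (\<lambda>d. (d + c) mod N) {0..<N} {0..<N}"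
  proof (rule bij_betw_byWitness[where f' = "\<lambda>d. (d - c) mod N"])
    show "\<forall>a\<in>{0..<N}. ((a + c) mod N - c) mod N = a" by (simp add: mod_simps)
    show "\<forall>a'\<in>{0..<N}. ((a' - c) mod N + c) mod N = a'" by (simp add: mod_simps)
  qed (use assms in auto)
  from sum.reindex_bij_betw[OF this, of f] show ?thesis by simp
qed

lemma sum_digits4:
  fixes f :: "int \<Rightarrow> int \<Rightarrow> int \<Rightarrow> int \<Rightarrow> 'a::comm_monoid_add"
  assumes "N > 0"
  shows "(\<Sum>s\<in>{0..<N ^ 4}. f (dig N 0 s) (dig N 1 s) (dig N 2 s) (dig N 3 s))
    = (\<Sum>a\<in>{0..<N}. \<Sum>b\<in>{0..<N}. \<Sum>c\<in>{0..<N}. \<Sum>d\<in>{0..<N}. f a b c d)"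
proof -
  have N4: "N ^ 4 = N * (N * (N * N))" by (simp add: eval_nat_numeral)
  have pos: "N * N > 0" "N * (N * N) > 0" using assms by auto
  have "(\<Sum>s\<in>{0..<N ^ 4}. f (dig N 0 s) (dig N 1 s) (dig N 2 s) (dig N 3 s))
    = (\<Sum>a\<in>{0..<N}. \<Sum>b\<in>{0..<N}. \<Sum>c\<in>{0..<N}. \<Sum>d\<in>{0..<N}.
        (\<lambda>s. f (dig N 0 s) (dig N 1 s) (dig N 2 s) (dig N 3 s)) (a + N * (b + N * (c + N * d))))"
    unfolding N4 using assms pos by (simp add: sum_add_mult)
  also have "\<dots> = (\<Sum>a\<in>{0..<N}. \<Sum>b\<in>{0..<N}. \<Sum>c\<in>{0..<N}. \<Sum>d\<in>{0..<N}. f a b c d)"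
  proof (intro sum.cong refl)
    fix a b c d assume "a \<in> {0..<N}" "b \<in> {0..<N}" "c \<in> {0..<N}" "d \<in> {0..<N}"
    then show "(\<lambda>s. f (dig N 0 s) (dig N 1 s) (dig N 2 s) (dig N 3 s)) (a + N * (b + N * (c + N * d)))
      = f a b c d"
      by (simp add: dig_def power2_eq_square power3_eq_cube zdiv_zmult2_eq)
  qed
  finally show ?thesis .
qed

lemma sum_digits4_shift:
  fixes f :: "int \<Rightarrow> int \<Rightarrow> int \<Rightarrow> int \<Rightarrow> 'a::comm_monoid_add"
  assumes "N > 0"
  shows "(\<Sum>a\<in>{0..<N}. \<Sum>b\<in>{0..<N}. \<Sum>c\<in>{0..<N}. \<Sum>d\<in>{0..<N}. f a b c d)
    = (\<Sum>a\<in>{0..<N}. \<Sum>b\<in>{0..<N}. \<Sum>c\<in>{0..<N}. \<Sum>d\<in>{0..<N}.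
        f ((a + p) mod N) ((b + q) mod N) ((c + r) mod N) ((d + t) mod N))"
proof -
  note sh = sum_shift_mod[OF assms]
  have "(\<Sum>a\<in>{0..<N}. \<Sum>b\<in>{0..<N}. \<Sum>c\<in>{0..<N}. \<Sum>d\<in>{0..<N}. f a b c d)
    = (\<Sum>a\<in>{0..<N}. \<Sum>b\<in>{0..<N}. \<Sum>c\<in>{0..<N}. \<Sum>d\<in>{0..<N}. f a b c ((d + t) mod N))"
    by (intro sum.cong refl sh)
  also have "\<dots> = (\<Sum>a\<in>{0..<N}. \<Sum>b\<in>{0..<N}. \<Sum>c\<in>{0..<N}. \<Sum>d\<in>{0..<N}. f a b ((c + r) mod N) ((d + t) mod N))"
    by (intro sum.cong refl sh[where f = "\<lambda>c. \<Sum>d\<in>{0..<N}. f _ _ c ((d + t) mod N)"])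
  also have "\<dots> = (\<Sum>a\<in>{0..<N}. \<Sum>b\<in>{0..<N}. \<Sum>c\<in>{0..<N}. \<Sum>d\<in>{0..<N}. f a ((b + q) mod N) ((c + r) mod N) ((d + t) mod N))"
    by (intro sum.cong refl sh[where f = "\<lambda>b. \<Sum>c\<in>{0..<N}. \<Sum>d\<in>{0..<N}. f _ b ((c + r) mod N) ((d + t) mod N)"])
  also have "\<dots> = (\<Sum>a\<in>{0..<N}. \<Sum>b\<in>{0..<N}. \<Sum>c\<in>{0..<N}. \<Sum>d\<in>{0..<N}. f ((a + p) mod N) ((b + q) mod N) ((c + r) mod N) ((d + t) mod N))"
    by (rule sh)
  finally show ?thesis .
qed

text \<open>Write \<open>q\<close> as a power of two times an odd number; by its size the power
  divides \<open>2 ^ b\<close>. Multiplying by the complementary power gives an odd multiple of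
  \<open>2 ^ b\<close>. The induction strips the factors 2 one at a time.\<close>

lemma ex_mult_eq_half_mod:
  fixes q :: int
  assumes "q \<noteq> 0" "\<bar>q\<bar> \<le> 2 ^ b"
  shows "\<exists>t. t * q mod 2 ^ Suc b = 2 ^ b"
  using assms
proof (induction b arbitrary: q)
  case 0
  then have "q = 1 \<or> q = -1" by auto
  then show ?case by (intro exI[of _ 1]) auto
next
  case (Suc b)
  show ?case
  proof (cases "even q")
    case True
    then obtain q' where q': "q = 2 * q'" by blast
    with Suc obtain t where t: "t * q' mod 2 ^ Suc b = 2 ^ b" by fastforce
    then have "t * q mod 2 ^ Suc (Suc b) = 2 ^ Suc b"
      using mult_mod_right[of 2 "t * q'" "2 ^ Suc b"] by (simp add: q' algebra_simps)
    then show ?thesis by blast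
  next
    case False
    then obtain u where u: "q = 2 * u + 1" by (elim oddE)
    have "2 ^ Suc b * q = 2 ^ Suc b + 2 ^ Suc (Suc b) * u" by (simp add: u algebra_simps)
    then have "2 ^ Suc b * q mod 2 ^ Suc (Suc b) = (2 ^ Suc b) mod 2 ^ Suc (Suc b)" 
      by (metis mod_mult_self2)
    then show ?thesis by (intro exI[of _ "2 ^ Suc b"]) simp
  qed
qed

text \<open>
  Adding a multiple of \<open>(X - x) (X - y) (X - z)\<close> to a random cubic polynomial modulo \<open>2 h\<close>
  does not change its distribution nor its values at \<open>x\<close>, \<open>y\<close>, \<open>z\<close>, but a suitable
  multiple flips the top bit of the value at \<open>a\<close>.
\<close>

lemma hash_sign_orthogonal:
  fixes n :: nat and h :: int
  assumes h: "h = 2 ^ b" and n: "int n ^ 3 \<le> h"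
    and xyz: "x \<in> {1..int n}" "y \<in> {1..int n}" "z \<in> {1..int n}" "a \<in> {1..int n}"
    and a: "a \<noteq> x" "a \<noteq> y" "a \<noteq> z"
  shows "(\<Sum>s\<in>{0..<(2 * h) ^ 4}. hash_sign h s x * hash_sign h s y * hash_sign h s z * hash_sign h s a) = 0"
proof -
  define N where "N = 2 * h"
  have N: "N > 0" "h > 0" by (auto simp: N_def h)
  define q where "q = (a - x) * (a - y) * (a - z)"
  have "\<bar>q\<bar> \<le> int n * int n * int n"
    unfolding q_def abs_mult using xyz by (intro mult_mono) auto
  then have "\<bar>q\<bar> \<le> 2 ^ b" using n h by (simp add: power3_eq_cube)
  moreover have "q \<noteq> 0" using a by (simp add: q_def)
  ultimately obtain t where "t * q mod 2 ^ Suc b = 2 ^ b" using ex_mult_eq_half_mod by blast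
  then have t: "t * q mod N = h" by (simp add: N_def h)
  define V where "V = (\<lambda>c0 c1 c2 c3 u. if coeffs_val c0 c1 c2 c3 u mod N < h then 1 else - 1 :: int)"
  define G where "G = (\<lambda>c0 c1 c2 c3. V c0 c1 c2 c3 x * V c0 c1 c2 c3 y * V c0 c1 c2 c3 z * V c0 c1 c2 c3 a)"
  \<comment> \<open>Together with \<open>t\<close> these are the coefficients of \<open>t\<close>
    times the cubic with zeros \<open>x\<close>, \<open>y\<close> and \<open>z\<close>, which may
    coincide.\<close>
  define c1 where "c1 = - t * (x + y + z)"
  define c2 where "c2 = t * (x * y + y * z + x * z)"
  define c3 where "c3 = - t * (x * y * z)"
  have shift: "coeffs_val ((p + t) mod N) ((q + c1) mod N) ((r + c2) mod N) ((s + c3) mod N) u mod N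
    = (coeffs_val p q r s u + t * ((u - x) * (u - y) * (u - z))) mod N" for p q r s u
  proof -
    have "coeffs_val ((p + t) mod N) ((q + c1) mod N) ((r + c2) mod N) ((s + c3) mod N) u mod N
      = coeffs_val (p + t) (q + c1) (r + c2) (s + c3) u mod N"
      unfolding coeffs_val_def
      by (intro mod_add_cong mod_mult_cong refl) (simp_all add: mod_simps)
    also have "coeffs_val (p + t) (q + c1) (r + c2) (s + c3) u
      = coeffs_val p q r s u + t * ((u - x) * (u - y) * (u - z))"
      unfolding coeffs_val_def c1_def c2_def c3_def by (simp add: algebra_simps)
    finally show ?thesis .
  qed
  have same: "V ((p + t) mod N) ((q + c1) mod N) ((r + c2) mod N) ((s + c3) mod N) u = V p q r s u"
    if "u \<in> {x, y, z}" for p q r s u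
    using that unfolding V_def shift by auto
  \<comment> \<open>At \<open>a\<close> the value changes by \<open>t * q\<close>, which is
    \<open>h\<close> modulo \<open>2 * h\<close>; adding \<open>h\<close> exchanges the lower and
    the upper half of the residues.\<close>
  have flip: "V ((p + t) mod N) ((q + c1) mod N) ((r + c2) mod N) ((s + c3) mod N) a = - V p q r s a"
    for p q r s
  proof -
    define v where "v = coeffs_val p q r s a"
    have "(v + t * ((a - x) * (a - y) * (a - z))) mod N = (v mod N + h) mod N"
      using t unfolding q_def by (metis mod_add_eq mod_mod_trivial)
    moreover have "(v mod N + h) mod N = (if v mod N < h then v mod N + h else v mod N - h)"
    proof (cases "v mod N < h")
      case True
      then show ?thesis using N by (simp add: N_def)
    next
      case False
      have "(v mod N + h) mod N = (v mod N - h + N) mod N" by (simp add: N_def algebra_simps)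
      also have "\<dots> = (v mod N - h) mod N" by simp
      also have "\<dots> = v mod N - h"
      proof (rule mod_pos_pos_trivial)
        have "v mod N < N" using N by simp
        then show "v mod N - h < N" using N by linarith
      qed (use False in simp)
      finally show ?thesis using False by simp
    qed
    moreover have "0 \<le> v mod N" "v mod N < 2 * h" using N by (auto simp: N_def)
    ultimately show ?thesis unfolding V_def shift v_def[symmetric] by auto
  qed
  let ?S = "\<Sum>a\<in>{0..<N}. \<Sum>b\<in>{0..<N}. \<Sum>c\<in>{0..<N}. \<Sum>d\<in>{0..<N}. G a b c d"
  \<comment> \<open>The shift permutes the coefficient vectors, keeps three factors of
    \<open>G\<close> and negates the fourth.\<close>
  have "?S = - ?S"
    by (subst sum_digits4_shift[OF N(1), of _ t c1 c2 c3])
       (simp add: G_def same flip sum_negf)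
  then have "?S = 0" by simp
  moreover have "(\<Sum>s\<in>{0..<(2 * h) ^ 4}. hash_sign h s x * hash_sign h s y * hash_sign h s z * hash_sign h s a)
    = (\<Sum>s\<in>{0..<N ^ 4}. G (dig N 0 s) (dig N 1 s) (dig N 2 s) (dig N 3 s))"
    by (simp add: G_def V_def hash_sign_def N_def)
  ultimately show ?thesis using sum_digits4[OF N(1), of G] by simp
qed

section \<open>A maximal inequality\<close>

text \<open>Here the restriction to insertions enters: for \<open>0 <= a <= b\<close> pointwise, the
  mixed term \<open>a * (b - a)\<close> is nonnegative. With deletions the increment could be large
  while the norm stays the same.\<close>

lemma sum_increment_le:
  fixes a b :: "'a \<Rightarrow> real"
  assumes "\<And>x. x \<in> A \<Longrightarrow> 0 \<le> a x" "\<And>x. x \<in> A \<Longrightarrow> a x \<le> b x"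
  shows "(\<Sum>x\<in>A. (b x - a x)\<^sup>2) \<le> (\<Sum>x\<in>A. (b x)\<^sup>2) - (\<Sum>x\<in>A. (a x)\<^sup>2)"
  unfolding sum_subtractf[symmetric]
proof (rule sum_mono)
  fix x assume "x \<in> A"
  with assms have "0 \<le> a x * (b x - a x)" by simp
  then show "(b x - a x)\<^sup>2 \<le> (b x)\<^sup>2 - (a x)\<^sup>2" by (simp add: power2_eq_square algebra_simps)
qed

text \<open>A weighted Young inequality, applied twice. The weight is such that the factor
  \<open>(12 / 11) ^ 3\<close> of \<open>b ^ 4\<close> stays below 4/3; the recursion of the maximal
  inequality tolerates any factor below 2.\<close>

lemma power4_sum_le:
  fixes a b :: real
  shows "(a + b) ^ 4 \<le> 1728 * a ^ 4 + 4 / 3 * b ^ 4"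
proof -
  have sq: "(x + y)\<^sup>2 \<le> 12 * x\<^sup>2 + 12 / 11 * y\<^sup>2" for x y :: real
  proof -
    have "0 \<le> (11 * x - y)\<^sup>2 / 11" by simp
    also have "\<dots> = 12 * x\<^sup>2 + 12 / 11 * y\<^sup>2 - (x + y)\<^sup>2"
      by (simp add: power2_eq_square field_simps)
    finally show ?thesis by simp
  qed
  have "(a + b) ^ 4 = ((a + b)\<^sup>2)\<^sup>2" by simp
  also have "\<dots> \<le> (12 * a\<^sup>2 + 12 / 11 * b\<^sup>2)\<^sup>2"
    by (intro power_mono sq) simp
  also have "\<dots> \<le> 12 * (12 * a\<^sup>2)\<^sup>2 + 12 / 11 * (12 / 11 * b\<^sup>2)\<^sup>2" by (rule sq)
  also have "\<dots> = 1728 * a ^ 4 + 1728 / 1331 * b ^ 4"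
    by (simp add: power_mult_distrib power_divide flip: power_mult)
  also have "\<dots> \<le> 1728 * a ^ 4 + 4 / 3 * b ^ 4"
    by (intro add_left_mono mult_right_mono) auto
  finally show ?thesis .
qed

text \<open>
  Halve the interval with respect to the control function \<open>\<tau>\<close>.  The recursion is
  summable because the exponent 2 of the increments of \<open>\<tau>\<close> exceeds 1.
\<close>

lemma maximal_inequality:
  fixes S :: "'w \<Rightarrow> nat \<Rightarrow> real" and \<tau> :: "nat \<Rightarrow> real"
  assumes "finite \<Omega>" "a \<le> b" "c \<ge> 0"
    and mono: "\<And>i j. a \<le> i \<Longrightarrow> i \<le> j \<Longrightarrow> j \<le> b \<Longrightarrow> \<tau> i \<le> \<tau> j"
    and mom: "\<And>i j. a \<le> i \<Longrightarrow> i \<le> j \<Longrightarrow> j \<le> b \<Longrightarrow> (\<Sum>\<omega>\<in>\<Omega>. (S \<omega> j - S \<omega> i) ^ 4) \<le> c * (\<tau> j - \<tau> i)\<^sup>2"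
    and k: "\<And>\<omega>. \<omega> \<in> \<Omega> \<Longrightarrow> k \<omega> \<in> {a..b}"
  shows "(\<Sum>\<omega>\<in>\<Omega>. (S \<omega> (k \<omega>) - S \<omega> a) ^ 4) \<le> 5184 * c * (\<tau> b - \<tau> a)\<^sup>2"
  using assms(2) mono mom k
proof (induction "b - a" arbitrary: a b k rule: less_induct)
  case less
  show ?case
  proof (cases "a = b")
    case True
    with less.prems(4) have "S \<omega> (k \<omega>) = S \<omega> a" if "\<omega> \<in> \<Omega>" for \<omega> using that by fastforce
    then show ?thesis by (simp add: True)
  next
    case False
    define U where "U = \<tau> b - \<tau> a"
    have U: "U \<ge> 0" using less.prems(1,2) by (simp add: U_def)
    \<comment> \<open>The first index at which half of the growth is reached. Both
      \<open>{a..h - 1}\<close> and \<open>{h..b}\<close> then have growth at most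
      \<open>U / 2\<close>; the step from \<open>h - 1\<close> to \<open>h\<close> may be large, but
      is contained in the increment from \<open>a\<close> to \<open>h\<close>.\<close>
    define h where "h = (LEAST h. a < h \<and> h \<le> b \<and> U / 2 \<le> \<tau> h - \<tau> a)"
    have "\<exists>h. a < h \<and> h \<le> b \<and> U / 2 \<le> \<tau> h - \<tau> a"
      using False less.prems(1) U by (intro exI[of _ b]) (auto simp: U_def)
    from LeastI_ex[OF this] have h: "a < h" "h \<le> b" "U / 2 \<le> \<tau> h - \<tau> a"
      by (auto simp: h_def)
    have hm: "\<tau> (h - 1) - \<tau> a \<le> U / 2"
    proof (cases "h - 1 = a")
      case True
      then show ?thesis using U by simp
    next
      case False
      have "\<not> (a < h - 1 \<and> h - 1 \<le> b \<and> U / 2 \<le> \<tau> (h - 1) - \<tau> a)"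
        using not_less_Least[of "h - 1" "\<lambda>h. a < h \<and> h \<le> b \<and> U / 2 \<le> \<tau> h - \<tau> a"] h(1)
        unfolding h_def[symmetric] by auto
      with False h show ?thesis by auto
    qed
    have hb: "\<tau> b - \<tau> h \<le> U / 2" using h(3) by (simp add: U_def field_simps)
    \<comment> \<open>The chosen time, projected to either half, so that the induction hypothesis
      applies to both halves for all \<omega>; at each \<omega> one of the projections is the chosen
      time itself.\<close>
    define k1 where "k1 = (\<lambda>\<omega>. min (k \<omega>) (h - 1))"
    define k2 where "k2 = (\<lambda>\<omega>. max (k \<omega>) h)"
    have half: "5184 * c * v\<^sup>2 \<le> 1296 * c * U\<^sup>2" if "0 \<le> v" "v \<le> U / 2" for v
    proof -
      have "v\<^sup>2 \<le> (U / 2)\<^sup>2" using that by (intro power_mono)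
      then have "5184 * c * v\<^sup>2 \<le> 5184 * c * (U / 2)\<^sup>2"
        using assms(3) by (intro mult_left_mono) auto
      then show ?thesis by (simp add: power_divide)
    qed
    have 1: "(\<Sum>\<omega>\<in>\<Omega>. (S \<omega> (k1 \<omega>) - S \<omega> a) ^ 4) \<le> 1296 * c * U\<^sup>2"
    proof -
      have "(\<Sum>\<omega>\<in>\<Omega>. (S \<omega> (k1 \<omega>) - S \<omega> a) ^ 4) \<le> 5184 * c * (\<tau> (h - 1) - \<tau> a)\<^sup>2"
      proof (rule less.hyps)
        show "k1 \<omega> \<in> {a..h - 1}" if "\<omega> \<in> \<Omega>" for \<omega>
          using less.prems(4)[OF that] h by (auto simp: k1_def)
      qed (use h less.prems in auto)
      also have "\<dots> \<le> 1296 * c * U\<^sup>2"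
        using hm h less.prems(2)[of a "h - 1"] by (intro half) auto
      finally show ?thesis .
    qed
    have 2: "(\<Sum>\<omega>\<in>\<Omega>. (S \<omega> (k2 \<omega>) - S \<omega> h) ^ 4) \<le> 1296 * c * U\<^sup>2"
    proof -
      have "(\<Sum>\<omega>\<in>\<Omega>. (S \<omega> (k2 \<omega>) - S \<omega> h) ^ 4) \<le> 5184 * c * (\<tau> b - \<tau> h)\<^sup>2"
      proof (rule less.hyps)
        show "k2 \<omega> \<in> {h..b}" if "\<omega> \<in> \<Omega>" for \<omega>
          using less.prems(4)[OF that] h by (auto simp: k2_def)
      qed (use h less.prems in auto)
      also have "\<dots> \<le> 1296 * c * U\<^sup>2"
        using hb h less.prems(2)[of h b] by (intro half) auto
      finally show ?thesis .
    qed
    have 3: "(\<Sum>\<omega>\<in>\<Omega>. (S \<omega> h - S \<omega> a) ^ 4) \<le> c * U\<^sup>2"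
    proof -
      have "(\<Sum>\<omega>\<in>\<Omega>. (S \<omega> h - S \<omega> a) ^ 4) \<le> c * (\<tau> h - \<tau> a)\<^sup>2"
        using h by (intro less.prems(3)) auto
      also have "\<dots> \<le> c * U\<^sup>2"
        using h less.prems(2)[of h b] less.prems(2)[of a h] assms(3)
        by (intro mult_left_mono power_mono) (auto simp: U_def)
      finally show ?thesis .
    qed
    have "(S \<omega> (k \<omega>) - S \<omega> a) ^ 4 \<le> 1728 * (S \<omega> h - S \<omega> a) ^ 4
        + 4 / 3 * ((S \<omega> (k1 \<omega>) - S \<omega> a) ^ 4 + (S \<omega> (k2 \<omega>) - S \<omega> h) ^ 4)" if "\<omega> \<in> \<Omega>" for \<omega>
    proof (cases "k \<omega> < h")
      case True
      then have "k1 \<omega> = k \<omega>" by (auto simp: k1_def)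
      moreover have "0 \<le> (S \<omega> h - S \<omega> a) ^ 4" "0 \<le> (S \<omega> (k \<omega>) - S \<omega> a) ^ 4"
        "0 \<le> (S \<omega> (k2 \<omega>) - S \<omega> h) ^ 4" by simp_all
      ultimately show ?thesis by (simp add: algebra_simps del: zero_le_power_eq_numeral)
    next
      case False
      then have "k2 \<omega> = k \<omega>" by (auto simp: k2_def)
      then have "(S \<omega> (k \<omega>) - S \<omega> a) ^ 4 \<le> 1728 * (S \<omega> h - S \<omega> a) ^ 4 + 4 / 3 * (S \<omega> (k2 \<omega>) - S \<omega> h) ^ 4"
        using power4_sum_le[of "S \<omega> h - S \<omega> a" "S \<omega> (k \<omega>) - S \<omega> h"] by simp
      moreover have "0 \<le> (S \<omega> (k1 \<omega>) - S \<omega> a) ^ 4" by simp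
      ultimately show ?thesis unfolding ring_distribs by linarith
    qed
    then have "(\<Sum>\<omega>\<in>\<Omega>. (S \<omega> (k \<omega>) - S \<omega> a) ^ 4) \<le> (\<Sum>\<omega>\<in>\<Omega>. 1728 * (S \<omega> h - S \<omega> a) ^ 4
        + 4 / 3 * ((S \<omega> (k1 \<omega>) - S \<omega> a) ^ 4 + (S \<omega> (k2 \<omega>) - S \<omega> h) ^ 4))"
      by (rule sum_mono)
    also have "\<dots> = 1728 * (\<Sum>\<omega>\<in>\<Omega>. (S \<omega> h - S \<omega> a) ^ 4)
        + 4 / 3 * ((\<Sum>\<omega>\<in>\<Omega>. (S \<omega> (k1 \<omega>) - S \<omega> a) ^ 4) + (\<Sum>\<omega>\<in>\<Omega>. (S \<omega> (k2 \<omega>) - S \<omega> h) ^ 4))"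
      by (simp only: sum.distrib sum_distrib_left ring_distribs)
    \<comment> \<open>The constant 5184 is the solution of
      \<open>D = 1728 + 4 / 3 * 2 * (D / 4)\<close>: each half contributes with a quarter of the
      bound because its growth is halved and enters squared.\<close>
    also have "\<dots> \<le> 1728 * (c * U\<^sup>2) + 4 / 3 * (1296 * c * U\<^sup>2 + 1296 * c * U\<^sup>2)"
      using 1 2 3 by (intro add_mono mult_left_mono) auto
    also have "\<dots> = 5184 * c * U\<^sup>2" by simp
    finally show ?thesis by (simp add: U_def)
  qed
qed

lemma markov_count:
  fixes f :: "'a \<Rightarrow> real"
  assumes "finite A" "\<And>x. x \<in> A \<Longrightarrow> 0 \<le> f x" "L > 0" "sum f A \<le> L * M"
  shows "real (card {x \<in> A. f x > L}) \<le> M"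
proof -
  have "L * real (card {x \<in> A. f x > L}) = (\<Sum>x\<in>{x \<in> A. f x > L}. L)" by simp
  also have "\<dots> \<le> (\<Sum>x\<in>{x \<in> A. f x > L}. f x)" by (intro sum_mono) auto
  also have "\<dots> \<le> sum f A" using assms by (intro sum_mono2) auto
  also have "\<dots> \<le> L * M" by fact
  finally show ?thesis using assms(3) by simp
qed

section \<open>Moments of a single counter\<close>

text \<open>In \<open>orth\<close> the point \<open>a\<close> differs from \<open>x\<close>,
  \<open>y\<close> and \<open>z\<close>, which may coincide; \<open>x = y = z\<close> gives pairwise
  orthogonality. This is the form in which an induction that adds one point at a time uses
  independence.\<close>

locale four_wise =
  fixes B :: int and n :: nat and H :: "int \<Rightarrow> nat \<Rightarrow> real"
  assumes B: "B > 0"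
    and H2: "\<And>s x. H s x * H s x = 1"
    and orth: "\<And>x y z a. x \<in> {1..n} \<Longrightarrow> y \<in> {1..n} \<Longrightarrow> z \<in> {1..n} \<Longrightarrow> a \<in> {1..n} \<Longrightarrow>
      a \<noteq> x \<Longrightarrow> a \<noteq> y \<Longrightarrow> a \<noteq> z \<Longrightarrow> (\<Sum>s\<in>{0..<B}. H s x * H s y * H s z * H s a) = 0"
begin

lemma orth1:
  assumes "x \<in> {1..n}" "a \<in> {1..n}" "a \<noteq> x"
  shows "(\<Sum>s\<in>{0..<B}. H s x * H s a) = 0"
  using orth[of x x x a] assms by (simp add: H2)

lemma cross1:
  fixes g :: "nat \<Rightarrow> real"
  assumes "A \<subseteq> {1..n}" "a \<in> {1..n}" "a \<notin> A"
  shows "(\<Sum>s\<in>{0..<B}. (\<Sum>x\<in>A. g x * H s x) * H s a) = 0"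
proof -
  have "(\<Sum>s\<in>{0..<B}. (\<Sum>x\<in>A. g x * H s x) * H s a) = (\<Sum>s\<in>{0..<B}. \<Sum>x\<in>A. g x * (H s x * H s a))"
    by (simp add: sum_distrib_right mult.assoc)
  also have "\<dots> = (\<Sum>x\<in>A. g x * (\<Sum>s\<in>{0..<B}. H s x * H s a))"
    by (subst sum.swap) (simp add: sum_distrib_left)
  also have "\<dots> = 0"
  proof (intro sum.neutral ballI)
    fix x assume "x \<in> A"
    with assms have "x \<in> {1..n}" "a \<noteq> x" by auto
    from orth1[OF this(1) assms(2) this(2)] show "g x * (\<Sum>s\<in>{0..<B}. H s x * H s a) = 0" by simp
  qed
  finally show ?thesis .
qed

lemma cross3:
  fixes g :: "nat \<Rightarrow> real"
  assumes "A \<subseteq> {1..n}" "a \<in> {1..n}" "a \<notin> A"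
  shows "(\<Sum>s\<in>{0..<B}. (\<Sum>x\<in>A. g x * H s x) ^ 3 * H s a) = 0"
proof -
  have "(\<Sum>s\<in>{0..<B}. (\<Sum>x\<in>A. g x * H s x) ^ 3 * H s a)
    = (\<Sum>s\<in>{0..<B}. \<Sum>x\<in>A. \<Sum>y\<in>A. \<Sum>z\<in>A. g x * g y * g z * (H s x * H s y * H s z * H s a))"
    by (simp add: power3_eq_cube sum_distrib_left sum_distrib_right mult_ac)
  also have "\<dots> = (\<Sum>x\<in>A. \<Sum>y\<in>A. \<Sum>z\<in>A. \<Sum>s\<in>{0..<B}. g x * g y * g z * (H s x * H s y * H s z * H s a))"
    by (simp only: sum.swap[where A = "{0..<B}"])
  also have "\<dots> = (\<Sum>x\<in>A. \<Sum>y\<in>A. \<Sum>z\<in>A. g x * g y * g z * (\<Sum>s\<in>{0..<B}. H s x * H s y * H s z * H s a))"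
    by (simp only: sum_distrib_left)
  also have "\<dots> = 0" 
    using assms by (intro sum.neutral ballI, subst orth) auto
  finally show ?thesis .
qed

lemma second_moment:
  fixes g :: "nat \<Rightarrow> real"
  assumes "A \<subseteq> {1..n}"
  shows "(\<Sum>s\<in>{0..<B}. (\<Sum>x\<in>A. g x * H s x)\<^sup>2) = B * (\<Sum>x\<in>A. (g x)\<^sup>2)"
  using finite_subset[OF assms finite_atLeastAtMost] assms
proof (induction A rule: finite_induct)
  case (insert a A)
  define S where "S = (\<lambda>s. \<Sum>x\<in>A. g x * H s x)"
  have sq: "(H s x)\<^sup>2 = 1" for s x
    by (simp add: power2_eq_square H2)
  have "(\<Sum>s\<in>{0..<B}. (\<Sum>x\<in>insert a A. g x * H s x)\<^sup>2)
    = (\<Sum>s\<in>{0..<B}. (S s)\<^sup>2 + 2 * g a * (S s * H s a) + (g a)\<^sup>2)"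
    using insert.hyps
    by (intro sum.cong refl) (simp add: S_def power2_sum power_mult_distrib sq mult_ac)
  also have "\<dots> = (\<Sum>s\<in>{0..<B}. (S s)\<^sup>2) + 2 * g a * (\<Sum>s\<in>{0..<B}. S s * H s a) + B * (g a)\<^sup>2"
    using B by (simp add: sum.distrib sum_distrib_left)
  also have "(\<Sum>s\<in>{0..<B}. S s * H s a) = 0"
    unfolding S_def using insert by (intro cross1) auto
  finally show ?case using insert by (simp add: S_def algebra_simps)
qed simp

text \<open>The constant 3 is that of a Gaussian variable. When a point \<open>a\<close> is added,
  the terms odd in \<open>H s a\<close> vanish and the others add up to at most a perfect
  square.\<close>

lemma fourth_moment:
  fixes g :: "nat \<Rightarrow> real"
  assumes "A \<subseteq> {1..n}"
  shows "(\<Sum>s\<in>{0..<B}. (\<Sum>x\<in>A. g x * H s x) ^ 4) \<le> 3 * B * (\<Sum>x\<in>A. (g x)\<^sup>2)\<^sup>2"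
  using finite_subset[OF assms finite_atLeastAtMost] assms
proof (induction A rule: finite_induct)
  case (insert a A)
  define S where "S = (\<lambda>s. \<Sum>x\<in>A. g x * H s x)"
  define G where "G = (\<Sum>x\<in>A. (g x)\<^sup>2)"
  have expand: "(t * e + u) ^ 4 = u ^ 4 + 4 * t * (u ^ 3 * e) + 6 * t\<^sup>2 * u\<^sup>2 + 4 * t ^ 3 * (u * e) + t ^ 4"
    if "e * e = 1" for t e u :: real
  proof -
    have "(t * e + u)\<^sup>2 = t\<^sup>2 * (e * e) + u\<^sup>2 + 2 * t * e * u"
      by (simp add: power2_eq_square algebra_simps)
    then have "(t * e + u) ^ 4 = (t\<^sup>2 + u\<^sup>2 + 2 * t * e * u)\<^sup>2"
      using that power_mult[of "t * e + u" 2 2] by simp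
    also have "\<dots> = (t\<^sup>2 + u\<^sup>2)\<^sup>2 + 4 * t\<^sup>2 * (e * e) * u\<^sup>2 + 4 * t * e * u * (t\<^sup>2 + u\<^sup>2)"
      by (simp add: power2_eq_square algebra_simps)
    finally show ?thesis using that by (simp add: eval_nat_numeral algebra_simps)
  qed
  have "(\<Sum>s\<in>{0..<B}. (\<Sum>x\<in>insert a A. g x * H s x) ^ 4)
    = (\<Sum>s\<in>{0..<B}. S s ^ 4 + 4 * g a * (S s ^ 3 * H s a) + 6 * (g a)\<^sup>2 * (S s)\<^sup>2
        + 4 * (g a) ^ 3 * (S s * H s a) + (g a) ^ 4)"
  proof (intro sum.cong refl)
    fix s
    have "(\<Sum>x\<in>insert a A. g x * H s x) = g a * H s a + S s" using insert.hyps by (simp add: S_def)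
    then show "(\<Sum>x\<in>insert a A. g x * H s x) ^ 4 = S s ^ 4 + 4 * g a * (S s ^ 3 * H s a)
      + 6 * (g a)\<^sup>2 * (S s)\<^sup>2 + 4 * (g a) ^ 3 * (S s * H s a) + (g a) ^ 4"
      by (simp only: expand[OF H2])
  qed
  also have "\<dots> = (\<Sum>s\<in>{0..<B}. S s ^ 4) + 4 * g a * (\<Sum>s\<in>{0..<B}. S s ^ 3 * H s a)
      + 6 * (g a)\<^sup>2 * (\<Sum>s\<in>{0..<B}. (S s)\<^sup>2) + 4 * (g a) ^ 3 * (\<Sum>s\<in>{0..<B}. S s * H s a) + B * (g a) ^ 4"
    using B by (simp add: sum.distrib sum_distrib_left)
  also have "(\<Sum>s\<in>{0..<B}. S s * H s a) = 0"
    unfolding S_def using insert by (intro cross1) auto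
  also have "(\<Sum>s\<in>{0..<B}. S s ^ 3 * H s a) = 0"
    unfolding S_def using insert by (intro cross3) auto
  also have "(\<Sum>s\<in>{0..<B}. (S s)\<^sup>2) = B * G"
    unfolding S_def G_def using insert by (intro second_moment) auto
  \<comment> \<open>Raising the last coefficient from 1 to 3 completes the square.\<close>
  also have "(\<Sum>s\<in>{0..<B}. S s ^ 4) + 4 * g a * 0 + 6 * (g a)\<^sup>2 * (B * G) + 4 * (g a) ^ 3 * 0 + B * (g a) ^ 4
    \<le> 3 * B * G\<^sup>2 + 6 * (g a)\<^sup>2 * (B * G) + 3 * (B * (g a) ^ 4)"
  proof -
    have "(\<Sum>s\<in>{0..<B}. S s ^ 4) \<le> 3 * B * G\<^sup>2" using insert unfolding S_def G_def by simp
    moreover have "0 \<le> B * (g a) ^ 4" using B by simp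
    ultimately show ?thesis by linarith
  qed
  also have "\<dots> = 3 * B * ((g a)\<^sup>2 + G)\<^sup>2"
    by (simp add: power2_eq_square eval_nat_numeral algebra_simps)
  finally show ?case using insert by (simp add: G_def)
qed simp

end

lemma four_wise_hash_sign:
  assumes "h = 2 ^ b" "int n ^ 3 \<le> h"
  shows "four_wise ((2 * h) ^ 4) n (\<lambda>s x. of_int (hash_sign h s (int x)))"
proof
  show "(2 * h) ^ 4 > 0" by (simp add: assms)
  show "real_of_int (hash_sign h s (int x)) * of_int (hash_sign h s (int x)) = 1" for s x
    by (simp add: hash_sign_def)
  fix x y z a :: nat
  assume "x \<in> {1..n}" "y \<in> {1..n}" "z \<in> {1..n}" "a \<in> {1..n}" "a \<noteq> x" "a \<noteq> y" "a \<noteq> z"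
  then have "(\<Sum>s\<in>{0..<(2 * h) ^ 4}. hash_sign h s x * hash_sign h s y * hash_sign h s z * hash_sign h s a) = 0"
    using assms by (intro hash_sign_orthogonal[of h b n]) auto
  then show "(\<Sum>s\<in>{0..<(2 * h) ^ 4}. real_of_int (hash_sign h s (int x)) * of_int (hash_sign h s (int y))
      * of_int (hash_sign h s (int z)) * of_int (hash_sign h s (int a))) = 0"
    by (simp flip: of_int_mult of_int_sum)
qed

section \<open>Frequencies and counters\<close>

lemma freq_0 [simp]: "freq ps 0 x = 0"
  by (simp add: freq_def)

lemma freq_Suc: "freq ps (Suc t) x = freq ps t x + (if ps ! t = x then 1 else 0)"
proof -
  have "{i \<in> {1..Suc t}. ps ! (i - 1) = x}
    = (if ps ! t = x then insert (Suc t) {i \<in> {1..t}. ps ! (i - 1) = x} else {i \<in> {1..t}. ps ! (i - 1) = x})"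
    by (auto simp: le_Suc_eq)
  then show ?thesis by (simp add: freq_def)
qed

lemma freq_mono: "s \<le> t \<Longrightarrow> freq ps s x \<le> freq ps t x"
  unfolding freq_def by (intro card_mono) auto

lemma F2_mono: "s \<le> t \<Longrightarrow> F2 n ps s \<le> F2 n ps t"
  unfolding F2_def by (intro sum_mono power_mono freq_mono) auto

lemma F2_0 [simp]: "F2 n ps 0 = 0"
  by (simp add: F2_def)

lemma F2_Suc:
  assumes "ps ! t \<in> {1..n}"
  shows "F2 n ps (Suc t) = F2 n ps t + 2 * freq ps t (ps ! t) + 1"
proof -
  have "F2 n ps (Suc t) = (\<Sum>j = 1..n. (freq ps t j)\<^sup>2 + (if j = ps ! t then 2 * freq ps t j + 1 else 0))"
    unfolding F2_def by (intro sum.cong refl) (auto simp: freq_Suc power2_eq_square)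
  also have "\<dots> = F2 n ps t + (2 * freq ps t (ps ! t) + 1)"
    using assms by (simp add: sum.distrib F2_def sum.delta)
  finally show ?thesis by simp
qed

locale stream_hash = four_wise +
  fixes ps :: "nat list" and m :: nat
  assumes len: "length ps = m" and ps: "set ps \<subseteq> {1..n}"
begin

definition cnt :: "int \<Rightarrow> nat \<Rightarrow> real" where
  "cnt s t = (\<Sum>i<t. H s (ps ! i))"

abbreviation \<tau> :: "nat \<Rightarrow> real" where
  "\<tau> t \<equiv> real (F2 n ps t)"

lemma item: "t < m \<Longrightarrow> ps ! t \<in> {1..n}"
  using ps len nth_mem by blast

lemma cnt_eq: "t \<le> m \<Longrightarrow> cnt s t = (\<Sum>x\<in>{1..n}. real (freq ps t x) * H s x)"
proof (induction t)
  case (Suc t)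
  have "(\<Sum>x\<in>{1..n}. real (freq ps (Suc t) x) * H s x)
    = (\<Sum>x\<in>{1..n}. real (freq ps t x) * H s x + (if x = ps ! t then H s x else 0))"
    by (intro sum.cong refl) (auto simp: freq_Suc algebra_simps)
  also have "\<dots> = cnt s (Suc t)"
    using Suc item[of t] by (simp add: sum.distrib cnt_def)
  finally show ?case ..
qed (simp add: cnt_def)

text \<open>The hypothesis of \<open>maximal_inequality\<close>, with \<open>F2\<close> as control
  function and \<open>3 * B\<close> as constant.\<close>

lemma increment_moment:
  assumes "i \<le> j" "j \<le> m"
  shows "(\<Sum>s\<in>{0..<B}. (cnt s j - cnt s i) ^ 4) \<le> 3 * real_of_int B * (\<tau> j - \<tau> i)\<^sup>2"
proof -
  define g where "g = (\<lambda>x. real (freq ps j x) - real (freq ps i x))"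
  have "cnt s j - cnt s i = (\<Sum>x\<in>{1..n}. g x * H s x)" for s
    using assms by (simp add: cnt_eq g_def sum_subtractf algebra_simps)
  then have "(\<Sum>s\<in>{0..<B}. (cnt s j - cnt s i) ^ 4) \<le> 3 * real_of_int B * (\<Sum>x\<in>{1..n}. (g x)\<^sup>2)\<^sup>2"
    using fourth_moment[of "{1..n}" g] by simp
  also have "(\<Sum>x\<in>{1..n}. (g x)\<^sup>2)\<^sup>2 \<le> (\<tau> j - \<tau> i)\<^sup>2"
  proof (intro power_mono)
    have "(\<Sum>x\<in>{1..n}. (g x)\<^sup>2)
      \<le> (\<Sum>x\<in>{1..n}. (real (freq ps j x))\<^sup>2) - (\<Sum>x\<in>{1..n}. (real (freq ps i x))\<^sup>2)"
      unfolding g_def using assms(1) by (intro sum_increment_le) (auto simp: freq_mono)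
    then show "(\<Sum>x\<in>{1..n}. (g x)\<^sup>2) \<le> \<tau> j - \<tau> i" by (simp add: F2_def)
  qed (auto intro: sum_nonneg)
  then have "3 * real_of_int B * (\<Sum>x\<in>{1..n}. (g x)\<^sup>2)\<^sup>2 \<le> 3 * real_of_int B * (\<tau> j - \<tau> i)\<^sup>2"
    using B by (intro mult_left_mono) auto
  finally show ?thesis .
qed

lemma cnt_second: "t \<le> m \<Longrightarrow> (\<Sum>s\<in>{0..<B}. (cnt s t)\<^sup>2) = B * \<tau> t"
  using second_moment[of "{1..n}" "\<lambda>x. real (freq ps t x)"] by (simp add: cnt_eq F2_def)

lemma cnt_fourth: "t \<le> m \<Longrightarrow> (\<Sum>s\<in>{0..<B}. cnt s t ^ 4) \<le> 3 * real_of_int B * (\<tau> t)\<^sup>2"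
  using increment_moment[of 0 t] by (simp add: cnt_def)

definition dev :: "nat \<Rightarrow> nat \<Rightarrow> int \<Rightarrow> real" where
  "dev a b s = Max ((\<lambda>t. (cnt s t - cnt s a)\<^sup>2) ` {a..b})"

lemma dev_ge: "t \<in> {a..b} \<Longrightarrow> (cnt s t - cnt s a)\<^sup>2 \<le> dev a b s"
  unfolding dev_def by (intro Max_ge) auto

lemma dev_attained: "a \<le> b \<Longrightarrow> \<exists>t\<in>{a..b}. dev a b s = (cnt s t - cnt s a)\<^sup>2"
  unfolding dev_def using Max_in[of "(\<lambda>t. (cnt s t - cnt s a)\<^sup>2) ` {a..b}"] by (auto simp del: Max_in)

lemma dev_nonneg: "a \<le> b \<Longrightarrow> 0 \<le> dev a b s"
  using dev_attained[of a b s] by auto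

text \<open>The maximal inequality bounds fourth powers by a multiple of \<open>U\<^sup>2\<close>;
  the arithmetic-geometric mean inequality with weight \<open>U\<close> turns this into a bound on
  squares that is linear in \<open>U\<close>, with 7776 = 5184 * 3 / 2.\<close>

lemma sum_dev_le:
  fixes U :: real
  assumes "a \<le> b" "b \<le> m" "U > 0" "\<tau> b - \<tau> a \<le> U"
  shows "(\<Sum>s\<in>{0..<B}. dev a b s) \<le> B * (7777 * U)"
proof -
  obtain k where k: "\<And>s. k s \<in> {a..b} \<and> dev a b s = (cnt s (k s) - cnt s a)\<^sup>2"
    using dev_attained[OF assms(1)] by metis
  have "(\<Sum>s\<in>{0..<B}. (cnt s (k s) - cnt s a) ^ 4) \<le> 5184 * (3 * real_of_int B) * (\<tau> b - \<tau> a)\<^sup>2"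
    using assms B k increment_moment by (intro maximal_inequality) (auto simp: F2_mono)
  also have "\<dots> \<le> 5184 * (3 * real_of_int B) * U\<^sup>2"
    using assms B by (intro mult_left_mono power_mono) (auto simp: F2_mono)
  finally have 4: "(\<Sum>s\<in>{0..<B}. (cnt s (k s) - cnt s a) ^ 4) \<le> 15552 * real_of_int B * U\<^sup>2" by simp
  have "x\<^sup>2 \<le> x ^ 4 / (2 * U) + U / 2" for x
  proof -
    have "0 \<le> (x\<^sup>2 - U)\<^sup>2 / (2 * U)" using assms by simp
    also have "\<dots> = x ^ 4 / (2 * U) + U / 2 - x\<^sup>2"
      using assms by (simp add: power2_eq_square eval_nat_numeral field_simps)
    finally show ?thesis by simp
  qed
  then have "(\<Sum>s\<in>{0..<B}. dev a b s) \<le> (\<Sum>s\<in>{0..<B}. (cnt s (k s) - cnt s a) ^ 4 / (2 * U) + U / 2)"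
    using k by (intro sum_mono) simp
  also have "\<dots> = (\<Sum>s\<in>{0..<B}. (cnt s (k s) - cnt s a) ^ 4) / (2 * U) + B * (U / 2)"
    using B by (simp add: sum.distrib sum_divide_distrib)
  also have "\<dots> \<le> 15552 * real_of_int B * U\<^sup>2 / (2 * U) + B * (U / 2)"
    using 4 assms(3) by (intro add_right_mono divide_right_mono) auto
  also have "\<dots> = B * (7776 * U + U / 2)"
    using assms(3) by (simp add: power2_eq_square field_simps)
  also have "\<dots> \<le> B * (7777 * U)"
    using assms(3) B by (intro mult_left_mono) auto
  finally show ?thesis .
qed

section \<open>Groups of counters\<close>

text \<open>A group is a single number \<open>g\<close> below \<open>B ^ k\<close>, so that groups
  can in turn be digits of the overall random number.\<close>

definition grp :: "nat \<Rightarrow> int \<Rightarrow> nat \<Rightarrow> real" where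
  "grp k g t = (\<Sum>j<k. (cnt (dig B j g) t)\<^sup>2) / k"

text \<open>The cross terms of the \<open>k\<close> independent centred squares vanish. Each
  diagonal term is at most 3 - 2 + 1 = 2 times the square of \<open>F2\<close>, by the fourth
  moment.\<close>

lemma grp_variance:
  assumes "t \<le> m" "k > 0"
  shows "(\<Sum>g\<in>{0..<B ^ k}. (grp k g t - \<tau> t)\<^sup>2) \<le> B ^ k * (2 * (\<tau> t)\<^sup>2 / k)"
proof -
  define \<xi> where "\<xi> s = (cnt s t)\<^sup>2 - \<tau> t" for s
  have \<xi>0: "(\<Sum>s\<in>{0..<B}. \<xi> s) = 0"
    using B cnt_second[OF assms(1)] by (simp add: \<xi>_def sum_subtractf)
  have "(\<Sum>s\<in>{0..<B}. (\<xi> s)\<^sup>2) = (\<Sum>s\<in>{0..<B}. cnt s t ^ 4 - 2 * \<tau> t * (cnt s t)\<^sup>2 + (\<tau> t)\<^sup>2)"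
    by (intro sum.cong refl) (simp add: \<xi>_def power2_diff flip: power_mult)
  also have "\<dots> = (\<Sum>s\<in>{0..<B}. cnt s t ^ 4) - 2 * \<tau> t * (\<Sum>s\<in>{0..<B}. (cnt s t)\<^sup>2) + B * (\<tau> t)\<^sup>2"
    using B by (simp add: sum.distrib sum_subtractf sum_distrib_left)
  also have "\<dots> \<le> 2 * real_of_int B * (\<tau> t)\<^sup>2"
    using cnt_fourth[OF assms(1)] unfolding cnt_second[OF assms(1)]
    by (simp add: power2_eq_square)
  finally have \<xi>2: "(\<Sum>s\<in>{0..<B}. (\<xi> s)\<^sup>2) \<le> 2 * real_of_int B * (\<tau> t)\<^sup>2" .
  have "(grp k g t - \<tau> t)\<^sup>2 = (\<Sum>j<k. \<Sum>l<k. \<xi> (dig B j g) * \<xi> (dig B l g)) / k\<^sup>2" for g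
  proof -
    have "grp k g t - \<tau> t = (\<Sum>j<k. \<xi> (dig B j g)) / k"
      using assms(2) by (simp add: grp_def \<xi>_def sum_subtractf field_simps)
    then show ?thesis by (simp add: power_divide power2_eq_square sum_product)
  qed
  then have "(\<Sum>g\<in>{0..<B ^ k}. (grp k g t - \<tau> t)\<^sup>2)
    = (\<Sum>g\<in>{0..<B ^ k}. \<Sum>j<k. \<Sum>l<k. \<xi> (dig B j g) * \<xi> (dig B l g)) / k\<^sup>2"
    by (simp add: sum_divide_distrib)
  also have "(\<Sum>g\<in>{0..<B ^ k}. \<Sum>j<k. \<Sum>l<k. \<xi> (dig B j g) * \<xi> (dig B l g))
    = (\<Sum>j<k. \<Sum>l<k. \<Sum>g\<in>{0..<B ^ k}. \<xi> (dig B j g) * \<xi> (dig B l g))"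
    by (simp only: sum.swap[where A = "{0..<B ^ k}"])
  also have "\<dots> = (\<Sum>j<k. \<Sum>l<k. if l = j then (\<Sum>g\<in>{0..<B ^ k}. (\<xi> (dig B j g))\<^sup>2) else 0)"
    using B \<xi>0 by (intro sum.cong refl) (auto simp: power2_eq_square intro!: sum_dig_mult_zero)
  also have "\<dots> = (\<Sum>j<k. B ^ k * ((\<Sum>s\<in>{0..<B}. (\<xi> s)\<^sup>2) / B))"
    using B by (intro sum.cong refl) (simp add: sum_dig[where \<phi> = "\<lambda>s. (\<xi> s)\<^sup>2"])
  also have "\<dots> \<le> (\<Sum>j<k. B ^ k * (2 * (\<tau> t)\<^sup>2))"
    using \<xi>2 B by (intro sum_mono mult_left_mono) (auto simp: field_simps)
  also have "\<dots> / k\<^sup>2 = B ^ k * (2 * (\<tau> t)\<^sup>2 / k)"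
    using assms by (simp add: power2_eq_square)
  finally show ?thesis by (simp add: divide_right_mono)
qed

lemma sum_grp_dev_le:
  fixes U :: real
  assumes "a \<le> b" "b \<le> m" "U > 0" "\<tau> b - \<tau> a \<le> U" "k > 0"
  shows "(\<Sum>g\<in>{0..<B ^ k}. (\<Sum>j<k. dev a b (dig B j g)) / k) \<le> B ^ k * (7777 * U)"
proof -
  have "(\<Sum>g\<in>{0..<B ^ k}. (\<Sum>j<k. dev a b (dig B j g)) / k)
    = (\<Sum>j<k. \<Sum>g\<in>{0..<B ^ k}. dev a b (dig B j g)) / k"
    by (subst sum.swap) (simp add: sum_divide_distrib)
  also have "\<dots> = (\<Sum>j<k. B ^ k * ((\<Sum>s\<in>{0..<B}. dev a b s) / B)) / k"
    using B by (simp add: sum_dig[where \<phi> = "dev a b"])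
  also have "\<dots> \<le> (\<Sum>j<k. B ^ k * (7777 * U)) / k"
    using B sum_dev_le[OF assms(1-4)]
    by (intro divide_right_mono sum_mono mult_left_mono) (auto simp: field_simps)
  also have "\<dots> = B ^ k * (7777 * U)" using assms(5) by simp
  finally show ?thesis .
qed

text \<open>The two ways to fail: a wrong value at the start of the interval, or too much movement
  within it. The threshold is 512 * 8192 times \<open>U\<close>, where 8192 exceeds the constant
  7777 of \<open>sum_grp_dev_le\<close>.\<close>

definition bad :: "nat \<Rightarrow> real \<Rightarrow> real \<Rightarrow> nat \<Rightarrow> nat \<Rightarrow> int set" where
  "bad k \<epsilon> U a b = {g \<in> {0..<B ^ k}. \<bar>grp k g a - \<tau> a\<bar> > \<epsilon> * \<tau> m / 4 \<or>
     (\<Sum>j<k. dev a b (dig B j g)) / k > 2 ^ 22 * U}"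

text \<open>Each kind of failure has probability at most 1/512. In Chebyshev's inequality the
  variance \<open>2 * F\<^sup>2 / k\<close> meets the threshold
  \<open>\<epsilon>\<^sup>2 * F\<^sup>2 / 16\<close>, where \<open>F\<close> is the final
  \<open>F2\<close>, whence 16384 = 32 * 512.\<close>

lemma card_bad:
  fixes U :: real
  assumes "a \<le> b" "b \<le> m" "U > 0" "\<tau> b - \<tau> a \<le> U" "k > 0"
    and \<epsilon>: "\<epsilon> > 0" and k: "16384 / \<epsilon>\<^sup>2 \<le> k" and F: "\<tau> m > 0"
  shows "256 * real (card (bad k \<epsilon> U a b)) \<le> B ^ k"
proof -
  let ?G = "{0..<B ^ k}"
  let ?V = "{g \<in> ?G. (grp k g a - \<tau> a)\<^sup>2 > (\<epsilon> * \<tau> m / 4)\<^sup>2}"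
  let ?D = "{g \<in> ?G. (\<Sum>j<k. dev a b (dig B j g)) / k > 2 ^ 22 * U}"
  have pos: "0 < \<epsilon> * \<tau> m / 4" using \<epsilon> F by simp
  have "real (card ?V) \<le> B ^ k / 512"
  proof (rule markov_count)
    have "a \<le> m" using assms by simp
    have "(\<Sum>g\<in>?G. (grp k g a - \<tau> a)\<^sup>2) \<le> B ^ k * (2 * (\<tau> a)\<^sup>2 / k)"
      by (rule grp_variance) fact+
    also have "\<dots> \<le> B ^ k * (2 * (\<tau> m)\<^sup>2 / k)"
      using B \<open>a \<le> m\<close> by (intro mult_left_mono divide_right_mono power_mono) (auto simp: F2_mono)
    also have "\<dots> \<le> B ^ k * (2 * (\<tau> m)\<^sup>2 / (16384 / \<epsilon>\<^sup>2))"
      using B k \<epsilon> assms(5) by (intro mult_left_mono divide_left_mono) auto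
    also have "\<dots> = (\<epsilon> * \<tau> m / 4)\<^sup>2 * (B ^ k / 512)"
      by (simp add: power2_eq_square)
    finally show "(\<Sum>g\<in>?G. (grp k g a - \<tau> a)\<^sup>2) \<le> (\<epsilon> * \<tau> m / 4)\<^sup>2 * (B ^ k / 512)" .
    show "0 < (\<epsilon> * \<tau> m / 4)\<^sup>2" using pos by (rule zero_less_power)
  qed auto
  moreover have "real (card ?D) \<le> B ^ k / 512"
  proof (rule markov_count)
    have "(\<Sum>g\<in>?G. (\<Sum>j<k. dev a b (dig B j g)) / k) \<le> B ^ k * (7777 * U)"
      by (rule sum_grp_dev_le) fact+
    also have "\<dots> \<le> B ^ k * (8192 * U)"
      using B assms(3) by (intro mult_left_mono) auto
    finally show "(\<Sum>g\<in>?G. (\<Sum>j<k. dev a b (dig B j g)) / k) \<le> 2 ^ 22 * U * (B ^ k / 512)"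
      by (simp add: mult_ac)
  qed (use assms dev_nonneg in \<open>auto intro!: divide_nonneg_nonneg sum_nonneg\<close>)
  moreover have "bad k \<epsilon> U a b \<subseteq> ?V \<union> ?D"
  proof
    fix g assume "g \<in> bad k \<epsilon> U a b"
    moreover have "(\<epsilon> * \<tau> m / 4)\<^sup>2 < (grp k g a - \<tau> a)\<^sup>2" if "\<epsilon> * \<tau> m / 4 < \<bar>grp k g a - \<tau> a\<bar>"
      using power_strict_mono[OF that, of 2] pos by simp
    ultimately show "g \<in> ?V \<union> ?D" by (auto simp: bad_def)
  qed
  then have "card (bad k \<epsilon> U a b) \<le> card ?V + card ?D"
    by (intro order_trans[OF card_mono card_Un_le] finite_UnI finite_subset[OF Collect_subset]) auto
  ultimately show ?thesis by linarith
qed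

text \<open>The error budget, in multiples of \<epsilon> times the final \<open>F2\<close>: 1/4 at
  the start of the interval, 1/2 for the movement of the group value, and 1/4 for the growth of
  \<open>F2\<close> itself.\<close>

lemma not_bad_tracks:
  assumes g: "g \<in> {0..<B ^ k}" "g \<notin> bad k \<epsilon> U a b" and t: "t \<in> {a..b}" and b: "b \<le> m"
    and k: "k > 0" and \<epsilon>: "0 < \<epsilon>" "\<epsilon> < 1" and U: "U = \<epsilon>\<^sup>2 / (36 * 2 ^ 22) * \<tau> m" and ab: "\<tau> b - \<tau> a \<le> U"
  shows "\<bar>grp k g t - \<tau> t\<bar> \<le> \<epsilon> * \<tau> m"
proof -
  define F where "F = \<tau> m"
  have F: "F \<ge> 0" by (simp add: F_def)
  define A where "A j = cnt (dig B j g) a" for j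
  define E where "E j = cnt (dig B j g) t - cnt (dig B j g) a" for j
  have Ya: "\<bar>grp k g a - \<tau> a\<bar> \<le> \<epsilon> * F / 4"
    and D: "(\<Sum>j<k. dev a b (dig B j g)) / k \<le> 2 ^ 22 * U"
    using g by (auto simp: bad_def F_def)
  have E2: "(\<Sum>j<k. (E j)\<^sup>2) / k \<le> \<epsilon>\<^sup>2 / 36 * F"
  proof -
    have "(\<Sum>j<k. (E j)\<^sup>2) / k \<le> (\<Sum>j<k. dev a b (dig B j g)) / k"
      unfolding E_def using t by (intro divide_right_mono sum_mono dev_ge) auto
    also note D
    finally show ?thesis by (simp add: U F_def mult.commute)
  qed
  \<comment> \<open>With \<epsilon>/8 both parts of the bound \<open>pw\<close> contribute
    \<open>\<epsilon> * F / 4\<close>: the first since the mean of the squares at the start is at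
    most \<open>2 * F\<close>, the second since \<open>1 + 8 / \<epsilon> <= 9 / \<epsilon>\<close>
    is multiplied by \<open>\<epsilon>\<^sup>2 / 36 * F\<close>. This is where the 36 in
    \<open>U\<close> comes from.\<close>
  define \<eta> where "\<eta> = \<epsilon> / 8"
  have \<eta>: "\<eta> > 0" using \<epsilon> by (simp add: \<eta>_def)
  have pw: "\<bar>(A j + E j)\<^sup>2 - (A j)\<^sup>2\<bar> \<le> \<eta> * (A j)\<^sup>2 + (1 + 1 / \<eta>) * (E j)\<^sup>2" for j
  proof -
    have 1: "0 \<le> (\<eta> * A j - E j)\<^sup>2 / \<eta>" "0 \<le> (\<eta> * A j + E j)\<^sup>2 / \<eta>" using \<eta> by auto
    have "(\<eta> * A j - E j)\<^sup>2 / \<eta> = \<eta> * (A j)\<^sup>2 + 1 / \<eta> * (E j)\<^sup>2 - 2 * A j * E j"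
      "(\<eta> * A j + E j)\<^sup>2 / \<eta> = \<eta> * (A j)\<^sup>2 + 1 / \<eta> * (E j)\<^sup>2 + 2 * A j * E j"
      using \<eta> by (simp_all add: power2_eq_square field_simps)
    with 1 have "\<bar>2 * A j * E j\<bar> \<le> \<eta> * (A j)\<^sup>2 + 1 / \<eta> * (E j)\<^sup>2" by linarith
    moreover have "(A j + E j)\<^sup>2 - (A j)\<^sup>2 = 2 * A j * E j + (E j)\<^sup>2" by (simp add: power2_sum)
    moreover have "0 \<le> (E j)\<^sup>2" by simp
    ultimately show ?thesis unfolding ring_distribs by linarith
  qed
  have "\<bar>grp k g t - grp k g a\<bar> = \<bar>\<Sum>j<k. (A j + E j)\<^sup>2 - (A j)\<^sup>2\<bar> / k"
    using abs_divide[of "(\<Sum>j<k. (cnt (dig B j g) t)\<^sup>2) - (\<Sum>j<k. (cnt (dig B j g) a)\<^sup>2)" "real k"]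
    by (simp add: grp_def A_def E_def sum_subtractf diff_divide_distrib)
  also have "\<dots> \<le> (\<Sum>j<k. \<eta> * (A j)\<^sup>2 + (1 + 1 / \<eta>) * (E j)\<^sup>2) / k"
    by (intro divide_right_mono order_trans[OF sum_abs] sum_mono pw) simp
  also have "\<dots> = \<eta> * grp k g a + (1 + 1 / \<eta>) * ((\<Sum>j<k. (E j)\<^sup>2) / k)"
    by (simp add: grp_def A_def sum.distrib sum_distrib_left add_divide_distrib)
  also have "\<dots> \<le> \<eta> * (2 * F) + (1 + 1 / \<eta>) * (\<epsilon>\<^sup>2 / 36 * F)"
  proof (intro add_mono mult_left_mono E2)
    have "\<tau> a \<le> F" using t b by (simp add: F_def F2_mono)
    moreover have "\<epsilon> * F / 4 \<le> F" using \<epsilon> F mult_right_mono[of \<epsilon> 1 F] by simp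
    ultimately show "grp k g a \<le> 2 * F" using Ya by linarith
  qed (use \<eta> in auto)
  also have "(1 + 1 / \<eta>) * (\<epsilon>\<^sup>2 / 36 * F) \<le> (9 / \<epsilon>) * (\<epsilon>\<^sup>2 / 36 * F)"
    using \<epsilon> F by (intro mult_right_mono) (auto simp: \<eta>_def field_simps)
  also have "\<dots> = \<epsilon> * F / 4" using \<epsilon> by (simp add: power2_eq_square)
  also have "\<eta> * (2 * F) = \<epsilon> * F / 4" by (simp add: \<eta>_def)
  finally have 1: "\<bar>grp k g t - grp k g a\<bar> \<le> \<epsilon> * F / 2" by (simp add: mult.commute)
  have "\<tau> a \<le> \<tau> t" "\<tau> t \<le> \<tau> b" using t by (simp_all add: F2_mono)
  moreover have "U \<le> \<epsilon> * F / 4"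
  proof -
    have "\<epsilon>\<^sup>2 \<le> \<epsilon>" using \<epsilon> by (simp add: power2_eq_square mult_left_le)
    then have "\<epsilon>\<^sup>2 / (36 * 2 ^ 22) \<le> \<epsilon> / 4" using \<epsilon> by simp
    then have "\<epsilon>\<^sup>2 / (36 * 2 ^ 22) * F \<le> \<epsilon> / 4 * F" using F by (rule mult_right_mono)
    then show ?thesis by (simp add: U F_def)
  qed
  ultimately have "\<bar>\<tau> t - \<tau> a\<bar> \<le> \<epsilon> * F / 4" using ab by linarith
  with 1 Ya show ?thesis unfolding F_def by linarith
qed

end

text \<open>An exponential moment: a factor 256 for every bad digit has mean at most 2 per digit, so
  \<open>2 ^ R\<close> in all, while more than a quarter of bad digits makes the product exceed
  \<open>256 powr (R / 4) = 4 ^ R\<close>. Markov's inequality gives the ratio.\<close>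

lemma card_many_bad:
  fixes G :: int
  assumes "G > 0" "256 * real (card Bd) \<le> G" "Bd \<subseteq> {0..<G}"
  shows "real (card {X \<in> {0..<G ^ R}. R < 4 * card {r. r < R \<and> dig G r X \<in> Bd}}) \<le> G ^ R / 2 ^ R"
proof -
  define f where "f X = (\<Prod>r<R. if dig G r X \<in> Bd then 256 else 1 :: real)" for X
  have f: "f X = 4 ^ (4 * card {r. r < R \<and> dig G r X \<in> Bd})" for X
    unfolding f_def by (subst prod.If_cases) (simp_all add: power_mult Int_def)
  have "(\<Sum>X\<in>{0..<G ^ R}. f X) = (\<Prod>r<R. \<Sum>x\<in>{0..<G}. if x \<in> Bd then 256 else 1 :: real)"
    unfolding f_def using assms(1) by (rule sum_prod_dig)
  also have "(\<Sum>x\<in>{0..<G}. if x \<in> Bd then 256 else 1 :: real) \<le> 2 * real_of_int G"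
  proof -
    have "(\<Sum>x\<in>{0..<G}. if x \<in> Bd then 256 else 1 :: real) \<le> (\<Sum>x\<in>{0..<G}. 1 + 256 * indicator Bd x)"
      by (intro sum_mono) (auto simp: indicator_def)
    also have "\<dots> = real_of_int G + 256 * (\<Sum>x\<in>{0..<G}. indicator Bd x)"
      using assms(1) by (simp add: sum.distrib sum_distrib_left)
    also have "(\<Sum>x\<in>{0..<G}. indicator Bd x) = real (card Bd)"
      using assms(3) by (simp add: indicator_def sum.If_cases Int_absorb1)
    finally show ?thesis using assms(2) by linarith
  qed
  then have "(\<Prod>r<R. \<Sum>x\<in>{0..<G}. if x \<in> Bd then 256 else 1 :: real) \<le> (\<Prod>r<R. 2 * real_of_int G)"
    by (intro prod_mono) (auto intro!: sum_nonneg)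
  finally have "(\<Sum>X\<in>{0..<G ^ R}. f X) \<le> 4 ^ R * (G ^ R / 2 ^ R)"
    using power_mult_distrib[of "2 :: real" 2 R] by (simp add: power_mult_distrib)
  then have "real (card {X \<in> {0..<G ^ R}. f X > 4 ^ R}) \<le> G ^ R / 2 ^ R"
    by (intro markov_count) (auto simp: f)
  then show ?thesis by (simp add: f)
qed

section \<open>Union bound over the time intervals\<close>

context stream_hash
begin

text \<open>There are at most \<open>36 * 2 ^ 22 / \<epsilon>\<^sup>2 + 1\<close> intervals, and
  \<open>card_many_bad\<close> bounds the failure in each by \<open>1 / 2 ^ R\<close>. The
  hypothesis on \<open>R\<close> pays for their union.\<close>

theorem tracking:
  fixes \<epsilon> \<delta> :: real
  assumes \<epsilon>: "0 < \<epsilon>" "\<epsilon> < 1" and \<delta>: "0 < \<delta>" and k: "k > 0" "16384 / \<epsilon>\<^sup>2 \<le> k"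
    and R: "37 * 2 ^ 22 / (\<epsilon>\<^sup>2 * \<delta>) \<le> 2 ^ R"
  shows "real (card {X \<in> {0..<(B ^ k) ^ R}. \<exists>t\<le>m.
      R < 4 * card {r. r < R \<and> \<bar>grp k (dig (B ^ k) r X) t - \<tau> t\<bar> > \<epsilon> * \<tau> m}}) \<le> \<delta> * (B ^ k) ^ R"
    (is "real (card ?W) \<le> _")
proof (cases "\<tau> m = 0")
  case True
  have "m = 0"
  proof (rule ccontr)
    assume "m \<noteq> 0"
    then obtain m' where m': "m = Suc m'" using not0_implies_Suc by blast
    then have "F2 n ps m > 0" using F2_Suc[of ps m' n] item[of m'] by simp
    with True show False by simp
  qed
  then have "?W = {}" by (auto simp: grp_def cnt_def)
  then show ?thesis using \<delta> B by (simp only: card.empty) simp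
next
  case False
  then have F: "\<tau> m > 0" by simp
  define \<kappa> where "\<kappa> = \<epsilon>\<^sup>2 / (36 * 2 ^ 22)"
  define U where "U = \<kappa> * \<tau> m"
  have \<kappa>: "\<kappa> > 0" "\<kappa> \<le> 1" using \<epsilon> by (auto simp: \<kappa>_def power_le_one le_divide_eq intro: order_trans[of _ 1])
  have U: "U > 0" using \<kappa> F by (simp add: U_def)
  define q where "q = nat \<lfloor>1 / \<kappa>\<rfloor>"
  \<comment> \<open>Interval \<open>i\<close> starts when \<open>F2\<close> first reaches
    \<open>i * U\<close> and lasts as long as \<open>F2\<close> grows by at most \<open>U\<close>.
    It contains every \<open>t\<close> with \<open>F2\<close> between \<open>i * U\<close> and
    \<open>(i + 1) * U\<close>. One item may carry \<open>F2\<close> across several multiples of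
    \<open>U\<close>; then some intervals start at the same time.\<close>
  define a where "a i = (LEAST t. real i * U \<le> \<tau> t)" for i :: nat
  define b where "b i = Max {t. t \<le> m \<and> a i \<le> t \<and> \<tau> t - \<tau> (a i) \<le> U}" for i :: nat
  have ai: "a i \<le> m" "real i * U \<le> \<tau> (a i)" if "i \<le> q" for i
  proof -
    have "int i \<le> \<lfloor>1 / \<kappa>\<rfloor>" using that \<kappa> by (simp add: q_def le_nat_iff)
    then have "real i \<le> 1 / \<kappa>" by linarith
    then have "real i * U \<le> 1 / \<kappa> * U" using U by (intro mult_right_mono) auto
    then have *: "real i * U \<le> \<tau> m" using \<kappa> by (simp add: U_def)
    then show "a i \<le> m" unfolding a_def by (rule Least_le)
    show "real i * U \<le> \<tau> (a i)" unfolding a_def using * by (rule LeastI)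
  qed
  have bi: "b i \<in> {t. t \<le> m \<and> a i \<le> t \<and> \<tau> t - \<tau> (a i) \<le> U}" if "i \<le> q" for i
    unfolding b_def using ai[OF that] U by (intro Max_in) (auto intro!: exI[of _ "a i"])
  define Bd where "Bd i = bad k \<epsilon> U (a i) (b i)" for i
  define V where "V i = {X \<in> {0..<(B ^ k) ^ R}. R < 4 * card {r. r < R \<and> dig (B ^ k) r X \<in> Bd i}}" for i
  have G: "B ^ k > 0" using B by simp
  have V: "real (card (V i)) \<le> (B ^ k) ^ R / 2 ^ R" if "i \<le> q" for i
    unfolding V_def
  proof (rule card_many_bad[OF G])
    show "256 * real (card (Bd i)) \<le> B ^ k"
      unfolding Bd_def using bi[OF that] U k \<epsilon> F by (intro card_bad) auto
  qed (auto simp: Bd_def bad_def)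
  have "?W \<subseteq> (\<Union>i\<le>q. V i)"
  proof
    fix X assume "X \<in> ?W"
    then obtain t where X: "X \<in> {0..<(B ^ k) ^ R}" and t: "t \<le> m"
      and many: "R < 4 * card {r. r < R \<and> \<bar>grp k (dig (B ^ k) r X) t - \<tau> t\<bar> > \<epsilon> * \<tau> m}" by blast
    define i where "i = nat \<lfloor>\<tau> t / U\<rfloor>"
    have i: "real i \<le> \<tau> t / U" "\<tau> t / U < real i + 1"
      using U unfolding i_def by (auto simp: of_nat_nat)
    have "\<tau> t / U \<le> \<tau> m / U" using U t by (intro divide_right_mono) (auto simp: F2_mono)
    also have "\<dots> = 1 / \<kappa>" using F by (simp add: U_def)
    finally have iq: "i \<le> q" unfolding i_def q_def by (intro nat_mono floor_mono)
    have "real i * U \<le> \<tau> t" using i(1) U by (simp add: field_simps)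
    then have "a i \<le> t" unfolding a_def by (rule Least_le)
    have "\<tau> t - \<tau> (a i) \<le> U" using ai(2)[OF iq] i(2) U by (simp add: field_simps)
    with \<open>a i \<le> t\<close> t have tb: "t \<in> {a i..b i}" unfolding b_def by (auto intro!: Max_ge)
    have "dig (B ^ k) r X \<in> Bd i" if "\<bar>grp k (dig (B ^ k) r X) t - \<tau> t\<bar> > \<epsilon> * \<tau> m" for r
    proof (rule ccontr)
      assume "dig (B ^ k) r X \<notin> Bd i"
      then have "\<bar>grp k (dig (B ^ k) r X) t - \<tau> t\<bar> \<le> \<epsilon> * \<tau> m"
        unfolding Bd_def using bi[OF iq] tb k \<epsilon> dig_range[OF G]
        by (intro not_bad_tracks[where U = U]) (auto simp: U_def \<kappa>_def)
      with that show False by simp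
    qed
    then have "card {r. r < R \<and> \<bar>grp k (dig (B ^ k) r X) t - \<tau> t\<bar> > \<epsilon> * \<tau> m}
      \<le> card {r. r < R \<and> dig (B ^ k) r X \<in> Bd i}"
      by (intro card_mono) auto
    with many X iq show "X \<in> (\<Union>i\<le>q. V i)" by (fastforce simp: V_def)
  qed
  then have "card ?W \<le> card (\<Union>i\<le>q. V i)"
    by (rule card_mono[rotated]) (auto simp: V_def intro: finite_subset[of _ "{0..<(B ^ k) ^ R}"])
  also have "\<dots> \<le> (\<Sum>i\<le>q. card (V i))" by (rule card_UN_le) simp
  finally have "real (card ?W) \<le> (\<Sum>i\<le>q. real (card (V i)))" by (simp flip: of_nat_sum)
  also have "\<dots> \<le> (\<Sum>i\<le>q. (B ^ k) ^ R / 2 ^ R)" using V by (intro sum_mono) auto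
  also have "\<dots> = (real q + 1) / 2 ^ R * (B ^ k) ^ R" by simp
  also have "\<dots> \<le> \<delta> * (B ^ k) ^ R"
  proof (rule mult_right_mono)
    have "real q \<le> 1 / \<kappa>" using \<kappa> by (simp add: q_def)
    also have "\<dots> = 36 * 2 ^ 22 / \<epsilon>\<^sup>2" by (simp add: \<kappa>_def)
    finally have "real q + 1 \<le> 36 * 2 ^ 22 / \<epsilon>\<^sup>2 + 1" by simp
    also have "\<dots> \<le> 37 * 2 ^ 22 / \<epsilon>\<^sup>2"
    proof -
      have "\<epsilon>\<^sup>2 \<le> 1" using \<epsilon> by (intro power_le_one) auto
      then have "1 \<le> 2 ^ 22 / \<epsilon>\<^sup>2" using \<epsilon> by (simp add: le_divide_eq)
      then show ?thesis by simp
    qed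
    also have "\<dots> \<le> \<delta> * 2 ^ R" using R \<epsilon> \<delta> by (simp add: field_simps)
    finally show "(real q + 1) / 2 ^ R \<le> \<delta>" by (simp add: field_simps)
  qed (use B in auto)
  finally show ?thesis .
qed

end

section \<open>Approximate medians in linear time\<close>

text \<open>The position as tie-break, packed into one integer because positions are below
  \<open>R\<close>. Distinct keys make the ranks in a block a permutation, and the machine compares
  two keys by one subtraction.\<close>

definition key :: "nat \<Rightarrow> (nat \<Rightarrow> int) \<Rightarrow> nat \<Rightarrow> int" where
  "key R A p = A p * int R + int p"

definition block_rank :: "nat \<Rightarrow> (nat \<Rightarrow> int) \<Rightarrow> nat \<Rightarrow> nat \<Rightarrow> nat \<Rightarrow> nat" where
  "block_rank R A s b p = card {q \<in> {s..<s + b}. key R A q < key R A p}"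

lemma key_less:
  assumes "A p < A q" "p < R"
  shows "key R A p < key R A q"
proof -
  have "(A p + 1) * int R \<le> A q * int R" using assms by (intro mult_right_mono) auto
  then show ?thesis using assms by (simp add: key_def algebra_simps)
qed

lemma key_inj:
  assumes "key R A p = key R A q" "p < R" "q < R"
  shows "p = q"
proof -
  have "A p = A q" using key_less[of A p q R] key_less[of A q p R] assms by force
  with assms show ?thesis by (simp add: key_def)
qed

lemma block_rank_less:
  assumes "key R A p < key R A q" "p \<in> {s..<s + b}"
  shows "block_rank R A s b p < block_rank R A s b q"
  unfolding block_rank_def using assms by (intro psubset_card_mono) auto

lemma block_rank_lt: "p \<in> {s..<s + b} \<Longrightarrow> block_rank R A s b p < b"
proof -
  assume p: "p \<in> {s..<s + b}"
  then have "{q \<in> {s..<s + b}. key R A q < key R A p} \<subset> {s..<s + b}" by blast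
  from psubset_card_mono[OF _ this] show ?thesis by (simp add: block_rank_def)
qed

lemma block_rank_inj_on:
  assumes "s + b \<le> R"
  shows "inj_on (block_rank R A s b) {s..<s + b}"
proof (rule inj_onI)
  fix p q assume pq: "p \<in> {s..<s + b}" "q \<in> {s..<s + b}" "block_rank R A s b p = block_rank R A s b q"
  then have "key R A p = key R A q"
    using block_rank_less[of R A p q s b] block_rank_less[of R A q p s b] by force
  with pq assms show "p = q" by (intro key_inj[of R A]) auto
qed

text \<open>Ranks map a block bijectively onto \<open>{..<b}\<close>; the inverse lists the block in
  sorted order.\<close>

lemma sorted_block:
  assumes "s + b \<le> R"
  obtains p where "bij_betw p {..<b} {s..<s + b}"
    "\<And>i j. i \<le> j \<Longrightarrow> j < b \<Longrightarrow> A (p i) \<le> A (p j)" "\<And>j. j < b \<Longrightarrow> block_rank R A s b (p j) = j"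
proof -
  let ?r = "block_rank R A s b"
  have "?r ` {s..<s + b} \<subseteq> {..<b}" using block_rank_lt by auto
  moreover have "card (?r ` {s..<s + b}) = b" using card_image[OF block_rank_inj_on[OF assms]] by simp
  ultimately have "?r ` {s..<s + b} = {..<b}" by (intro card_subset_eq) auto
  then have bij: "bij_betw ?r {s..<s + b} {..<b}" using block_rank_inj_on[OF assms] by (simp add: bij_betw_def)
  define p where "p = inv_into {s..<s + b} ?r"
  have p: "bij_betw p {..<b} {s..<s + b}" unfolding p_def by (rule bij_betw_inv_into[OF bij])
  have r: "?r (p j) = j" if "j < b" for j
    using that bij_betw_inv_into_right[OF bij] by (simp add: p_def)
  have m: "A (p i) \<le> A (p j)" if "i \<le> j" "j < b" for i j
  proof (rule ccontr)
    have in_block: "p i \<in> {s..<s + b}" "p j \<in> {s..<s + b}"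
      using that bij_betwE[OF p] by auto
    assume "\<not> A (p i) \<le> A (p j)"
    then have "key R A (p j) < key R A (p i)" using in_block assms by (intro key_less) auto
    from block_rank_less[OF this in_block(2)] show False using r that by auto
  qed
  show ?thesis by (rule that[OF p m r])
qed

text \<open>Half-lines stand for the values that are too large or too small; quality of a median is
  measured by how many entries lie in them.\<close>

definition up_closed :: "(int \<Rightarrow> bool) \<Rightarrow> bool" where
  "up_closed S \<longleftrightarrow> (\<forall>x y. x \<le> y \<longrightarrow> S x \<longrightarrow> S y)"

definition down_closed :: "(int \<Rightarrow> bool) \<Rightarrow> bool" where
  "down_closed S \<longleftrightarrow> (\<forall>x y. x \<le> y \<longrightarrow> S y \<longrightarrow> S x)"

text \<open>The loss 3 comes from upper half-lines: the lowest kept entry in \<open>S\<close>, of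
  rank \<open>4 * i + 3\<close>, vouches only for the \<open>4 * (c - i) - 3\<close> entries from
  there on. For lower half-lines the highest one vouches for \<open>4 * i + 4\<close> entries and
  nothing is lost.\<close>

lemma card_every_fourth:
  fixes a :: "nat \<Rightarrow> int"
  assumes mono: "\<And>i j. i \<le> j \<Longrightarrow> j < 4 * c \<Longrightarrow> a i \<le> a j" and S: "up_closed S \<or> down_closed S"
  shows "4 * card {i. i < c \<and> S (a (4 * i + 3))} \<le> card {j. j < 4 * c \<and> S (a j)} + 3"
proof (cases "{i. i < c \<and> S (a (4 * i + 3))} = {}")
  case False
  let ?K = "{i. i < c \<and> S (a (4 * i + 3))}"
  let ?J = "{j. j < 4 * c \<and> S (a j)}"
  have fin: "finite ?K" by simp
  from S show ?thesis
  proof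
    assume up: "up_closed S"
    define i where "i = Min ?K"
    have i: "i \<in> ?K" unfolding i_def by (rule Min_in[OF fin False])
    have "?K \<subseteq> {i..<c}" using Min_le[OF fin] by (auto simp: i_def)
    from card_mono[OF _ this] have "card ?K \<le> c - i" by simp
    moreover have "{4 * i + 3..<4 * c} \<subseteq> ?J"
      using i mono up by (fastforce simp: up_closed_def)
    from card_mono[OF _ this] have "4 * c - (4 * i + 3) \<le> card ?J" by simp
    moreover have "i < c" using i by simp
    ultimately show ?thesis by linarith
  next
    assume down: "down_closed S"
    define i where "i = Max ?K"
    have i: "i \<in> ?K" unfolding i_def by (rule Max_in[OF fin False])
    have "?K \<subseteq> {..i}" using Max_ge[OF fin] by (auto simp: i_def)
    from card_mono[OF _ this] have "card ?K \<le> Suc i" by simp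
    moreover have "{..4 * i + 3} \<subseteq> ?J"
    proof
      fix j assume j: "j \<in> {..4 * i + 3}"
      have "4 * i + 3 < 4 * c" using i by simp
      with j mono[of j "4 * i + 3"] have "a j \<le> a (4 * i + 3)" "j < 4 * c" by auto
      with i down show "j \<in> ?J" unfolding down_closed_def by blast
    qed
    from card_mono[OF _ this] have "4 * i + 4 \<le> card ?J" by simp
    ultimately show ?thesis by linarith
  qed
qed (simp only: card.empty)

text \<open>
  In every block of length \<open>b\<close> the entries of rank 3, 7, 11, \<dots> are kept.  Their positions in the
  output are such that the output of a block is contiguous and sorted.
\<close>

definition out_index :: "nat \<Rightarrow> (nat \<Rightarrow> int) \<Rightarrow> nat \<Rightarrow> nat \<Rightarrow> nat" where
  "out_index R A b p = (p div b * b + Suc (block_rank R A (p div b * b) b p)) div 4 - 1"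

definition kept :: "nat \<Rightarrow> (nat \<Rightarrow> int) \<Rightarrow> nat \<Rightarrow> nat \<Rightarrow> bool" where
  "kept R A b p \<longleftrightarrow> 4 dvd Suc (block_rank R A (p div b * b) b p)"

text \<open>A relation that constrains \<open>A'\<close> at the output positions only, so that
  \<open>A'\<close> may be the raw memory contents after a pass.\<close>

definition reduces :: "nat \<Rightarrow> nat \<Rightarrow> nat \<Rightarrow> (nat \<Rightarrow> int) \<Rightarrow> (nat \<Rightarrow> int) \<Rightarrow> bool" where
  "reduces R b N A A' \<longleftrightarrow> (\<forall>p<N. kept R A b p \<longrightarrow> A' (out_index R A b p) = A p)"

lemma in_block: "b > 0 \<Longrightarrow> p \<in> {p div b * b..<p div b * b + b}" for p b :: nat
  using div_mult_mod_eq[of p b] mod_less_divisor[of b p] unfolding atLeastLessThan_iff by linarith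

lemma block_bound:
  fixes p b M :: nat
  assumes "p < M * b"
  shows "p div b * b + b \<le> M * b"
proof -
  have "p div b < M" using assms by (simp add: less_mult_imp_div_less)
  then have "Suc (p div b) * b \<le> M * b" by (intro mult_le_mono1) simp
  then show ?thesis by simp
qed

text \<open>Four times the index plus 4 is block start plus rank plus 1; this determines the block,
  then the rank, then the entry. Hence a pass never overwrites what it has stored.\<close>

lemma out_index_inj:
  assumes "p < M * b" "q < M * b" "M * b \<le> R" "4 dvd b" "kept R A b p" "kept R A b q"
    and eq: "out_index R A b p = out_index R A b q"
  shows "p = q"
proof -
  define r where "r p = block_rank R A (p div b * b) b p" for p
  have b: "b > 0" using assms(1) by (cases b) auto
  have dv: "4 dvd x div b * b + Suc (r x)" if "kept R A b x" for x
    using assms(4) that unfolding kept_def r_def by (intro dvd_add) auto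
  note dv = dv[OF assms(5)] dv[OF assms(6)]
  have rb: "r p < b" "r q < b" unfolding r_def by (intro block_rank_lt in_block b)+
  have "(p div b * b + Suc (r p)) div 4 \<ge> 1" "(q div b * b + Suc (r q)) div 4 \<ge> 1"
    using dv by (auto elim!: dvdE)
  with eq have "(p div b * b + Suc (r p)) div 4 = (q div b * b + Suc (r q)) div 4"
    unfolding out_index_def r_def[symmetric] by linarith
  with dv have *: "r p + p div b * b = r q + q div b * b"
    by (metis add_Suc_right add.commute nat.inject dvd_div_mult_self)
  have "(r p + p div b * b) div b = p div b" "(r q + q div b * b) div b = q div b"
    using rb b by simp_all
  with * have d: "p div b = q div b" by simp
  with * have "block_rank R A (p div b * b) b p = block_rank R A (p div b * b) b q" by (simp add: r_def)
  moreover have "p div b * b + b \<le> R" using block_bound[OF assms(1)] assms(3) by linarith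
  moreover have "q \<in> {p div b * b..<p div b * b + b}" using in_block[OF b, of q] d by simp
  ultimately show ?thesis using in_block[OF b, of p] block_rank_inj_on by (blast dest: inj_onD)
qed

lemma reduces_block:
  assumes red: "reduces R (4 * c) (M * (4 * c)) A A'" and R: "M * (4 * c) \<le> R" and \<beta>: "\<beta> < M"
  obtains a p where "bij_betw p {..<4 * c} {\<beta> * (4 * c)..<\<beta> * (4 * c) + 4 * c}"
    "\<And>j. j < 4 * c \<Longrightarrow> a j = A (p j)" "\<And>i j. i \<le> j \<Longrightarrow> j < 4 * c \<Longrightarrow> a i \<le> a j"
    "\<And>i. i < c \<Longrightarrow> A' (\<beta> * c + i) = a (4 * i + 3)"
proof -
  let ?b = "4 * c"
  let ?s = "\<beta> * ?b"
  have "Suc \<beta> * ?b \<le> M * ?b" using \<beta> by (intro mult_le_mono1) simp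
  then have sb: "?s + ?b \<le> M * ?b" by simp
  with R have "?s + ?b \<le> R" by linarith
  from sorted_block[OF this, of A] obtain p where p: "bij_betw p {..<?b} {?s..<?s + ?b}"
    "\<And>i j. i \<le> j \<Longrightarrow> j < ?b \<Longrightarrow> A (p i) \<le> A (p j)" "\<And>j. j < ?b \<Longrightarrow> block_rank R A ?s ?b (p j) = j" by metis
  have "A' (\<beta> * c + i) = A (p (4 * i + 3))" if i: "i < c" for i
  proof -
    let ?q = "p (4 * i + 3)"
    have j: "4 * i + 3 < ?b" using i by simp
    then have q: "?q \<in> {?s..<?s + ?b}" using bij_betwE[OF p(1)] by auto
    then have "?q div ?b = \<beta>"
      by (intro div_nat_eqI) (auto simp: algebra_simps)
    then have *: "block_rank R A (?q div ?b * ?b) ?b ?q = 4 * i + 3" using p(3)[OF j] by simp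
    have "?q < M * ?b" using q sb by simp
    moreover have "kept R A ?b ?q" unfolding kept_def * by presburger
    moreover have "out_index R A ?b ?q = \<beta> * c + i"
      unfolding out_index_def \<open>?q div ?b = \<beta>\<close> p(3)[OF j] by simp
    ultimately show ?thesis using red unfolding reduces_def by metis
  qed
  with p show ?thesis by (intro that[of p "\<lambda>j. A (p j)"]) auto
qed

lemma card_blocks:
  fixes b M :: nat
  shows "card {p. p < M * b \<and> Q p} = (\<Sum>\<beta><M. card {p \<in> {\<beta> * b..<\<beta> * b + b}. Q p})"
proof (induction M)
  case (Suc M)
  have eq: "{p. p < Suc M * b \<and> Q p} = {p. p < M * b \<and> Q p} \<union> {p \<in> {M * b..<M * b + b}. Q p}"
    by auto
  have "card {p. p < Suc M * b \<and> Q p} = card {p. p < M * b \<and> Q p} + card {p \<in> {M * b..<M * b + b}. Q p}"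
    unfolding eq by (intro card_Un_disjoint) auto
  then show ?case using Suc by simp
qed simp

text \<open>The loss of \<open>card_every_fourth\<close>, summed over the \<open>M\<close>
  blocks.\<close>

lemma card_reduces:
  assumes red: "reduces R (4 * c) (M * (4 * c)) A A'" and R: "M * (4 * c) \<le> R"
    and S: "up_closed S \<or> down_closed S"
  shows "4 * card {i. i < M * c \<and> S (A' i)} \<le> card {p. p < M * (4 * c) \<and> S (A p)} + 3 * M"
proof -
  have "4 * card {i \<in> {\<beta> * c..<\<beta> * c + c}. S (A' i)}
      \<le> card {p \<in> {\<beta> * (4 * c)..<\<beta> * (4 * c) + 4 * c}. S (A p)} + 3" if \<beta>: "\<beta> < M" for \<beta>
  proof -
    obtain a p where p: "bij_betw p {..<4 * c} {\<beta> * (4 * c)..<\<beta> * (4 * c) + 4 * c}"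
      "\<And>j. j < 4 * c \<Longrightarrow> a j = A (p j)" "\<And>i j. i \<le> j \<Longrightarrow> j < 4 * c \<Longrightarrow> a i \<le> a j"
      "\<And>i. i < c \<Longrightarrow> A' (\<beta> * c + i) = a (4 * i + 3)" using reduces_block[OF red R \<beta>] by metis
    have "{i \<in> {\<beta> * c..<\<beta> * c + c}. S (A' i)} = (\<lambda>i. \<beta> * c + i) ` {i. i < c \<and> S (a (4 * i + 3))}"
    proof (intro set_eqI iffI)
      fix i assume i: "i \<in> {i \<in> {\<beta> * c..<\<beta> * c + c}. S (A' i)}"
      then have "i = \<beta> * c + (i - \<beta> * c)" "i - \<beta> * c < c" by auto
      with i p(4)[of "i - \<beta> * c"] show "i \<in> (\<lambda>i. \<beta> * c + i) ` {i. i < c \<and> S (a (4 * i + 3))}"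
        by (intro image_eqI[of _ _ "i - \<beta> * c"]) auto
    qed (use p(4) in auto)
    then have "card {i \<in> {\<beta> * c..<\<beta> * c + c}. S (A' i)} = card {i. i < c \<and> S (a (4 * i + 3))}"
      by (simp add: card_image)
    moreover have "card {p \<in> {\<beta> * (4 * c)..<\<beta> * (4 * c) + 4 * c}. S (A p)} = card {j. j < 4 * c \<and> S (a j)}"
    proof -
      have "p ` {j. j < 4 * c \<and> S (a j)} = {q \<in> p ` {..<4 * c}. S (A q)}" using p(2) by auto
      also have "p ` {..<4 * c} = {\<beta> * (4 * c)..<\<beta> * (4 * c) + 4 * c}" using p(1) by (simp add: bij_betw_def)
      finally have "bij_betw p {j. j < 4 * c \<and> S (a j)} {q \<in> {\<beta> * (4 * c)..<\<beta> * (4 * c) + 4 * c}. S (A q)}"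
        using p(1) by (auto simp: bij_betw_def intro: inj_on_subset)
      then show ?thesis by (simp add: bij_betw_same_card)
    qed
    ultimately show ?thesis using card_every_fourth[OF p(3) S] by simp
  qed
  then have "(\<Sum>\<beta><M. 4 * card {i \<in> {\<beta> * c..<\<beta> * c + c}. S (A' i)})
      \<le> (\<Sum>\<beta><M. card {p \<in> {\<beta> * (4 * c)..<\<beta> * (4 * c) + 4 * c}. S (A p)} + 3)"
    by (intro sum_mono) auto
  then show ?thesis by (simp add: card_blocks sum.distrib sum_distrib_left)
qed

text \<open>
  Pass \<open>i\<close> distorts ranks by at most \<open>3 / 2 ^ (i + 7)\<close> of the length of the array, which is summable, whereas
  the work \<open>N\<^sub>i * 2 ^ (i + 7)\<close> decreases geometrically since \<open>N\<^sub>i\<close> decreases by a factor 4.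
\<close>

lemma approx_median:
  fixes A :: "nat \<Rightarrow> nat \<Rightarrow> int"
  assumes red: "\<And>i. i \<le> l \<Longrightarrow> reduces (2 ^ (7 + 3 * l)) (2 ^ (7 + i)) (2 ^ (7 + 3 * l - 2 * i)) (A i) (A (Suc i))"
    and S: "up_closed S \<or> down_closed S"
    and few: "4 * card {p. p < 2 ^ (7 + 3 * l) \<and> S (A 0 p)} \<le> 2 ^ (7 + 3 * l)"
  shows "\<not> S (A (Suc l) (2 ^ (l + 4)))"
proof -
  define N :: "nat \<Rightarrow> nat" where "N i = 2 ^ (7 + 3 * l - 2 * i)" for i
  \<comment> \<open>The array lengths shrink by 4 and the block lengths double from 128; the choice
    of \<open>2 ^ (7 + 3 * l)\<close> entries makes them meet in the last pass, where
    \<open>M l = 1\<close>.\<close>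
  define M :: "nat \<Rightarrow> nat" where "M i = 2 ^ (3 * (l - i))" for i
  define h where "h i = card {p. p < N i \<and> S (A i p)}" for i
  have NM: "N i = M i * (4 * 2 ^ (5 + i))" "N (Suc i) = M i * 2 ^ (5 + i)" "N i \<le> 2 ^ (7 + 3 * l)" if "i \<le> l" for i
  proof -
    have "7 + 3 * l - 2 * i = 3 * (l - i) + (2 + (5 + i))" using that by simp
    then show "N i = M i * (4 * 2 ^ (5 + i))" unfolding N_def M_def by (simp only: power_add) simp
    have "7 + 3 * l - 2 * Suc i = 3 * (l - i) + (5 + i)" using that by simp
    then show "N (Suc i) = M i * 2 ^ (5 + i)" unfolding N_def M_def by (simp only: power_add)
    show "N i \<le> 2 ^ (7 + 3 * l)" unfolding N_def by (intro power_increasing) auto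
  qed
  have red': "reduces (2 ^ (7 + 3 * l)) (4 * 2 ^ (5 + i)) (M i * (4 * 2 ^ (5 + i))) (A i) (A (Suc i))"
    if "i \<le> l" for i
    using red[OF that] NM(1)[OF that] by (simp add: N_def power_add)
  have step: "4 * h (Suc i) \<le> h i + 3 * M i" if "i \<le> l" for i
    using card_reduces[OF red'[OF that] _ S] NM[OF that] unfolding h_def by simp
  \<comment> \<open>Measured in entries of the original array, pass \<open>i\<close> adds
    \<open>3 * M i * 4 ^ i = 3 * 8 ^ l / 2 ^ i\<close>, a geometric series below
    \<open>6 * 8 ^ l\<close>. The invariant is the bound on its partial sum, multiplied by
    \<open>2 ^ i\<close> to stay in the natural numbers.\<close>
  have "h i * 4 ^ i * 2 ^ i + 6 * 8 ^ l \<le> (h 0 + 6 * 8 ^ l) * 2 ^ i" if "i \<le> Suc l" for i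
    using that
  proof (induction i)
    case (Suc i)
    have il: "i \<le> l" using Suc.prems by simp
    have "(8::nat) ^ i * M i = 8 ^ i * 8 ^ (l - i)" by (simp add: M_def power_mult)
    also have "\<dots> = 8 ^ l" using il by (simp flip: power_add)
    finally have 8: "4 ^ i * 2 ^ i * M i = 8 ^ l" by (simp flip: power_mult_distrib)
    have "h (Suc i) * 4 ^ Suc i * 2 ^ Suc i = 2 * (4 ^ i * 2 ^ i) * (4 * h (Suc i))" by simp
    also have "\<dots> \<le> 2 * (4 ^ i * 2 ^ i) * (h i + 3 * M i)" by (intro mult_le_mono2 step il)
    also have "\<dots> = 2 * (h i * 4 ^ i * 2 ^ i) + 6 * (4 ^ i * 2 ^ i * M i)" by (simp add: algebra_simps)
    also have "\<dots> = 2 * (h i * 4 ^ i * 2 ^ i) + 6 * 8 ^ l" unfolding 8 by simp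
    finally have "h (Suc i) * 4 ^ Suc i * 2 ^ Suc i + 6 * 8 ^ l \<le> 2 * (h i * 4 ^ i * 2 ^ i + 6 * 8 ^ l)" by simp
    also have "\<dots> \<le> 2 * ((h 0 + 6 * 8 ^ l) * 2 ^ i)" using Suc by simp
    finally show ?case by simp
  qed simp
  from this[of "Suc l"] have "h (Suc l) * 4 ^ Suc l * 2 ^ Suc l \<le> (h 0 + 6 * 8 ^ l) * 2 ^ Suc l" by linarith
  then have "h (Suc l) * 4 ^ Suc l \<le> h 0 + 6 * 8 ^ l" by simp
  also have "h 0 \<le> 32 * 8 ^ l"
    using few by (simp add: h_def N_def power_add power_mult)
  \<comment> \<open>In units of \<open>8 ^ l\<close> the input has 128 entries: a quarter of it is
    32, the distortion is 6, and half of it is 64.\<close>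
  also have "32 * 8 ^ l + 6 * 8 ^ l < 64 * (8::nat) ^ l" by simp
  also have "64 * (8::nat) ^ l = 2 ^ (l + 4) * 4 ^ Suc l"
    using power_mult_distrib[of "2::nat" 4 l] by (simp add: power_add)
  finally have small: "h (Suc l) < 2 ^ (l + 4)" by simp
  have "M l * (4 * 2 ^ (5 + l)) \<le> 2 ^ (7 + 3 * l)" "0 < M l"
    using NM[of l] by (auto simp: M_def)
  from reduces_block[OF red'[OF order_refl] this]
  obtain a p where a: "bij_betw p {..<4 * 2 ^ (5 + l)} {0 * (4 * 2 ^ (5 + l))..<0 * (4 * 2 ^ (5 + l)) + 4 * 2 ^ (5 + l)}"
    "\<And>j. j < 4 * 2 ^ (5 + l) \<Longrightarrow> a j = A l (p j)"
    "\<And>i j. i \<le> j \<Longrightarrow> j < 4 * 2 ^ (5 + l) \<Longrightarrow> a i \<le> (a j :: int)"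
    "\<And>i. i < 2 ^ (5 + l) \<Longrightarrow> A (Suc l) (0 * 2 ^ (5 + l) + i) = a (4 * i + 3)" by metis
  \<comment> \<open>The last pass consists of one block, so its output is sorted. If its middle
    entry satisfied \<open>S\<close>, so would half of the output, contradicting
    \<open>small\<close>.\<close>
  have mono: "A (Suc l) i \<le> A (Suc l) j" if "i \<le> j" "j < 2 ^ (5 + l)" for i j
    using a(3)[of "4 * i + 3" "4 * j + 3"] a(4)[of i] a(4)[of j] that by simp
  have N: "N (Suc l) = 2 ^ (l + 4) + 2 ^ (l + 4)" using NM(2)[of l] by (simp add: M_def power_add)
  have N': "2 ^ (5 + l) = N (Suc l)" using N by (simp add: power_add)
  show ?thesis
  proof
    assume x: "S (A (Suc l) (2 ^ (l + 4)))"
    let ?m = "2 ^ (l + 4) :: nat"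
    have "2 ^ (l + 4) \<le> h (Suc l)"
      using S
    proof
      assume up: "up_closed S"
      have "{?m..<?m + ?m} \<subseteq> {p. p < N (Suc l) \<and> S (A (Suc l) p)}"
      proof
        fix p assume "p \<in> {?m..<?m + ?m}"
        with mono[of ?m p] N N' x up show "p \<in> {p. p < N (Suc l) \<and> S (A (Suc l) p)}"
          unfolding up_closed_def by auto
      qed
      from card_mono[OF _ this] show ?thesis by (simp add: h_def)
    next
      assume down: "down_closed S"
      have "{..<?m} \<subseteq> {p. p < N (Suc l) \<and> S (A (Suc l) p)}"
      proof
        fix p assume "p \<in> {..<?m}"
        with mono[of p ?m] N N' x down show "p \<in> {p. p < N (Suc l) \<and> S (A (Suc l) p)}"
          unfolding down_closed_def by auto
      qed
      from card_mono[OF _ this] show ?thesis by (simp add: h_def)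
    qed
    with small show False by simp
  qed
qed

section \<open>Lengths of integers in words\<close>

lemma bitlen_abs_mono: "\<bar>x\<bar> \<le> \<bar>y\<bar> \<Longrightarrow> bitlen \<bar>x\<bar> \<le> bitlen \<bar>y\<bar>"
  unfolding bitlen_def by (intro of_nat_mono floorlog_mono) auto

lemma words_mono: "\<bar>x\<bar> \<le> \<bar>y\<bar> \<Longrightarrow> words w x \<le> words w y"
  unfolding words_def
  by (intro nat_mono ceiling_mono divide_right_mono) (auto intro: bitlen_abs_mono)

lemma words_le:
  assumes "\<bar>x\<bar> < 2 ^ b" "w > 0" "Suc b \<le> c * w"
  shows "words w x \<le> c"
proof -
  have "bitlen \<bar>x\<bar> \<le> b"
    using assms(1) by (cases "x = 0") (auto simp: bitlen_le_iff_power)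
  then have "real_of_int (bitlen \<bar>x\<bar> + 1) \<le> real (c * w)"
    using assms(3) by linarith
  then have "real_of_int (bitlen \<bar>x\<bar> + 1) / real w \<le> real c"
    using assms(2) by (simp add: field_simps)
  then show ?thesis unfolding words_def by (simp add: nat_le_iff ceiling_le_iff)
qed

lemma words_le_bits:
  assumes "\<bar>x\<bar> < 2 ^ b" "w > 0"
  shows "words w x \<le> Suc b"
  using assms mult_le_mono2[of 1 w "Suc b"] by (intro words_le[where b = b]) simp_all

section \<open>A program logic for deterministic programs\<close>

type_synonym store = "nat \<Rightarrow> int"

fun istep :: "instr \<Rightarrow> store \<Rightarrow> store" where
  "istep (Const a c) \<sigma> = \<sigma>(a := c)"
| "istep (Arith f a b c) \<sigma> = \<sigma>(a := arith f (\<sigma> b) (\<sigma> c))"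
| "istep (Load a b) \<sigma> = \<sigma>(a := \<sigma> (nat (\<sigma> b)))"
| "istep (Store a b) \<sigma> = \<sigma>(nat (\<sigma> a) := \<sigma> b)"
| "istep (Rand a b) \<sigma> = \<sigma>"

text \<open>The side condition under which an instruction respects the cell bounds and costs at most
  one \<open>tick\<close>. \<open>Rand\<close> is excluded because the logic describes single
  outcomes.\<close>

fun iok :: "nat \<Rightarrow> (nat \<Rightarrow> int) \<Rightarrow> instr \<Rightarrow> store \<Rightarrow> bool" where
  "iok L bd (Const a c) \<sigma> \<longleftrightarrow> a < 32 \<and> \<bar>c\<bar> \<le> bd a"
| "iok L bd (Arith f a b c) \<sigma> \<longleftrightarrow> a < 32 \<and> b < 32 \<and> c < 32 \<and> \<bar>arith f (\<sigma> b) (\<sigma> c)\<bar> \<le> bd a"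
| "iok L bd (Load a b) \<sigma> \<longleftrightarrow> a < 32 \<and> b < 32 \<and> 0 \<le> \<sigma> b \<and> \<sigma> b < int L \<and> \<bar>\<sigma> (nat (\<sigma> b))\<bar> \<le> bd a"
| "iok L bd (Store a b) \<sigma> \<longleftrightarrow> a < 32 \<and> b < 32 \<and> 0 \<le> \<sigma> a \<and> \<sigma> a < int L \<and> \<bar>\<sigma> b\<bar> \<le> bd (nat (\<sigma> a))"
| "iok L bd (Rand a b) \<sigma> \<longleftrightarrow> False"

definition conc :: "nat \<Rightarrow> store \<Rightarrow> memory" where
  "conc L \<sigma> = map \<sigma> [0..<L]"

lemma length_conc [simp]: "length (conc L \<sigma>) = L"
  by (simp add: conc_def)

lemma rd_conc [simp]: "a < L \<Longrightarrow> rd (conc L \<sigma>) a = \<sigma> a"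
  by (simp add: conc_def rd_def)

lemma conc_update: "(conc L \<sigma>)[a := v] = conc L (\<sigma>(a := v))"
  by (rule nth_equalityI) (auto simp: conc_def nth_list_update)

text \<open>
  The bound \<open>bd a\<close> on the contents of cell \<open>a\<close> controls the storage, and the common
  bound \<open>V\<close> of all cells controls the time of a single instruction.  Programs use
  only the cells below 32 as direct operands.
\<close>

locale machine =
  fixes w L :: nat and bd :: "nat \<Rightarrow> int" and V :: int and P \<kappa> :: nat
  assumes w: "w > 0" and L: "32 \<le> L"
    and bd: "\<And>a. a < L \<Longrightarrow> \<bar>bd a\<bar> \<le> V"
    and P: "(\<Sum>a<L. words w (bd a)) \<le> P"
    and \<kappa>: "words w V \<le> \<kappa>"
begin

definition good :: "store \<Rightarrow> bool" where
  "good \<sigma> \<longleftrightarrow> (\<forall>a<L. \<bar>\<sigma> a\<bar> \<le> bd a)"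

text \<open>One operation code and three register names of at most 6 words give 19. The square is
  the schoolbook cost of arithmetic; \<open>2 * \<kappa>\<close> covers the operands of
  \<open>Const\<close>, \<open>Load\<close> and \<open>Store\<close>.\<close>

definition tick :: nat where
  "tick = 19 + 2 * \<kappa> + \<kappa> * \<kappa>"

text \<open>Termination is included, since the outcome is a \<open>return_spmf\<close>. Bounds
  relative to an arbitrary clock and peak at the start make runs composable.\<close>

definition gives :: "(mstate \<Rightarrow> mstate spmf) \<Rightarrow> nat \<Rightarrow> store \<Rightarrow> store \<Rightarrow> bool" where
  "gives f T \<sigma> \<sigma>' \<longleftrightarrow> (\<forall>s. memo s = conc L \<sigma> \<longrightarrow> peak s \<le> P \<longrightarrow>
     (\<exists>s'. f s = return_spmf s' \<and> memo s' = conc L \<sigma>' \<and> clock s' \<le> clock s + T * tick \<and> peak s' \<le> P))"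

text \<open>A total-correctness triple for one initial store. Goodness is assumed and re-established
  by every command, which keeps the bounds on all cells out of the invariants.\<close>

definition ok :: "com \<Rightarrow> nat \<Rightarrow> store \<Rightarrow> (store \<Rightarrow> bool) \<Rightarrow> bool" where
  "ok c T \<sigma> Q \<longleftrightarrow> (good \<sigma> \<longrightarrow> (\<exists>\<sigma>'. good \<sigma>' \<and> Q \<sigma>' \<and> gives (exec w c) T \<sigma> \<sigma>'))"

lemma words_cell: "good \<sigma> \<Longrightarrow> a < L \<Longrightarrow> words w (\<sigma> a) \<le> \<kappa>"
  using words_mono[of "\<sigma> a" V w] \<kappa> bd[of a] unfolding good_def by force

lemma words_bd: "\<bar>x\<bar> \<le> bd a \<Longrightarrow> a < L \<Longrightarrow> words w x \<le> \<kappa>"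
  using words_mono[of x V w] \<kappa> bd[of a] by force

lemma mem_words_conc: 
  assumes "good \<sigma>" shows "mem_words w (conc L \<sigma>) \<le> P"
proof -
  have "mem_words w (conc L \<sigma>) = (\<Sum>a<L. words w (\<sigma> a))"
    by (simp add: mem_words_def conc_def comp_def interv_sum_list_conv_sum_set_nat atLeast0LessThan)
  also have "\<dots> \<le> (\<Sum>a<L. words w (bd a))"
    using assms by (intro sum_mono words_mono) (auto simp: good_def)
  finally show ?thesis using P by simp
qed

lemma awords_reg: "a < 32 \<Longrightarrow> awords w a \<le> 6"
  using w by (intro words_le_bits[where b = 5, simplified]) auto

lemma peak_advance: "good \<sigma> \<Longrightarrow> peak s \<le> P \<Longrightarrow> peak (advance w k (conc L \<sigma>) s) \<le> P"
  by (simp add: advance_def mem_words_conc)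

lemma ok_weaken: "ok c T \<sigma> Q \<Longrightarrow> (\<And>\<sigma>'. good \<sigma>' \<Longrightarrow> Q \<sigma>' \<Longrightarrow> Q' \<sigma>') \<Longrightarrow> T \<le> T' \<Longrightarrow> ok c T' \<sigma> Q'"
  unfolding ok_def gives_def by (meson add_left_mono mult_right_mono order_trans zero_le)

lemma ok_good: "(good \<sigma> \<Longrightarrow> ok c T \<sigma> Q) \<Longrightarrow> ok c T \<sigma> Q"
  by (auto simp: ok_def)

lemma ok_Skip: "Q \<sigma> \<Longrightarrow> ok Skip 0 \<sigma> Q"
  by (auto simp: ok_def gives_def)

lemma instr_sem_conc:
  assumes "iok L bd i \<sigma>"
  shows "instr_sem i (conc L \<sigma>) = return_spmf (conc L (istep i \<sigma>))"
  using assms L by (cases i) (auto simp: conc_update nat_less_iff)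

lemma good_istep: "good \<sigma> \<Longrightarrow> iok L bd i \<sigma> \<Longrightarrow> good (istep i \<sigma>)"
  by (cases i) (auto simp: good_def)

lemma instr_cost_conc:
  assumes "good \<sigma>" "iok L bd i \<sigma>"
  shows "instr_cost w i (conc L \<sigma>) \<le> tick"
proof (cases i)
  case (Const a c)
  with assms have "awords w a \<le> 6" "words w c \<le> \<kappa>" using L by (auto intro: awords_reg words_bd)
  with Const show ?thesis by (simp add: instr_cost_def tick_def)
next
  case (Arith f a b c)
  with assms have "awords w a \<le> 6" "awords w b \<le> 6" "awords w c \<le> 6" "b < L" "c < L"
    "words w (\<sigma> b) \<le> \<kappa>" "words w (\<sigma> c) \<le> \<kappa>" using L by (auto intro: awords_reg words_cell)
  moreover from this have "words w (\<sigma> b) * words w (\<sigma> c) \<le> \<kappa> * \<kappa>" by (intro mult_mono) auto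
  ultimately show ?thesis using Arith by (simp add: instr_cost_def tick_def)
next
  case (Load a b)
  with assms have "awords w a \<le> 6" "awords w b \<le> 6" "b < L" "nat (\<sigma> b) < L"
    "words w (\<sigma> b) \<le> \<kappa>" "words w (\<sigma> (nat (\<sigma> b))) \<le> \<kappa>" using L by (auto intro: awords_reg words_cell)
  with Load show ?thesis by (simp add: instr_cost_def tick_def)
next
  case (Store a b)
  with assms have "awords w a \<le> 6" "awords w b \<le> 6" "a < L" "b < L"
    "words w (\<sigma> a) \<le> \<kappa>" "words w (\<sigma> b) \<le> \<kappa>" using L by (auto intro: awords_reg words_cell)
  with Store show ?thesis by (simp add: instr_cost_def tick_def)
qed (use assms in auto)

lemma ok_Instr: 
  assumes "iok L bd i \<sigma>" "Q (istep i \<sigma>)"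
  shows "ok (Instr i) 1 \<sigma> Q"
  unfolding ok_def gives_def
proof (intro impI exI[of _ "istep i \<sigma>"] conjI allI)
  assume good: "good \<sigma>"
  fix s :: mstate assume s: "memo s = conc L \<sigma>" "peak s \<le> P"
  have "instr_cost w i (conc L \<sigma>) \<le> tick" using good assms(1) by (rule instr_cost_conc)
  with s good assms(1)
  show "\<exists>s'. exec w (Instr i) s = return_spmf s' \<and> memo s' = conc L (istep i \<sigma>) \<and>
      clock s' \<le> clock s + 1 * tick \<and> peak s' \<le> P"
    by (auto simp: instr_sem_conc peak_advance good_istep) (simp_all add: advance_def)
qed (use assms good_istep in auto)

lemma gives_bind:
  assumes "gives f T1 \<sigma> \<sigma>'" "gives g T2 \<sigma>' \<sigma>''"
  shows "gives (\<lambda>s. bind_spmf (f s) g) (T1 + T2) \<sigma> \<sigma>''"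
  unfolding gives_def
proof (intro allI impI)
  fix s :: mstate assume s: "memo s = conc L \<sigma>" "peak s \<le> P"
  with assms(1) obtain s1 where s1: "f s = return_spmf s1" "memo s1 = conc L \<sigma>'"
    "clock s1 \<le> clock s + T1 * tick" "peak s1 \<le> P" unfolding gives_def by blast
  with assms(2) obtain s2 where "g s1 = return_spmf s2" "memo s2 = conc L \<sigma>''"
    "clock s2 \<le> clock s1 + T2 * tick" "peak s2 \<le> P" unfolding gives_def by blast
  with s1 show "\<exists>s'. f s \<bind> g = return_spmf s' \<and> memo s' = conc L \<sigma>'' \<and>
      clock s' \<le> clock s + (T1 + T2) * tick \<and> peak s' \<le> P"
    by (auto simp: algebra_simps)
qed

lemma ok_Seq: 
  assumes "ok c T1 \<sigma> (\<lambda>\<sigma>'. ok d T2 \<sigma>' Q)"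
  shows "ok (Seq c d) (T1 + T2) \<sigma> Q"
  unfolding ok_def
proof
  assume "good \<sigma>"
  with assms obtain \<sigma>' where 1: "good \<sigma>'" "ok d T2 \<sigma>' Q" "gives (exec w c) T1 \<sigma> \<sigma>'"
    by (auto simp: ok_def)
  then obtain \<sigma>'' where 2: "good \<sigma>''" "Q \<sigma>''" "gives (exec w d) T2 \<sigma>' \<sigma>''"
    by (auto simp: ok_def)
  from gives_bind[OF 1(3) 2(3)] have "gives (exec w (Seq c d)) (T1 + T2) \<sigma> \<sigma>''"
    by (simp add: gives_def)
  with 2 show "\<exists>\<sigma>'. good \<sigma>' \<and> Q \<sigma>' \<and> gives (exec w (Seq c d)) (T1 + T2) \<sigma> \<sigma>'" by blast
qed

lemma gives_charge:
  assumes "good \<sigma>" "a < 32"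
  shows "gives (\<lambda>s. return_spmf (charge_test w a s)) 1 \<sigma> \<sigma>"
proof -
  have "awords w a \<le> 6" "words w (\<sigma> a) \<le> \<kappa>" using assms L by (auto intro: awords_reg words_cell)
  then have "test_cost w a (conc L \<sigma>) \<le> tick"
    using assms L by (simp add: test_cost_def tick_def)
  then show ?thesis
    using assms(1) by (auto simp: gives_def charge_test_def peak_advance) (simp_all add: advance_def)
qed

lemma positive_conc: "memo s = conc L \<sigma> \<Longrightarrow> a < 32 \<Longrightarrow> positive a s \<longleftrightarrow> \<sigma> a > 0"
  using L by (simp add: positive_def)

lemma gives_cong:
  assumes "gives f T \<sigma> \<sigma>'" "\<And>s. memo s = conc L \<sigma> \<Longrightarrow> g s = f s"
  shows "gives g T \<sigma> \<sigma>'"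
  using assms unfolding gives_def by auto

lemma ok_Cond:
  assumes "a < 32" "\<sigma> a > 0 \<Longrightarrow> ok c T \<sigma> Q" "\<not> \<sigma> a > 0 \<Longrightarrow> ok d T \<sigma> Q"
  shows "ok (Cond a c d) (Suc T) \<sigma> Q"
  unfolding ok_def
proof
  assume good: "good \<sigma>"
  show "\<exists>\<sigma>'. good \<sigma>' \<and> Q \<sigma>' \<and> gives (exec w (Cond a c d)) (Suc T) \<sigma> \<sigma>'"
  proof (cases "\<sigma> a > 0")
    case True
    with assms(2) good obtain \<sigma>' where 1: "good \<sigma>'" "Q \<sigma>'" "gives (exec w c) T \<sigma> \<sigma>'"
      by (auto simp: ok_def)
    from gives_bind[OF gives_charge[OF good assms(1)] 1(3)]
    have "gives (exec w (Cond a c d)) (Suc T) \<sigma> \<sigma>'"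
      using assms(1) True by (rule_tac gives_cong) (auto simp: positive_conc)
    with 1 show ?thesis by blast
  next
    case False
    with assms(3) good obtain \<sigma>' where 1: "good \<sigma>'" "Q \<sigma>'" "gives (exec w d) T \<sigma> \<sigma>'"
      by (auto simp: ok_def)
    from gives_bind[OF gives_charge[OF good assms(1)] 1(3)]
    have "gives (exec w (Cond a c d)) (Suc T) \<sigma> \<sigma>'"
      using assms(1) False by (rule_tac gives_cong) (auto simp: positive_conc)
    with 1 show ?thesis by blast
  qed
qed

lemma gives_while:
  assumes a: "a < 32"
    and body: "\<And>i \<sigma>. i < n \<Longrightarrow> good \<sigma> \<Longrightarrow> I i \<sigma> \<Longrightarrow> \<sigma> a > 0 \<and> ok c (T i) \<sigma> (I (Suc i))"
    and stop: "\<And>\<sigma>. I n \<sigma> \<Longrightarrow> \<not> \<sigma> a > 0"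
    and "good \<sigma>" "I i \<sigma>" "i \<le> n"
  shows "\<exists>\<sigma>'. good \<sigma>' \<and> I n \<sigma>' \<and>
    gives (while_spmf (positive a) (\<lambda>s. exec w c (charge_test w a s))) (\<Sum>j\<in>{i..<n}. T j + 1) \<sigma> \<sigma>'"
  using assms(4-6)
proof (induction "n - i" arbitrary: i \<sigma>)
  case 0
  then have "I n \<sigma>" by simp
  with stop have "\<not> \<sigma> a > 0" by blast
  then have "gives (while_spmf (positive a) (\<lambda>s. exec w c (charge_test w a s))) 0 \<sigma> \<sigma>"
    using a by (auto simp: gives_def while_spmf.simps positive_conc)
  with 0 \<open>I n \<sigma>\<close> show ?case by auto
next
  case (Suc k)
  then have i: "i < n" by simp
  from body[OF i Suc.prems(1,2)] Suc.prems(1) obtain \<sigma>1 where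
    1: "\<sigma> a > 0" "good \<sigma>1" "I (Suc i) \<sigma>1" "gives (exec w c) (T i) \<sigma> \<sigma>1"
    by (auto simp: ok_def)
  from i Suc.hyps(2) have "k = n - Suc i" by simp
  from Suc.hyps(1)[OF this 1(2,3)] i obtain \<sigma>' where 2: "good \<sigma>'" "I n \<sigma>'"
    "gives (while_spmf (positive a) (\<lambda>s. exec w c (charge_test w a s))) (\<Sum>j\<in>{Suc i..<n}. T j + 1) \<sigma>1 \<sigma>'"
    by auto
  from gives_bind[OF gives_bind[OF gives_charge[OF Suc.prems(1) a] 1(4)] 2(3)]
  have "gives (while_spmf (positive a) (\<lambda>s. exec w c (charge_test w a s)))
      (1 + T i + (\<Sum>j\<in>{Suc i..<n}. T j + 1)) \<sigma> \<sigma>'"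
    using a 1(1) by (rule_tac gives_cong) (auto simp: positive_conc while_spmf.simps[of "positive a"])
  moreover have "1 + T i + (\<Sum>j\<in>{Suc i..<n}. T j + 1) = (\<Sum>j\<in>{i..<n}. T j + 1)"
    using i by (simp add: sum.atLeast_Suc_lessThan)
  ultimately show ?case using 2 by auto
qed

text \<open>All loops have a number \<open>n\<close> of iterations that is known in advance. The
  index of \<open>I\<close> counts completed iterations, and the budget \<open>T\<close> may vary
  with it, as it does for the selection passes.\<close>

lemma ok_While:
  assumes a: "a < 32" and I0: "I 0 \<sigma>"
    and body: "\<And>i \<sigma>. i < n \<Longrightarrow> good \<sigma> \<Longrightarrow> I i \<sigma> \<Longrightarrow> \<sigma> a > 0 \<and> ok c (T i) \<sigma> (I (Suc i))"
    and stop: "\<And>\<sigma>. good \<sigma> \<Longrightarrow> I n \<sigma> \<Longrightarrow> \<not> \<sigma> a > 0 \<and> Q \<sigma>"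
  shows "ok (While a c) ((\<Sum>i<n. T i + 1) + 1) \<sigma> Q"
  unfolding ok_def
proof
  assume good: "good \<sigma>"
  let ?I = "\<lambda>i \<sigma>. good \<sigma> \<and> I i \<sigma>"
  from gives_while[of a n ?I c T \<sigma> 0] a body stop good I0
  obtain \<sigma>' where 1: "good \<sigma>'" "I n \<sigma>'"
    "gives (while_spmf (positive a) (\<lambda>s. exec w c (charge_test w a s))) (\<Sum>j<n. T j + 1) \<sigma> \<sigma>'"
    by (auto simp: atLeast0LessThan ok_def)
  from gives_bind[OF 1(3) gives_charge[OF 1(1) a]]
  have "gives (exec w (While a c)) ((\<Sum>j<n. T j + 1) + 1) \<sigma> \<sigma>'"
    by (rule gives_cong) (auto simp: map_spmf_conv_bind_spmf)
  with 1 stop show "\<exists>\<sigma>'. good \<sigma>' \<and> Q \<sigma>' \<and> gives (exec w (While a c)) ((\<Sum>i<n. T i + 1) + 1) \<sigma> \<sigma>'"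
    by blast
qed

text \<open>A precondition that the simplifier can compute for loop-free code. Loops get
  \<open>False\<close>, since they go through \<open>ok_While\<close> with an invariant.\<close>

primrec lwp :: "com \<Rightarrow> (store \<Rightarrow> bool) \<Rightarrow> store \<Rightarrow> bool" where
  "lwp Skip Q \<sigma> = Q \<sigma>"
| "lwp (Instr i) Q \<sigma> = (iok L bd i \<sigma> \<and> Q (istep i \<sigma>))"
| "lwp (Seq c d) Q \<sigma> = lwp c (lwp d Q) \<sigma>"
| "lwp (Cond a c d) Q \<sigma> = (a < 32 \<and> (if \<sigma> a > 0 then lwp c Q \<sigma> else lwp d Q \<sigma>))"
| "lwp (While a c) Q \<sigma> = False"

end

primrec ticks :: "com \<Rightarrow> nat" where
  "ticks Skip = 0"
| "ticks (Instr i) = 1"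
| "ticks (Seq c d) = ticks c + ticks d"
| "ticks (Cond a c d) = Suc (max (ticks c) (ticks d))"
| "ticks (While a c) = 0"

context machine
begin

lemma lwp_ok: "lwp c Q \<sigma> \<Longrightarrow> ok c (ticks c) \<sigma> Q"
proof (induction c arbitrary: Q \<sigma>)
  case Skip
  then show ?case by (simp add: ok_Skip)
next
  case (Instr i)
  then show ?case using ok_Instr[of i \<sigma> Q] by simp
next
  case (Seq c d)
  from Seq.prems have "ok c (ticks c) \<sigma> (lwp d Q)" by (intro Seq.IH(1)) simp
  then have "ok c (ticks c) \<sigma> (\<lambda>\<sigma>'. ok d (ticks d) \<sigma>' Q)"
    by (rule ok_weaken) (auto intro: Seq.IH(2))
  then show ?case by (auto intro: ok_Seq)
next
  case (Cond a c d)
  show ?case unfolding ticks.simps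
  proof (rule ok_Cond)
    show "ok c (max (ticks c) (ticks d)) \<sigma> Q" if "\<sigma> a > 0"
      using Cond.prems that by (intro ok_weaken[OF Cond.IH(1)[of Q \<sigma>]]) auto
    show "ok d (max (ticks c) (ticks d)) \<sigma> Q" if "\<not> \<sigma> a > 0"
      using Cond.prems that by (intro ok_weaken[OF Cond.IH(2)[of Q \<sigma>]]) auto
  qed (use Cond.prems in auto)
qed simp

lemma ok_block: "lwp c Q \<sigma> \<Longrightarrow> ticks c \<le> T \<Longrightarrow> ok c T \<sigma> Q"
  by (rule ok_weaken[OF lwp_ok])

end

primrec block :: "instr list \<Rightarrow> com" where
  "block [] = Skip"
| "block (i # is) = Seq (Instr i) (block is)"

lemma ticks_block [simp]: "ticks (block is) = length is"
  by (induction "is") auto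

section \<open>The programs\<close>

text \<open>
  Cells below 32 are registers: 3 is positive iff the sketch is used, 4 and 5 hold the modulus \<open>2 h\<close>
  and \<open>h\<close>, 6 holds 1.  With \<open>K = counters k l\<close>, the seeds start at cell 32, the counters at
  \<open>32 + K\<close> and the arrays of the selection passes, one after the other, at \<open>32 + 2 K\<close>.  The frequency
  of item \<open>p\<close> in a small universe is in cell \<open>31 + p\<close>.
\<close>

definition groups :: "nat \<Rightarrow> nat" where
  "groups l = 2 ^ (7 + 3 * l)"

definition counters :: "nat \<Rightarrow> nat \<Rightarrow> nat" where
  "counters k l = k * groups l"

definition cell_count :: "nat \<Rightarrow> nat \<Rightarrow> nat" where
  "cell_count k l = 32 + 2 * counters k l + 2 * groups l"

text \<open>Register 16 yields the digits of the seed one by one in the order in which Horner's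
  scheme consumes them. At the end 17 holds \<open>h\<close> minus the value, which is positive
  exactly if the sign is 1.\<close>

definition hash_com :: com where
  "hash_com = block [
     Arith Rem 17 16 4, Arith Quot 16 16 4,
     Arith Times 17 17 0, Arith Rem 18 16 4, Arith Plus 17 17 18, Arith Quot 16 16 4,
     Arith Times 17 17 0, Arith Rem 18 16 4, Arith Plus 17 17 18, Arith Quot 16 16 4,
     Arith Times 17 17 0, Arith Plus 17 17 16, Arith Rem 17 17 4, Arith Minus 17 5 17]"

text \<open>Register 11 points to the seed; adding 12, which holds \<open>K\<close>, gives the
  address of the counter. Register 15 accumulates the squares of the group.\<close>

definition counter_com :: com where
  "counter_com = Seq (Instr (Load 16 11)) (Seq hash_com (Seq
     (block [Arith Plus 18 11 12, Load 19 18]) (Seq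
     (Cond 17 (Instr (Arith Plus 19 19 6)) (Instr (Arith Minus 19 19 6)))
     (block [Store 18 19, Arith Times 19 19 19, Arith Plus 15 15 19, Arith Plus 11 11 6, Arith Minus 14 14 6]))))"

definition group_com :: "nat \<Rightarrow> com" where
  "group_com k = Seq (block [Const 14 (int k), Const 15 0]) (Seq
     (While 14 counter_com)
     (block [Store 13 15, Arith Plus 13 13 6, Arith Minus 10 10 6]))"

definition counters_com :: "nat \<Rightarrow> nat \<Rightarrow> com" where
  "counters_com k l = Seq
     (block [Const 10 (int (groups l)), Const 11 32, Const 12 (int (counters k l)), Const 13 (int (32 + 2 * counters k l))])
     (While 10 (group_com k))"

definition compare_com :: com where
  "compare_com = Seq
     (block [Arith Plus 27 21 15, Load 16 27, Arith Times 16 16 12, Arith Plus 16 16 15, Arith Minus 16 28 16]) (Seq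
     (Cond 16 (Instr (Arith Plus 29 29 6)) Skip)
     (block [Arith Plus 15 15 6, Arith Minus 14 14 6]))"

text \<open>The rank is found by comparing the entry with its whole block; short blocks in the long
  early passes and long blocks in the short late ones keep the total linear. Adding register 7,
  which holds 0, copies a register.\<close>

definition entry_com :: com where
  "entry_com = Seq
     (block [Arith Minus 25 25 6, Arith Rem 26 25 23, Arith Minus 26 25 26, Arith Plus 27 21 25, Load 28 27,
       Arith Times 28 28 12, Arith Plus 28 28 25, Const 29 0, Arith Plus 14 23 7, Arith Plus 15 26 7]) (Seq
     (While 14 compare_com) (Seq
     (block [Arith Plus 29 29 6, Arith Rem 16 29 24])
     (Cond 16 Skip (block [Arith Plus 29 29 26, Arith Quot 29 29 24, Arith Minus 29 29 6, Arith Plus 29 29 13,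
       Arith Plus 27 21 25, Load 28 27, Store 29 28]))))"

definition pass_com :: com where
  "pass_com = Seq (block [Arith Plus 13 21 22, Arith Plus 25 22 7]) (Seq
     (While 25 entry_com)
     (block [Arith Plus 21 13 7, Arith Quot 22 22 24, Arith Plus 23 23 23, Arith Minus 20 20 6]))"

definition select_com :: "nat \<Rightarrow> nat \<Rightarrow> com" where
  "select_com k l = Seq
     (block [Const 7 0, Const 12 (int (groups l)), Const 20 (int (Suc l)), Const 21 (int (32 + 2 * counters k l)),
       Const 22 (int (groups l)), Const 23 128, Const 24 4]) (Seq
     (While 20 pass_com)
     (block [Const 7 (2 ^ (l + 4)), Arith Plus 7 21 7, Load 1 7]))"

text \<open>A frequency \<open>f\<close> that rises by one raises \<open>F2\<close> by
  \<open>f\<close> plus \<open>f + 1\<close>, the frequency before and after.\<close>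

definition table_com :: com where
  "table_com = block [Const 7 31, Arith Plus 8 0 7, Load 9 8, Arith Plus 1 1 9, Arith Plus 9 9 6, Arith Plus 1 1 9,
     Store 8 9]"

definition update_com :: "nat \<Rightarrow> nat \<Rightarrow> com" where
  "update_com k l = Cond 3 (Seq (counters_com k l) (select_com k l)) table_com"

definition modulus_com :: com where
  "modulus_com = Seq (block [Arith Times 8 0 0, Arith Times 8 8 0, Const 5 1, Arith Minus 9 8 5]) (Seq
     (While 9 (block [Arith Plus 5 5 5, Arith Minus 9 8 5]))
     (block [Arith Plus 4 5 5, Arith Times 10 4 4, Arith Times 10 10 10]))"

text \<open>The number \<open>B ^ K\<close> takes O(\<open>K\<close>) words, so the register that
  holds it stays within the storage bound.\<close>

definition power_com :: "nat \<Rightarrow> com" where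
  "power_com K = Seq (block [Const 11 1, Const 12 (int K)])
     (While 12 (block [Arith Times 11 11 10, Arith Minus 12 12 6]))"

definition unpack_com :: "nat \<Rightarrow> com" where
  "unpack_com K = Seq (block [Const 12 (int K), Const 13 32])
     (While 12 (block [Arith Rem 14 11 10, Store 13 14, Arith Quot 11 11 10, Arith Plus 13 13 6, Arith Minus 12 12 6]))"

text \<open>
  All seeds come from one random number below \<open>B ^ K\<close>, so that everything else is deterministic.
\<close>

definition init_com :: "nat \<Rightarrow> nat \<Rightarrow> com" where
  "init_com k l = Seq
     (block [Const 6 1, Const 2 1, Const 7 (int (counters k l)), Arith Minus 3 0 7])
     (Cond 3 (Seq (Seq (Instr (Const 2 (int k))) (Seq modulus_com (power_com (counters k l))))
        (Seq (Instr (Rand 11 11)) (unpack_com (counters k l)))) Skip)"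

definition F2_alg :: "nat \<Rightarrow> nat \<Rightarrow> stream_alg" where
  "F2_alg k l = \<lparr>cells = cell_count k l, init_prog = init_com k l, update_prog = update_com k l\<rparr>"

section \<open>Correctness of the sketch\<close>

text \<open>The division by \<open>k\<close> is left to the denominator in cell 2, so that the
  machine handles integers only.\<close>

definition group_sum :: "nat \<Rightarrow> (nat \<Rightarrow> int) \<Rightarrow> nat \<Rightarrow> int" where
  "group_sum k c r = (\<Sum>i<k. (c (r * k + i))\<^sup>2)"

text \<open>The guarantee of an approximate median: it avoids every half-line that contains at most
  a quarter of the values.\<close>

definition is_center :: "nat \<Rightarrow> (nat \<Rightarrow> int) \<Rightarrow> int \<Rightarrow> bool" where
  "is_center l v z \<longleftrightarrow> (\<forall>S. up_closed S \<or> down_closed S \<longrightarrow>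
     4 * card {p. p < groups l \<and> S (v p)} \<le> groups l \<longrightarrow> \<not> S z)"

text \<open>With \<open>W = 2 ^ w\<close> the exponent counts words. Products add exponents, and a
  sum costs one more because \<open>2 <= W\<close>, so the length of every intermediate result
  follows the structure of the program.\<close>

definition bnd :: "int \<Rightarrow> nat \<Rightarrow> int \<Rightarrow> bool" where
  "bnd W e x \<longleftrightarrow> \<bar>x\<bar> \<le> W ^ e"

lemma bnd_mono: "bnd W e x \<Longrightarrow> 2 \<le> W \<Longrightarrow> e \<le> e' \<Longrightarrow> bnd W e' x"
  unfolding bnd_def by (erule order_trans) (intro power_increasing, auto)

lemma bnd_mult: "bnd W a x \<Longrightarrow> bnd W b y \<Longrightarrow> bnd W (a + b) (x * y)"
  unfolding bnd_def abs_mult power_add by (intro mult_mono) auto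

lemma bnd_add: 
  assumes "bnd W a x" "bnd W b y" "2 \<le> W" shows "bnd W (Suc (max a b)) (x + y)"
proof -
  have "bnd W (max a b) x" "bnd W (max a b) y" using assms by (auto intro: bnd_mono)
  then have "\<bar>x + y\<bar> \<le> 2 * W ^ max a b" unfolding bnd_def by linarith
  also have "\<dots> \<le> W * W ^ max a b" using assms(3) by (intro mult_right_mono) auto
  finally show ?thesis by (simp add: bnd_def)
qed

lemma bnd_uminus: "bnd W a (- x) = bnd W a x"
  by (simp add: bnd_def)

lemma bnd_diff: "bnd W a x \<Longrightarrow> bnd W b y \<Longrightarrow> 2 \<le> W \<Longrightarrow> bnd W (Suc (max a b)) (x - y)"
  using bnd_add[of W a x b "- y"] by (simp add: bnd_uminus)

lemma bnd_mod: "0 < y \<Longrightarrow> bnd W b y \<Longrightarrow> bnd W b (x mod y)"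
  unfolding bnd_def using pos_mod_bound[of y x] pos_mod_sign[of y x] by linarith

lemma bnd_div: 
  assumes "0 < y" "0 \<le> x" "bnd W a x" shows "bnd W a (x div y)"
proof -
  have "x div y \<le> x" "0 \<le> x div y" using assms zdiv_mono2[of x 1 y] by (auto simp: pos_imp_zdiv_nonneg_iff)
  with assms show ?thesis by (simp add: bnd_def)
qed

lemma bnd_nat: "int x \<le> W \<Longrightarrow> bnd W 1 (int x)"
  by (simp add: bnd_def)

lemma bnd_address:
  assumes "int x \<le> 33 + 4 * W" "2 \<le> W"
  shows "bnd W 7 (int x)"
proof -
  have "int x \<le> 2 ^ 6 * W" using assms by simp
  also have "\<dots> \<le> W ^ 6 * W" using assms by (intro mult_right_mono power_mono) auto
  finally show ?thesis using power_Suc2[of W 6] by (simp add: bnd_def)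
qed

text \<open>Seeds are below \<open>(2 * h) ^ 4 <= W ^ 20\<close>, and the counters share this bound.
  Group sums are at most \<open>K * W\<^sup>2 <= W ^ 3\<close>. The registers get a generous
  exponent for intermediate results.\<close>

definition sketch_bd :: "nat \<Rightarrow> nat \<Rightarrow> int \<Rightarrow> nat \<Rightarrow> int" where
  "sketch_bd k l W a = (if a < 32 then W ^ 32 else if a < 32 + 2 * counters k l then W ^ 20 else W ^ 3)"

locale sketch = machine w "cell_count k l" "sketch_bd k l W" "W ^ 32" P \<kappa>
  for w k l :: nat and W :: int and P \<kappa> :: nat +
  fixes h :: int
  assumes W2: "2 \<le> W" and k: "0 < k" and KW: "int (counters k l) \<le> W"
    and h: "0 < h" and hW: "2 * h \<le> W ^ 5"
begin

abbreviation "K \<equiv> counters k l"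
abbreviation "R \<equiv> groups l"

lemma sketch_bd_simps:
  "a < 32 \<Longrightarrow> sketch_bd k l W a = W ^ 32"
  "a < K \<Longrightarrow> sketch_bd k l W (32 + K + a) = W ^ 20"
  by (auto simp: sketch_bd_def)

lemma reg_bound: "bnd W e x \<Longrightarrow> e \<le> 32 \<Longrightarrow> a < 32 \<Longrightarrow> \<bar>x\<bar> \<le> sketch_bd k l W a"
  using bnd_mono[of W e x 32] W2 by (simp add: sketch_bd_simps bnd_def)

lemma R_pos: "0 < R" by (simp add: groups_def)

lemma RK: "R \<le> K" using k by (simp add: counters_def)

lemma K_pos: "0 < K" using RK R_pos by linarith

lemma RW: "int R \<le> W" using KW RK by linarith

lemma hash_ok:
  assumes s: "\<sigma> 16 = s" "0 \<le> s" "s < (2 * h) ^ 4" and c: "\<sigma> 4 = 2 * h" "\<sigma> 5 = h"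
    and x: "\<sigma> 0 = x" "0 \<le> x" "x \<le> W"
  shows "ok hash_com 14 \<sigma> (\<lambda>\<sigma>'. \<exists>u v y. \<sigma>' = \<sigma>(16 := u, 18 := v, 17 := y) \<and>
    (0 < y \<longleftrightarrow> hash_sign h s x = 1))"
proof -
  define N where "N = 2 * h"
  have N: "0 < N" "bnd W 5 N" using h hW by (auto simp: N_def bnd_def)
  have bh: "bnd W 5 h" using h hW by (auto simp: bnd_def)
  have bx: "bnd W 1 x" using x by (simp add: bnd_def)
  define d0 d1 d2 d3 where d: "d0 = s mod N" "d1 = s div N mod N" "d2 = s div N div N mod N" "d3 = s div N div N div N"
  \<comment> \<open>The program uses the last quotient without reducing it; as
    \<open>s < N ^ 4\<close> it is already a digit.\<close>
  have d3: "0 \<le> d3" "d3 < N"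
  proof -
    have "s < N ^ 3 * N" using s(3) by (simp add: N_def eval_nat_numeral)
    moreover have "N ^ 3 * (s div N ^ 3) \<le> s"
      using mult_div_mod_eq[of "N ^ 3" s] pos_mod_sign[of "N ^ 3" s] zero_less_power[OF N(1), of 3] by linarith
    ultimately have "N ^ 3 * (s div N ^ 3) < N ^ 3 * N" by linarith
    then have "s div N ^ 3 < N" using N by simp
    then show "d3 < N" "0 \<le> d3" using N s(2)
      by (simp_all add: d power3_eq_cube zdiv_zmult2_eq pos_imp_zdiv_nonneg_iff)
  qed
  have bs: "bnd W 20 s"
  proof -
    have "s \<le> N ^ 4" using s by (simp add: N_def)
    also have "\<dots> \<le> (W ^ 5) ^ 4" using h hW by (intro power_mono) (auto simp: N_def)
    finally show ?thesis using s by (simp add: bnd_def flip: power_mult)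
  qed
  have bd012: "bnd W 5 d0" "bnd W 5 d1" "bnd W 5 d2" "bnd W 5 d3"
    using N d3 unfolding d(1-3) by (auto intro: bnd_mod) (auto simp: bnd_def)
  have sdiv: "0 \<le> s div N" "0 \<le> s div N div N" using s N by (auto simp: pos_imp_zdiv_nonneg_iff)
  have b1: "bnd W 6 (d0 * x)" using bnd_mult[OF bd012(1) bx] by simp
  have b2: "bnd W 7 (d0 * x + d1)" using bnd_add[OF b1 bd012(2) W2] by simp
  have b3: "bnd W 8 ((d0 * x + d1) * x)" using bnd_mult[OF b2 bx] by simp
  have b4: "bnd W 9 ((d0 * x + d1) * x + d2)" using bnd_add[OF b3 bd012(3) W2] by simp
  have b5: "bnd W 10 (((d0 * x + d1) * x + d2) * x)" using bnd_mult[OF b4 bx] by simp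
  have b6: "bnd W 11 (((d0 * x + d1) * x + d2) * x + d3)" using bnd_add[OF b5 bd012(4) W2] by simp
  define v where "v = (((d0 * x + d1) * x + d2) * x + d3) mod N"
  have b7: "bnd W 5 v" unfolding v_def by (rule bnd_mod[OF N])
  have b8: "bnd W 6 (h - v)" using bnd_diff[OF bh b7 W2] by simp
  have b9: "bnd W 20 (s div N)" "bnd W 20 (s div N div N)" "bnd W 20 d3"
    unfolding d using N bs s sdiv by (auto intro!: bnd_div)
  have sign: "v < h \<longleftrightarrow> hash_sign h s x = 1"
  proof -
    have "dig N 0 s = d0" "dig N 1 s = d1" "dig N 2 s = d2" "dig N 3 s = d3"
      using N d3 by (simp_all add: dig_def d power2_eq_square power3_eq_cube zdiv_zmult2_eq)
    then show ?thesis unfolding hash_sign_def coeffs_val_def v_def N_def[symmetric] by simp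
  qed
  note R = reg_bound[OF b1] reg_bound[OF b2] reg_bound[OF b3] reg_bound[OF b4] reg_bound[OF b5] reg_bound[OF b6]
    reg_bound[OF b7] reg_bound[OF b8] reg_bound[OF b9(1)] reg_bound[OF b9(2)] reg_bound[OF b9(3)]
    reg_bound[OF bd012(1)] reg_bound[OF bd012(2)] reg_bound[OF bd012(3)]
  have c': "\<sigma> 4 = N" using c by (simp add: N_def)
  show ?thesis
    unfolding hash_com_def
    by (rule ok_block) (simp_all add: s(1) c' c(2) x(1) R d[symmetric] v_def[symmetric] sign,
      rule exI[of _ d3], rule exI[of _ d2], rule exI[of _ "h - v"], simp add: fun_eq_iff sign)
qed


text \<open>\<open>c\<close> and \<open>c'\<close> are the counters before and after the current item; the first \<open>g\<close> are up to date.\<close>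

definition counters_inv :: "store \<Rightarrow> (nat \<Rightarrow> int) \<Rightarrow> (nat \<Rightarrow> int) \<Rightarrow> nat \<Rightarrow> store \<Rightarrow> bool" where
  "counters_inv \<rho> c c' g \<sigma> \<longleftrightarrow>
     (\<forall>a\<in>{0, 2, 3, 4, 5, 6} \<union> {32..<32 + K}. \<sigma> a = \<rho> a) \<and> \<sigma> 12 = int K \<and> \<sigma> 11 = int (32 + g) \<and>
     (\<forall>i<K. \<sigma> (32 + K + i) = (if i < g then c' i else c i))"

definition values_inv :: "(nat \<Rightarrow> int) \<Rightarrow> nat \<Rightarrow> store \<Rightarrow> bool" where
  "values_inv c r \<sigma> \<longleftrightarrow> (\<forall>q<r. \<sigma> (32 + 2 * K + q) = group_sum k c q)"

lemma counter_ok: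
  assumes inv: "counters_inv \<rho> c c' g \<sigma>" "values_inv c' r \<sigma>" and g: "g < K"
    and \<rho>: "\<rho> 4 = 2 * h" "\<rho> 5 = h" "\<rho> 6 = 1" "0 \<le> \<rho> 0" "\<rho> 0 \<le> W"
    and sd: "0 \<le> \<rho> (32 + g)" "\<rho> (32 + g) < (2 * h) ^ 4"
    and c': "c' g = c g + hash_sign h (\<rho> (32 + g)) (\<rho> 0)" "\<bar>c' g\<bar> \<le> W"
    and r: "\<sigma> 10 = int y" "\<sigma> 13 = z" "\<sigma> 14 = int (Suc j)" "j < K"
    and acc: "\<sigma> 15 = acc" "\<bar>acc + (c' g)\<^sup>2\<bar> \<le> W ^ 3"
  shows "ok counter_com 25 \<sigma> (\<lambda>\<sigma>'. counters_inv \<rho> c c' (Suc g) \<sigma>' \<and> values_inv c' r \<sigma>' \<and>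
    \<sigma>' 10 = int y \<and> \<sigma>' 13 = z \<and> \<sigma>' 14 = int j \<and> \<sigma>' 15 = acc + (c' g)\<^sup>2)"
proof (rule ok_good)
  assume good: "good \<sigma>"
  define s where "s = \<rho> (32 + g)"
  define x where "x = \<rho> 0"
  define X where "X = 32 + K + g"
  have X: "a \<noteq> X" "X \<noteq> a" if "a < 32" for a using that by (auto simp: X_def)
  have XL: "X < cell_count k l" using g by (simp add: X_def cell_count_def)
  have Xs: "sketch_bd k l W X = W ^ 20" using g by (simp add: X_def sketch_bd_simps)
  have inv': "\<sigma> 0 = x" "\<sigma> 4 = 2 * h" "\<sigma> 5 = h" "\<sigma> 6 = 1" "\<sigma> 11 = int (32 + g)" "\<sigma> 12 = int K"
    "\<sigma> (32 + g) = s" "\<sigma> X = c g"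
    using inv(1) g \<rho> by (auto simp: counters_inv_def s_def x_def X_def)
  have cg: "bnd W 2 (c g)"
  proof -
    have "\<bar>hash_sign h s x\<bar> = 1" by (simp add: hash_sign_def)
    then have "\<bar>c g\<bar> \<le> W + 1" using c' unfolding s_def[symmetric] x_def[symmetric] by linarith
    also have "\<dots> \<le> 2 * W" using W2 by simp
    also have "\<dots> \<le> W * W" using W2 by (intro mult_right_mono) auto
    finally show ?thesis by (simp add: bnd_def power2_eq_square)
  qed
  have bs: "bnd W 20 s"
  proof -
    have "s \<le> (2 * h) ^ 4" using sd by (simp add: s_def)
    also have "\<dots> \<le> (W ^ 5) ^ 4" using h hW by (intro power_mono) auto
    finally show ?thesis using sd by (simp add: bnd_def s_def flip: power_mult)
  qed
  have "int g < int K" using g by (simp only: of_nat_less_iff)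
  then have bX: "bnd W 7 (int X)"
    using KW W2 by (intro bnd_address) (simp_all add: X_def)
  have gL: "32 + g < cell_count k l" using g by (simp add: cell_count_def)
  have "int (33 + g) \<le> int X" using K_pos unfolding of_nat_le_iff X_def by linarith
  then have bg: "bnd W 7 (int (33 + g))" using bX unfolding bnd_def by linarith
  have bj: "bnd W 1 (int j)" using r(4) KW by (intro bnd_nat order_trans[OF _ KW]) (simp only: of_nat_le_iff)
  have bc: "bnd W 1 (c' g)" using c' by (simp add: bnd_def)
  have bsq: "bnd W 3 ((c' g)\<^sup>2)" using bnd_mono[OF bnd_mult[OF bc bc] W2, of 3] by (simp add: power2_eq_square)
  have bacc: "bnd W 3 (acc + (c' g)\<^sup>2)" using acc by (simp add: bnd_def)
  have "ok (Instr (Load 16 11)) 1 \<sigma> (\<lambda>\<sigma>'. \<sigma>' = \<sigma>(16 := s))"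
    using gL reg_bound[OF bs, of 16] inv'(7) by (intro ok_Instr) (simp_all add: inv'(5) del: of_nat_add of_nat_Suc)
  moreover have "ok (Seq hash_com (Seq (block [Arith Plus 18 11 12, Load 19 18]) (Seq
     (Cond 17 (Instr (Arith Plus 19 19 6)) (Instr (Arith Minus 19 19 6)))
     (block [Store 18 19, Arith Times 19 19 19, Arith Plus 15 15 19, Arith Plus 11 11 6, Arith Minus 14 14 6]))))
     (14 + 10) (\<sigma>(16 := s)) (\<lambda>\<sigma>'. counters_inv \<rho> c c' (Suc g) \<sigma>' \<and> values_inv c' r \<sigma>' \<and>
    \<sigma>' 10 = int y \<and> \<sigma>' 13 = z \<and> \<sigma>' 14 = int j \<and> \<sigma>' 15 = acc + (c' g)\<^sup>2)"
  proof (rule ok_Seq, rule ok_weaken[OF hash_ok[of "\<sigma>(16 := s)" s x]])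
    fix \<sigma>1
    assume "\<exists>u v y. \<sigma>1 = \<sigma>(16 := s, 16 := u, 18 := v, 17 := y) \<and> (0 < y \<longleftrightarrow> hash_sign h s x = 1)"
    then obtain u v t where \<sigma>1: "\<sigma>1 = \<sigma>(16 := u, 18 := v, 17 := t)" and t: "0 < t \<longleftrightarrow> hash_sign h s x = 1"
      by auto
    have addr: "int (32 + g) + int K = int X" by (simp add: X_def)
    have cg1: "0 < t \<Longrightarrow> c g + 1 = c' g" "\<not> 0 < t \<Longrightarrow> c g - 1 = c' g"
      using t c' unfolding s_def[symmetric] x_def[symmetric] by (auto simp: hash_sign_def split: if_splits)
    have g1: "int (32 + g) + 1 = int (33 + g)" by simp
    have j1: "int (Suc j) - 1 = int j" by simp
    have fin: "counters_inv \<rho> c c' (Suc g) \<sigma>' \<and> values_inv c' r \<sigma>' \<and>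
        \<sigma>' 10 = int y \<and> \<sigma>' 13 = z \<and> \<sigma>' 14 = int j \<and> \<sigma>' 15 = acc + (c' g)\<^sup>2"
      if \<sigma>': "\<sigma>' = \<sigma>(16 := u, 17 := t, 18 := int X, X := c' g, 19 := v', 15 := acc + (c' g)\<^sup>2, 11 := int (33 + g), 14 := int j)"
      for \<sigma>' v'
    proof -
      have same: "\<sigma>' a = \<sigma> a" if "a \<in> {0, 2, 3, 4, 5, 6, 10, 12, 13} \<or> a \<ge> 32" "a \<noteq> X" for a
        using that by (auto simp: \<sigma>')
      have XX: "\<sigma>' X = c' g" using X by (simp add: \<sigma>')
      have "\<forall>a\<in>{0, 2, 3, 4, 5, 6} \<union> {32..<32 + K}. \<sigma>' a = \<rho> a"
      proof
        fix a assume a: "a \<in> {0, 2, 3, 4, 5, 6} \<union> {32..<32 + K}"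
        then have "\<sigma>' a = \<sigma> a" by (intro same) (auto simp: X_def)
        moreover have "\<sigma> a = \<rho> a" using a inv(1) unfolding counters_inv_def by blast
        ultimately show "\<sigma>' a = \<rho> a" by simp
      qed
      moreover have "\<forall>i<K. \<sigma>' (32 + K + i) = (if i < Suc g then c' i else c i)"
      proof (intro allI impI)
        fix i assume i: "i < K"
        show "\<sigma>' (32 + K + i) = (if i < Suc g then c' i else c i)"
        proof (cases "i = g")
          case True
          with XX show ?thesis by (simp add: X_def)
        next
          case False
          then have "\<sigma>' (32 + K + i) = \<sigma> (32 + K + i)" by (intro same) (auto simp: X_def)
          with i False inv(1) show ?thesis unfolding counters_inv_def by simp
        qed
      qed
      moreover have "values_inv c' r \<sigma>'"
        unfolding values_inv_def
      proof (intro allI impI)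
        fix q assume "q < r"
        moreover have "\<sigma>' (32 + 2 * K + q) = \<sigma> (32 + 2 * K + q)"
          using g by (intro same) (auto simp: X_def)
        ultimately show "\<sigma>' (32 + 2 * K + q) = group_sum k c' q"
          using inv(2) unfolding values_inv_def by simp
      qed
      moreover have "\<sigma>' 12 = int K" "\<sigma>' 10 = int y" "\<sigma>' 13 = z"
        using same[of 12] same[of 10] same[of 13] X inv' r by auto
      moreover have "\<sigma>' 11 = int (32 + Suc g)" "\<sigma>' 14 = int j" "\<sigma>' 15 = acc + (c' g)\<^sup>2"
        using X by (simp_all add: \<sigma>')
      ultimately show ?thesis unfolding counters_inv_def by blast
    qed
    note RB = reg_bound[OF bX] reg_bound[OF bg] reg_bound[OF bj] reg_bound[OF bc] reg_bound[OF bsq] reg_bound[OF bacc]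
      reg_bound[OF cg]
    have Wc: "\<bar>c' g\<bar> \<le> W ^ 20" using bnd_mono[OF bc W2, of 20] by (simp add: bnd_def)
    show "ok (Seq (block [Arith Plus 18 11 12, Load 19 18]) (Seq
       (Cond 17 (Instr (Arith Plus 19 19 6)) (Instr (Arith Minus 19 19 6)))
       (block [Store 18 19, Arith Times 19 19 19, Arith Plus 15 15 19, Arith Plus 11 11 6, Arith Minus 14 14 6])))
       10 \<sigma>1 (\<lambda>\<sigma>'. counters_inv \<rho> c c' (Suc g) \<sigma>' \<and> values_inv c' r \<sigma>' \<and>
      \<sigma>' 10 = int y \<and> \<sigma>' 13 = z \<and> \<sigma>' 14 = int j \<and> \<sigma>' 15 = acc + (c' g)\<^sup>2)"
      by (rule ok_block) (simp_all add: \<sigma>1 inv' r(1-3) acc(1) addr X XL RB[unfolded abs_of_nat abs_power2] cg1 Xs Wc j1 g1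
        fin[OF refl, THEN conjunct1] fin[OF refl, THEN conjunct2, THEN conjunct1]
        power2_eq_square[symmetric] del: of_nat_add of_nat_Suc split: if_splits)
  qed (use inv' sd \<rho> in \<open>auto simp: s_def x_def\<close>)
  ultimately show ?thesis unfolding counter_com_def
    by - (rule ok_weaken, rule ok_Seq, erule ok_weaken, auto)
qed

end

section \<open>Updating the counters and the group sums\<close>

context sketch
begin

definition step_ok :: "store \<Rightarrow> (nat \<Rightarrow> int) \<Rightarrow> (nat \<Rightarrow> int) \<Rightarrow> bool" where
  "step_ok \<rho> c c' \<longleftrightarrow> \<rho> 4 = 2 * h \<and> \<rho> 5 = h \<and> \<rho> 6 = 1 \<and> 0 \<le> \<rho> 0 \<and> \<rho> 0 \<le> W \<and>
     (\<forall>g<K. 0 \<le> \<rho> (32 + g) \<and> \<rho> (32 + g) < (2 * h) ^ 4 \<and>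
       c' g = c g + hash_sign h (\<rho> (32 + g)) (\<rho> 0) \<and> \<bar>c' g\<bar> \<le> W)"

lemma sum_squares_bound:
  assumes "step_ok \<rho> c c'" "n \<le> k" "r < R"
  shows "\<bar>\<Sum>i<n. (c' (r * k + i))\<^sup>2\<bar> \<le> W ^ 3"
proof -
  have rk: "r * k + i < K" if "i < k" for i
  proof -
    have "Suc r * k \<le> R * k" using assms(3) by (intro mult_le_mono1) simp
    then show ?thesis using that by (simp add: counters_def mult.commute)
  qed
  have "(\<Sum>i<n. (c' (r * k + i))\<^sup>2) \<le> (\<Sum>i<n. W\<^sup>2)"
  proof (rule sum_mono)
    fix i assume "i \<in> {..<n}"
    then have "r * k + i < K" using assms(2) by (intro rk) simp
    then have "\<bar>c' (r * k + i)\<bar> \<le> W" using assms(1) unfolding step_ok_def by blast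
    from power_mono[OF this, of 2] show "(c' (r * k + i))\<^sup>2 \<le> W\<^sup>2" by simp
  qed
  also have "\<dots> \<le> int K * W\<^sup>2"
  proof -
    have "k \<le> K" using R_pos by (simp add: counters_def)
    then have "int n \<le> int K" using assms(2) by simp
    then show ?thesis by (simp add: mult_right_mono)
  qed
  also have "\<dots> \<le> W * W\<^sup>2" using KW by (intro mult_right_mono) auto
  also have "\<dots> = W ^ 3" by (simp add: power2_eq_square power3_eq_cube)
  finally show ?thesis by (simp add: sum_nonneg)
qed

lemma group_ok:
  assumes st: "step_ok \<rho> c c'" and r: "r < R"
    and inv: "counters_inv \<rho> c c' (r * k) \<sigma>" "values_inv c' r \<sigma>" "\<sigma> 10 = int (R - r)" "\<sigma> 13 = int (32 + 2 * K + r)"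
  shows "ok (group_com k) (26 * k + 6) \<sigma> (\<lambda>\<sigma>'. counters_inv \<rho> c c' (Suc r * k) \<sigma>' \<and> values_inv c' (Suc r) \<sigma>' \<and>
    \<sigma>' 10 = int (R - Suc r) \<and> \<sigma>' 13 = int (32 + 2 * K + Suc r))"
proof -
  have rk: "r * k + i < K" if "i < k" for i
  proof -
    have "Suc r * k \<le> R * k" using r by (intro mult_le_mono1) simp
    then show ?thesis using that by (simp add: counters_def mult.commute)
  qed
  have kK: "k \<le> K" using R_pos by (simp add: counters_def)
  define J where "J = (\<lambda>j \<sigma>. counters_inv \<rho> c c' (r * k + j) \<sigma> \<and> values_inv c' r \<sigma> \<and>
    \<sigma> 10 = int (R - r) \<and> \<sigma> 13 = int (32 + 2 * K + r) \<and> \<sigma> 14 = int (k - j) \<and> \<sigma> 15 = (\<Sum>i<j. (c' (r * k + i))\<^sup>2))"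
  have bk: "bnd W 1 (int k)" using kK KW by (intro bnd_nat) simp
  have 1: "ok (block [Const 14 (int k), Const 15 0]) 2 \<sigma> (J 0)"
    using inv reg_bound[OF bk, of 14] W2 unfolding J_def
    by (intro ok_block) (auto simp: counters_inv_def values_inv_def sketch_bd_simps)
  have 2: "ok (While 14 counter_com) ((\<Sum>i<k. 25 + 1) + 1) \<sigma>' (J k)" if "J 0 \<sigma>'" for \<sigma>'
  proof (rule ok_While[where I = J])
    fix j \<sigma>1 assume j: "j < k" and J: "J j \<sigma>1"
    have 14: "\<sigma>1 14 = int (Suc (k - Suc j))" using J j by (simp add: J_def Suc_diff_Suc)
    then have "0 < \<sigma>1 14" by simp
    moreover have "ok counter_com 25 \<sigma>1 (J (Suc j))"
      unfolding J_def
    proof (rule ok_weaken[OF counter_ok[where g = "r * k + j" and \<rho> = \<rho> and c = c and c' = c' and r = r and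
      y = "R - r" and z = "int (32 + 2 * K + r)" and j = "k - Suc j" and acc = "\<Sum>i<j. (c' (r * k + i))\<^sup>2"]])
      show "\<bar>(\<Sum>i<j. (c' (r * k + i))\<^sup>2) + (c' (r * k + j))\<^sup>2\<bar> \<le> W ^ 3"
        using sum_squares_bound[OF st _ r, of "Suc j"] j by simp
    qed (use J st rk[OF j] 14 j kK in \<open>auto simp: J_def step_ok_def\<close>)
    ultimately show "0 < \<sigma>1 14 \<and> ok counter_com 25 \<sigma>1 (J (Suc j))" ..
  next
    fix \<sigma>1 assume "J k \<sigma>1"
    then show "\<not> 0 < \<sigma>1 14 \<and> J k \<sigma>1" by (simp add: J_def)
  qed (use that in auto)
  define X where "X = 32 + 2 * K + r"
  have XL: "X < cell_count k l" using r by (simp add: X_def cell_count_def)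
  have 3: "ok (block [Store 13 15, Arith Plus 13 13 6, Arith Minus 10 10 6]) 3 \<sigma>'
     (\<lambda>\<sigma>'. counters_inv \<rho> c c' (Suc r * k) \<sigma>' \<and> values_inv c' (Suc r) \<sigma>' \<and>
    \<sigma>' 10 = int (R - Suc r) \<and> \<sigma>' 13 = int (32 + 2 * K + Suc r))" if J: "J k \<sigma>'" for \<sigma>'
  proof (rule ok_block)
    have X: "a \<noteq> X" "X \<noteq> a" if "a < 32" for a using that by (auto simp: X_def)
    have regs: "\<sigma>' 13 = int X" "\<sigma>' 10 = int (R - r)" "\<sigma>' 15 = group_sum k c' r" "\<sigma>' 6 = 1"
      using J st unfolding J_def group_sum_def X_def counters_inv_def step_ok_def by auto
    have vb: "\<bar>group_sum k c' r\<bar> \<le> sketch_bd k l W X"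
      using sum_squares_bound[OF st order_refl r] by (simp add: group_sum_def sketch_bd_def X_def)
    have x1: "int X + 1 = int (Suc X)" by simp
    have r1: "int (R - r) - 1 = int (R - Suc r)" using r by simp
    have bX: "bnd W 7 (int (Suc X))"
      using r KW RW W2 by (intro bnd_address) (simp_all add: X_def)
    have bR: "bnd W 1 (int (R - Suc r))" using RW by (intro bnd_nat) simp
    have "counters_inv \<rho> c c' (Suc r * k) \<sigma>'' \<and> values_inv c' (Suc r) \<sigma>''"
      if "\<sigma>'' = \<sigma>'(X := group_sum k c' r, 13 := int (Suc X), 10 := int (R - Suc r))" for \<sigma>''
    proof -
      have "X \<noteq> 32 + K + i" if "i < K" for i using that by (simp add: X_def)
      moreover have "X \<noteq> a" if "a < 32 + K" for a using that by (simp add: X_def)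
      ultimately have "counters_inv \<rho> c c' (Suc r * k) \<sigma>''"
        using J unfolding J_def that counters_inv_def by (auto simp: add.commute)
      moreover have "values_inv c' (Suc r) \<sigma>''"
        unfolding values_inv_def
      proof (intro allI impI)
        fix q assume q: "q < Suc r"
        show "\<sigma>'' (32 + 2 * K + q) = group_sum k c' q"
        proof (cases "q = r")
          case True
          then show ?thesis by (simp add: that X_def)
        next
          case False
          with q J show ?thesis unfolding J_def values_inv_def by (auto simp: that X_def)
        qed
      qed
      ultimately show ?thesis ..
    qed
    note inv = this[OF refl]
    show "lwp (block [Store 13 15, Arith Plus 13 13 6, Arith Minus 10 10 6]) (\<lambda>\<sigma>'. counters_inv \<rho> c c' (Suc r * k) \<sigma>' \<and>
       values_inv c' (Suc r) \<sigma>' \<and> \<sigma>' 10 = int (R - Suc r) \<and> \<sigma>' 13 = int (32 + 2 * K + Suc r)) \<sigma>'"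
      using inv by (simp add: regs X XL vb x1 r1 reg_bound[OF bX, unfolded abs_of_nat] reg_bound[OF bR, unfolded abs_of_nat]
        X_def[symmetric] del: of_nat_add of_nat_Suc of_nat_diff)
  qed simp
  have "ok (group_com k) (2 + (((\<Sum>i<k. 25 + 1) + 1) + 3)) \<sigma> (\<lambda>\<sigma>'. counters_inv \<rho> c c' (Suc r * k) \<sigma>' \<and> values_inv c' (Suc r) \<sigma>' \<and>
    \<sigma>' 10 = int (R - Suc r) \<and> \<sigma>' 13 = int (32 + 2 * K + Suc r))"
    unfolding group_com_def
    by (intro ok_Seq ok_weaken[OF 1] ok_weaken[OF 2] 3 order_refl)
  then show ?thesis by (simp add: algebra_simps)
qed

lemma counters_ok:
  assumes st: "step_ok \<sigma> c c'" and c: "\<And>i. i < K \<Longrightarrow> \<sigma> (32 + K + i) = c i"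
  shows "ok (counters_com k l) (26 * K + 7 * R + 5) \<sigma> (\<lambda>\<sigma>'. counters_inv \<sigma> c c' K \<sigma>' \<and> values_inv c' R \<sigma>')"
proof -
  define I where "I = (\<lambda>r \<sigma>'. counters_inv \<sigma> c c' (r * k) \<sigma>' \<and> values_inv c' r \<sigma>' \<and>
    \<sigma>' 10 = int (R - r) \<and> \<sigma>' 13 = int (32 + 2 * K + r))"
  note bR = bnd_nat[OF RW] bnd_nat[OF KW]
  have bX: "bnd W 7 (int (32 + 2 * K))"
    using KW W2 by (intro bnd_address) simp_all
  have "(2::int) ^ 5 \<le> W ^ 5" using W2 by (intro power_mono) auto
  then have b32: "bnd W 5 32" by (simp add: bnd_def)
  have 1: "ok (block [Const 10 (int R), Const 11 32, Const 12 (int K), Const 13 (int (32 + 2 * K))]) 4 \<sigma> (I 0)"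
    using c unfolding I_def counters_inv_def values_inv_def
    by (intro ok_block) (simp_all add: reg_bound[OF bR(1), unfolded abs_of_nat] reg_bound[OF bR(2), unfolded abs_of_nat]
      reg_bound[OF bX, unfolded abs_of_nat] reg_bound[OF b32, unfolded abs_numeral] del: of_nat_add)
  have 2: "ok (While 10 (group_com k)) ((\<Sum>r<R. (26 * k + 6) + 1) + 1) \<sigma>'
    (\<lambda>\<sigma>'. counters_inv \<sigma> c c' K \<sigma>' \<and> values_inv c' R \<sigma>')" if "I 0 \<sigma>'" for \<sigma>'
  proof (rule ok_While[where I = I])
    fix r \<sigma>1 assume r: "r < R" and I: "I r \<sigma>1"
    have "ok (group_com k) (26 * k + 6) \<sigma>1 (I (Suc r))"
      using group_ok[OF st r, of \<sigma>1] I unfolding I_def by blast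
    with I r show "0 < \<sigma>1 10 \<and> ok (group_com k) (26 * k + 6) \<sigma>1 (I (Suc r))"
      by (simp add: I_def)
  next
    fix \<sigma>1 assume "I R \<sigma>1"
    then show "\<not> 0 < \<sigma>1 10 \<and> counters_inv \<sigma> c c' K \<sigma>1 \<and> values_inv c' R \<sigma>1"
      by (simp add: I_def counters_def mult.commute)
  qed (use that in auto)
  have "ok (counters_com k l) (4 + ((\<Sum>r<R. (26 * k + 6) + 1) + 1)) \<sigma> (\<lambda>\<sigma>'. counters_inv \<sigma> c c' K \<sigma>' \<and> values_inv c' R \<sigma>')"
    unfolding counters_com_def by (intro ok_Seq ok_weaken[OF 1] 2 order_refl)
  then show ?thesis by (simp add: counters_def algebra_simps)
qed


section \<open>One selection pass\<close>

definition frame :: "store \<Rightarrow> store \<Rightarrow> bool" where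
  "frame \<rho> \<sigma> \<longleftrightarrow> (\<forall>a\<in>{0, 2, 3, 4, 5, 6} \<union> {32..<32 + 2 * K}. \<sigma> a = \<rho> a)"

definition pass_inv :: "store \<Rightarrow> nat \<Rightarrow> nat \<Rightarrow> nat \<Rightarrow> int \<Rightarrow> (nat \<Rightarrow> int) \<Rightarrow> store \<Rightarrow> bool" where
  "pass_inv \<rho> Bs N b y A \<sigma> \<longleftrightarrow> frame \<rho> \<sigma> \<and> \<sigma> 7 = 0 \<and> \<sigma> 12 = int R \<and> \<sigma> 24 = 4 \<and> \<sigma> 21 = int Bs \<and>
     \<sigma> 22 = int N \<and> \<sigma> 23 = int b \<and> \<sigma> 13 = int (Bs + N) \<and> \<sigma> 20 = y \<and> (\<forall>p<N. \<sigma> (Bs + p) = A p)"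

definition pass_post :: "store \<Rightarrow> nat \<Rightarrow> nat \<Rightarrow> nat \<Rightarrow> nat \<Rightarrow> (nat \<Rightarrow> int) \<Rightarrow> store \<Rightarrow> bool" where
  "pass_post \<rho> Bs N b i A \<sigma>' \<longleftrightarrow> (\<exists>A'. reduces R b N A A' \<and> frame \<rho> \<sigma>' \<and> \<sigma>' 7 = 0 \<and>
     \<sigma>' 12 = int R \<and> \<sigma>' 24 = 4 \<and> \<sigma>' 21 = int (Bs + N) \<and> \<sigma>' 22 = int (N div 4) \<and> \<sigma>' 23 = int (2 * b) \<and>
     \<sigma>' 20 = int i \<and> (\<forall>p. \<sigma>' (Bs + N + p) = A' p))"

lemma address_bound: "x \<le> cell_count k l \<Longrightarrow> bnd W 7 (int x)"
  using KW RW W2 by (intro bnd_address) (simp_all add: cell_count_def)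

lemma le_R_bound: "x \<le> R \<Longrightarrow> bnd W 1 (int x)"
  using RW by (intro bnd_nat) linarith

context
  fixes Bs N b M :: nat and A :: "nat \<Rightarrow> int" and \<rho> :: store and y :: int
  assumes Bs: "32 + 2 * K \<le> Bs" "Bs + 2 * N \<le> cell_count k l" and N: "N \<le> R" "N = M * b" "0 < M" and b: "4 dvd b" "0 < b"
    and \<rho>6: "\<rho> 6 = 1"
begin

lemma pass_invD:
  assumes "pass_inv \<rho> Bs N b y A \<sigma>"
  shows "\<sigma> 6 = 1" "\<sigma> 7 = 0" "\<sigma> 12 = int R" "\<sigma> 24 = 4" "\<sigma> 21 = int Bs" "\<sigma> 22 = int N" "\<sigma> 23 = int b"
    "\<sigma> 13 = int (Bs + N)" "\<sigma> 20 = y"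
  using assms \<rho>6 by (auto simp: pass_inv_def frame_def)

lemma pass_inv_cong:
  assumes "pass_inv \<rho> Bs N b y A \<sigma>"
    and "\<And>a. a \<notin> {14, 15, 16, 25, 26, 27, 28, 29} \<Longrightarrow> \<not> Bs + N \<le> a \<Longrightarrow> \<sigma>' a = \<sigma> a"
  shows "pass_inv \<rho> Bs N b y A \<sigma>'"
proof -
  have "\<sigma>' a = \<sigma> a" if "a \<in> {0, 2, 3, 4, 5, 6, 7, 12, 13, 20, 21, 22, 23, 24} \<union> {32..<Bs + N}" for a
    using that Bs by (intro assms(2)) auto
  then show ?thesis using assms(1) Bs unfolding pass_inv_def frame_def by auto
qed

lemma value_bound:
  assumes "good \<sigma>" "pass_inv \<rho> Bs N b y A \<sigma>" "p < N"
  shows "\<bar>A p\<bar> \<le> W ^ 3" "bnd W 3 (A p)" "bnd W 4 (A p * int R)" "bnd W 5 (key R A p)"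
proof -
  have "\<bar>\<sigma> (Bs + p)\<bar> \<le> sketch_bd k l W (Bs + p)" using assms(1,3) Bs by (simp add: good_def)
  then show *: "\<bar>A p\<bar> \<le> W ^ 3" using assms(2,3) Bs by (simp add: pass_inv_def sketch_bd_def)
  then show 3: "bnd W 3 (A p)" by (simp add: bnd_def)
  show 4: "bnd W 4 (A p * int R)" using bnd_mult[OF 3 bnd_nat[OF RW]] by simp
  have "int p \<le> W" using assms(3) N RW by simp
  from bnd_add[OF 4 bnd_nat[OF this] W2] show "bnd W 5 (key R A p)" by (simp add: key_def)
qed

lemma compare_ok:
  assumes inv: "pass_inv \<rho> Bs N b y A \<sigma>" and q: "q < N" and j: "j < b"
    and regs: "\<sigma> 15 = int q" "\<sigma> 14 = int (Suc j)" "\<sigma> 28 = v" "\<sigma> 29 = int x" and v: "bnd W 5 v" and x: "x < b"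
  shows "ok compare_com 9 \<sigma> (\<lambda>\<sigma>'. \<exists>u u'. \<sigma>' = \<sigma>(27 := u, 16 := u',
    29 := int (x + (if key R A q < v then 1 else 0)), 15 := int (Suc q), 14 := int j))"
proof (rule ok_good)
  assume good: "good \<sigma>"
  note D = pass_invD[OF inv] regs
  note vb = value_bound[OF good inv q]
  have addr: "int Bs + int q = int (Bs + q)" by simp
  have qL: "Bs + q < cell_count k l" "Bs + q \<le> cell_count k l" using q Bs by auto
  have Aq: "\<sigma> (Bs + q) = A q" using inv q by (simp add: pass_inv_def)
  have ne: "Bs + q \<noteq> a" "a \<noteq> Bs + q" if "a < 32" for a using that Bs by auto
  have e: "int q + 1 = int (Suc q)" "int (Suc j) - 1 = int j" "int x + 1 = int (Suc x)" by auto
  have bN: "b \<le> N" using q N b by (cases M) auto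
  have le: "Suc q \<le> R" "j \<le> R" "Suc x \<le> R" using q j x N(1) bN by linarith+
  note bd = le_R_bound[OF le(1)] le_R_bound[OF le(2)] le_R_bound[OF le(3)]
  have b6: "bnd W 6 (v - key R A q)" using bnd_diff[OF v vb(4) W2] by simp
  note RB = reg_bound[OF vb(2)] reg_bound[OF vb(3)] reg_bound[OF vb(4)] reg_bound[OF b6]
    reg_bound[OF bd(1), unfolded abs_of_nat] reg_bound[OF bd(2), unfolded abs_of_nat] reg_bound[OF bd(3), unfolded abs_of_nat]
    reg_bound[OF address_bound[OF qL(2)], unfolded abs_of_nat]
  have k: "A q * int R + int q = key R A q" by (simp add: key_def)
  show ?thesis unfolding compare_com_def
    by (rule ok_block) (simp_all add: D addr qL Aq ne e RB k del: of_nat_add of_nat_Suc split: if_splits,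
      intro conjI impI, (rule exI[of _ "int (Bs + q)"], rule exI[of _ "v - key R A q"],
        simp add: fun_eq_iff D del: of_nat_add of_nat_Suc)+)
qed


text \<open>Entries are handled from the last to the first, so that the register that counts the
  remaining entries is also the index of the current one.\<close>

definition entry_inv :: "nat \<Rightarrow> store \<Rightarrow> bool" where
  "entry_inv p \<sigma> \<longleftrightarrow> pass_inv \<rho> Bs N b y A \<sigma> \<and> \<sigma> 25 = int p \<and>
     (\<forall>p'. p \<le> p' \<longrightarrow> p' < N \<longrightarrow> kept R A b p' \<longrightarrow> \<sigma> (Bs + N + out_index R A b p') = A p')"

lemma entry_ok:
  assumes inv: "entry_inv (Suc p) \<sigma>" and p: "p < N"
  shows "ok entry_com (10 * b + 21) \<sigma> (entry_inv p)"
proof (rule ok_good)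
  assume good: "good \<sigma>"
  define s where "s = p div b * b"
  define v where "v = key R A p"
  define rk where "rk = block_rank R A s b p"
  have pinv: "pass_inv \<rho> Bs N b y A \<sigma>" and p25: "\<sigma> 25 = int (Suc p)"
    and out: "\<And>p'. Suc p \<le> p' \<Longrightarrow> p' < N \<Longrightarrow> kept R A b p' \<Longrightarrow> \<sigma> (Bs + N + out_index R A b p') = A p'"
    using inv by (auto simp: entry_inv_def)
  note D = pass_invD[OF pinv] p25
  note vb = value_bound[OF good pinv p]
  have s: "s \<le> p" "p < s + b" using in_block[OF b(2), of p] by (auto simp: s_def)
  have sN: "s + b \<le> N" using block_bound[of p M b] p N by (simp add: s_def)
  have rkb: "rk < b" unfolding rk_def using s by (intro block_rank_lt) auto
  have ipb: "int p - int p mod int b = int s"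
  proof -
    have "int p = int (s + p mod b)" unfolding s_def by simp
    then show ?thesis by (simp add: zmod_int)
  qed
  have addr: "int Bs + int p = int (Bs + p)" by simp
  have pL: "Bs + p < cell_count k l" "Bs + p \<le> cell_count k l" using p Bs by auto
  have Ap: "\<sigma> (Bs + p) = A p" using pinv p by (simp add: pass_inv_def)
  have ne: "Bs + p \<noteq> a" "a \<noteq> Bs + p" if "a < 32" for a using that Bs by auto
  have le: "p \<le> R" "s \<le> R" "b \<le> R" "Suc rk \<le> R" "s + Suc rk \<le> R" using p s sN N(1) rkb by linarith+
  have mb: "bnd W 1 (int p mod int b)"
    using le_R_bound[OF le(3)] b(2) by (intro bnd_mod) auto
  note RB = reg_bound[OF vb(2)] reg_bound[OF vb(3)] reg_bound[OF vb(4)]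
    reg_bound[OF le_R_bound[OF le(1)], unfolded abs_of_nat] reg_bound[OF le_R_bound[OF le(2)], unfolded abs_of_nat]
    reg_bound[OF le_R_bound[OF le(3)], unfolded abs_of_nat] reg_bound[OF mb]
    reg_bound[OF address_bound[OF pL(2)], unfolded abs_of_nat]
  have key: "A p * int R + int p = v" by (simp add: key_def v_def)
  have e: "int (Suc p) - 1 = int p" by simp
  define \<sigma>1 where "\<sigma>1 = \<sigma>(25 := int p, 26 := int s, 27 := int (Bs + p), 28 := v, 29 := 0, 14 := int b, 15 := int s)"
  have z: "bnd W 0 0" using W2 by (simp add: bnd_def)
  have 1: "ok (block [Arith Minus 25 25 6, Arith Rem 26 25 23, Arith Minus 26 25 26, Arith Plus 27 21 25, Load 28 27,
       Arith Times 28 28 12, Arith Plus 28 28 25, Const 29 0, Arith Plus 14 23 7, Arith Plus 15 26 7]) 10 \<sigma> (\<lambda>\<sigma>'. \<sigma>' = \<sigma>1)"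
    by (rule ok_block) (simp_all add: D e ipb addr pL Ap ne RB key reg_bound[OF z, simplified] \<sigma>1_def v_def[symmetric] 
      vb(4)[THEN reg_bound] RB[unfolded v_def[symmetric]] abs_mod_less fun_eq_iff del: of_nat_add of_nat_Suc)
  define cn where "cn z = card {q \<in> {s..<s + z}. key R A q < v}" for z
  have cn_Suc: "cn (Suc z) = cn z + (if key R A (s + z) < v then 1 else 0)" for z
  proof -
    have "{q \<in> {s..<s + Suc z}. key R A q < v}
      = {q \<in> {s..<s + z}. key R A q < v} \<union> (if key R A (s + z) < v then {s + z} else {})"
      by (auto simp: less_Suc_eq)
    then show ?thesis unfolding cn_def by (simp add: card_insert_if)
  qed
  have cn_le: "cn z \<le> z" for z by (induction z) (auto simp: cn_Suc cn_def[of 0])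
  have cn_b: "cn b = rk" by (simp add: cn_def rk_def block_rank_def v_def)
  define J where "J z \<sigma>' = (\<exists>u u'. \<sigma>' = \<sigma>1(27 := u, 16 := u', 29 := int (cn z), 15 := int (s + z), 14 := int (b - z)))" for z \<sigma>'
  have J_inv: "pass_inv \<rho> Bs N b y A \<sigma>'" if "J z \<sigma>'" for z \<sigma>'
    using that Bs by (intro pass_inv_cong[OF pinv]) (auto simp: J_def \<sigma>1_def)
  have 2: "ok (While 14 compare_com) ((\<Sum>z<b. 9 + 1) + 1) \<sigma>1 (J b)"
  proof (rule ok_While[where I = J])
    show "J 0 \<sigma>1" unfolding J_def
      by (rule exI[of _ "\<sigma>1 27"], rule exI[of _ "\<sigma>1 16"]) (auto simp: \<sigma>1_def cn_def fun_eq_iff)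
  next
    fix z \<sigma>' assume z: "z < b" and J: "J z \<sigma>'"
    have regs: "\<sigma>' 15 = int (s + z)" "\<sigma>' 14 = int (Suc (b - Suc z))" "\<sigma>' 28 = v" "\<sigma>' 29 = int (cn z)"
      using J z by (auto simp: J_def \<sigma>1_def Suc_diff_Suc)
    have "ok compare_com 9 \<sigma>' (J (Suc z))"
    proof (rule ok_weaken[OF compare_ok[OF J_inv[OF J] _ _ regs]])
      fix \<sigma>'' assume "\<exists>u u'. \<sigma>'' = \<sigma>'(27 := u, 16 := u',
        29 := int (cn z + (if key R A (s + z) < v then 1 else 0)), 15 := int (Suc (s + z)), 14 := int (b - Suc z))"
      then obtain u u' where "\<sigma>'' = \<sigma>'(27 := u, 16 := u', 29 := int (cn (Suc z)), 15 := int (s + Suc z), 14 := int (b - Suc z))"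
        unfolding cn_Suc by auto
      with J have "\<sigma>'' = \<sigma>1(27 := u, 16 := u', 29 := int (cn (Suc z)), 15 := int (s + Suc z), 14 := int (b - Suc z))"
        by (auto simp: J_def fun_eq_iff)
      then show "J (Suc z) \<sigma>''" unfolding J_def by blast
    next
      show "cn z < b" using cn_le[of z] z by linarith
      show "bnd W 5 v" using vb(4) by (simp add: v_def)
    qed (use z sN in auto)
    with regs show "0 < \<sigma>' 14 \<and> ok compare_com 9 \<sigma>' (J (Suc z))" by simp
  qed (auto simp: J_def)
  have 3: "ok (Seq (block [Arith Plus 29 29 6, Arith Rem 16 29 24])
     (Cond 16 Skip (block [Arith Plus 29 29 26, Arith Quot 29 29 24, Arith Minus 29 29 6, Arith Plus 29 29 13,
       Arith Plus 27 21 25, Load 28 27, Store 29 28]))) 10 \<sigma>2 (entry_inv p)" if J: "J b \<sigma>2" for \<sigma>2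
  proof -
    define Z where "Z = s + Suc rk"
    define T where "T = Z div 4"
    define T' where "T' = T - 1"
    define X where "X = Bs + N + T'"
    have pinv2: "pass_inv \<rho> Bs N b y A \<sigma>2" using J_inv[OF J] .
    note D2 = pass_invD[OF pinv2]
    have regs: "\<sigma>2 25 = int p" "\<sigma>2 26 = int s" "\<sigma>2 29 = int rk"
      using J by (auto simp: J_def \<sigma>1_def cn_b)
    have out2: "\<sigma>2 (Bs + N + i) = \<sigma> (Bs + N + i)" for i
      using J Bs by (auto simp: J_def \<sigma>1_def)
    have A2: "\<sigma>2 (Bs + p) = A p" using pinv2 p by (simp add: pass_inv_def)
    have kp: "kept R A b p \<longleftrightarrow> 4 dvd Suc rk" by (simp add: kept_def rk_def s_def)
    have oi: "out_index R A b p = T'" by (simp add: out_index_def T'_def T_def Z_def rk_def s_def)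
    have r1: "int rk + 1 = int (Suc rk)" by simp
    have md: "int (Suc rk) mod 4 = int (Suc rk mod 4)" by (simp add: of_nat_mod)
    have md0: "0 < Suc rk mod 4 \<longleftrightarrow> \<not> kept R A b p" unfolding kp by (simp add: dvd_eq_mod_eq_0)
    have srk: "int (Suc rk) + int s = int Z" by (simp add: Z_def)
    have dv: "int Z div 4 = int T" by (simp add: T_def of_nat_div)
    have q0: "int T' + int (Bs + N) = int X" by (simp add: X_def)
    have q1: "int T - 1 = int T'" "T \<ge> 1" "X < cell_count k l" if "kept R A b p"
    proof -
      have "4 dvd s + Suc rk" using that b(1) unfolding kp s_def by (intro dvd_add) auto
      then show T: "T \<ge> 1" unfolding T_def Z_def by (auto elim!: dvdE)
      then show "int T - 1 = int T'" by (simp add: T'_def of_nat_diff)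
      have "T \<le> N" using sN rkb unfolding T_def Z_def by linarith
      with T Bs p show "X < cell_count k l" by (simp add: X_def T'_def)
    qed
    have nX: "a \<noteq> X" "X \<noteq> a" if "a < 32" for a using that Bs p by (auto simp: X_def)
    have TZ: "Z \<le> R" using le(5) by (simp add: Z_def)
    have TR: "T \<le> R" "T' \<le> R" "Suc rk mod 4 \<le> R"
    proof -
      show "T \<le> R" using TZ unfolding T_def by linarith
      then show "T' \<le> R" by (simp add: T'_def)
      have "Suc rk mod 4 \<le> Suc rk" by (rule mod_less_eq_dividend)
      then show "Suc rk mod 4 \<le> R" using le(4) by (rule order_trans)
    qed
    note RB2 = RB reg_bound[OF le_R_bound[OF TR(1)], unfolded abs_of_nat] reg_bound[OF le_R_bound[OF TR(2)], unfolded abs_of_nat]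
      reg_bound[OF le_R_bound[OF TR(3)], unfolded abs_of_nat] reg_bound[OF le_R_bound[OF le(4)], unfolded abs_of_nat]
      reg_bound[OF le_R_bound[OF TZ], unfolded abs_of_nat]
    have bX: "\<bar>int X\<bar> \<le> sketch_bd k l W a" if "kept R A b p" "a < 32" for a
      using that q1(3) by (intro reg_bound[OF address_bound]) auto
    have bA: "\<bar>A p\<bar> \<le> sketch_bd k l W X" using vb(1) Bs by (simp add: sketch_bd_def X_def)
    have skip: "entry_inv p \<sigma>'" if "\<not> kept R A b p" "\<sigma>' = \<sigma>2(29 := int (Suc rk), 16 := w')" for \<sigma>' w'
      unfolding entry_inv_def
    proof (intro conjI allI impI)
      show "pass_inv \<rho> Bs N b y A \<sigma>'" using that by (intro pass_inv_cong[OF pinv2]) auto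
      show "\<sigma>' 25 = int p" using that regs by simp
      fix p' assume p': "p \<le> p'" "p' < N" "kept R A b p'"
      then have "\<sigma> (Bs + N + out_index R A b p') = A p'" using that(1) by (intro out) (auto simp: order_less_le Suc_le_eq)
      then show "\<sigma>' (Bs + N + out_index R A b p') = A p'" using that(2) Bs out2 by simp
    qed
    have store: "entry_inv p \<sigma>'"
      if "kept R A b p" "\<sigma>' = \<sigma>2(16 := w', 29 := int X, 27 := int (Bs + p), 28 := A p, X := A p)" for \<sigma>' w'
      unfolding entry_inv_def
    proof (intro conjI allI impI)
      show "pass_inv \<rho> Bs N b y A \<sigma>'" using that by (intro pass_inv_cong[OF pinv2]) (auto simp: X_def)
      show "\<sigma>' 25 = int p" using that regs nX by simp
      fix p' assume p': "p \<le> p'" "p' < N" "kept R A b p'"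
      show "\<sigma>' (Bs + N + out_index R A b p') = A p'"
      proof (cases "p' = p")
        case True
        then show ?thesis using that(2) by (simp add: oi X_def)
      next
        case False
        \<comment> \<open>Injectivity of the output positions: the current store leaves the entries
          kept earlier intact.\<close>
        then have "out_index R A b p' \<noteq> T'"
          using out_index_inj[of p' M b p R A] p' p N b that(1) oi by auto
        moreover have "\<sigma> (Bs + N + out_index R A b p') = A p'" using p' False by (intro out) auto
        ultimately show ?thesis using that(2) Bs out2 by (simp add: X_def)
      qed
    qed
    show ?thesis
      by (rule ok_block) (simp_all add: D2 regs r1 md md0 srk dv q0 q1 addr pL A2 ne nX RB2 bX[unfolded abs_of_nat] bA
        skip[OF _ refl] store[OF _ refl] del: of_nat_add of_nat_Suc of_nat_mod of_nat_div split: if_splits)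
  qed
  have 4: "ok (Seq (While 14 compare_com) (Seq (block [Arith Plus 29 29 6, Arith Rem 16 29 24])
     (Cond 16 Skip (block [Arith Plus 29 29 26, Arith Quot 29 29 24, Arith Minus 29 29 6, Arith Plus 29 29 13,
       Arith Plus 27 21 25, Load 28 27, Store 29 28])))) (((\<Sum>z<b. 9 + 1) + 1) + 10) \<sigma>1 (entry_inv p)"
    by (intro ok_Seq[OF ok_weaken[OF 2]] 3 order_refl)
  have "ok entry_com (10 + (((\<Sum>z<b. 9 + 1) + 1) + 10)) \<sigma> (entry_inv p)"
    unfolding entry_com_def
    by (rule ok_Seq, rule ok_weaken[OF 1], erule ssubst, rule 4, rule order_refl)
  then show ?thesis by (simp add: algebra_simps)
qed


lemma pass_ok:
  assumes inv: "frame \<rho> \<sigma>" "\<sigma> 7 = 0" "\<sigma> 12 = int R" "\<sigma> 24 = 4" "\<sigma> 21 = int Bs" "\<sigma> 22 = int N" "\<sigma> 23 = int b"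
    "\<sigma> 20 = int (Suc i)" and A: "\<And>p. p < N \<Longrightarrow> \<sigma> (Bs + p) = A p" and y: "y = int (Suc i)" and i: "i \<le> R"
  shows "ok pass_com (N * (10 * b + 22) + 7) \<sigma> (\<lambda>\<sigma>'. pass_post \<rho> Bs N b i A \<sigma>')"
proof -
  have \<sigma>6: "\<sigma> 6 = 1" using inv(1) \<rho>6 by (simp add: frame_def)
  have BL: "Bs + N \<le> cell_count k l" using Bs by linarith
  have a1: "int Bs + int N = int (Bs + N)" by simp
  have 1: "ok (block [Arith Plus 13 21 22, Arith Plus 25 22 7]) 2 \<sigma> (entry_inv N)"
  proof (rule ok_block)
    have "entry_inv N (\<sigma>(13 := int (Bs + N), 25 := int N))"
      unfolding entry_inv_def pass_inv_def using inv A Bs y by (auto simp: frame_def)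
    then show "lwp (block [Arith Plus 13 21 22, Arith Plus 25 22 7]) (entry_inv N) \<sigma>"
      by (simp add: inv a1 reg_bound[OF address_bound[OF BL], unfolded abs_of_nat]
        reg_bound[OF le_R_bound[OF N(1)], unfolded abs_of_nat] del: of_nat_add)
  qed simp
  have 2: "ok (While 25 entry_com) ((\<Sum>j<N. (10 * b + 21) + 1) + 1) \<sigma>' (entry_inv 0)" if "entry_inv N \<sigma>'" for \<sigma>'
  proof (rule ok_While[where I = "\<lambda>j. entry_inv (N - j)"])
    fix j \<sigma>1 assume j: "j < N" and I: "entry_inv (N - j) \<sigma>1"
    have "N - j = Suc (N - Suc j)" using j by simp
    with I have I': "entry_inv (Suc (N - Suc j)) \<sigma>1" by simp
    have "ok entry_com (10 * b + 21) \<sigma>1 (entry_inv (N - Suc j))"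
      using j by (intro entry_ok[OF I']) simp
    moreover have "0 < \<sigma>1 25" using I' by (simp add: entry_inv_def)
    ultimately show "0 < \<sigma>1 25 \<and> ok entry_com (10 * b + 21) \<sigma>1 (entry_inv (N - Suc j))" by simp
  next
    fix \<sigma>1 assume "entry_inv (N - N) \<sigma>1"
    then show "\<not> 0 < \<sigma>1 25 \<and> entry_inv 0 \<sigma>1" by (simp add: entry_inv_def)
  qed (use that in simp_all)
  have 3: "ok (block [Arith Plus 21 13 7, Arith Quot 22 22 24, Arith Plus 23 23 23, Arith Minus 20 20 6]) 4 \<sigma>1
    (\<lambda>\<sigma>'. pass_post \<rho> Bs N b i A \<sigma>')" if I: "entry_inv 0 \<sigma>1" for \<sigma>1
  proof (rule ok_block)
    have pinv: "pass_inv \<rho> Bs N b y A \<sigma>1" using I by (simp add: entry_inv_def)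
    note D = pass_invD[OF pinv]
    define \<sigma>' where "\<sigma>' = \<sigma>1(21 := int (Bs + N), 22 := int (N div 4), 23 := int (2 * b), 20 := int i)"
    have red: "reduces R b N A (\<lambda>p. \<sigma>1 (Bs + N + p))"
      using I unfolding entry_inv_def reduces_def by simp
    have "frame \<rho> \<sigma>'" using pinv by (auto simp: pass_inv_def frame_def \<sigma>'_def)
    moreover have "\<sigma>' (Bs + N + p) = \<sigma>1 (Bs + N + p)" for p using Bs by (simp add: \<sigma>'_def)
    ultimately have post: "pass_post \<rho> Bs N b i A \<sigma>'" using red D unfolding pass_post_def by (intro exI[of _ "\<lambda>p. \<sigma>1 (Bs + N + p)"]) (simp add: \<sigma>'_def)
    have e: "int b + int b = int (2 * b)" "int N div 4 = int (N div 4)" "int (Suc i) - 1 = int i"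
      by (simp_all add: of_nat_div)
    have N4: "N div 4 \<le> R" using N(1) by linarith
    have "bnd W 2 (int (2 * b))"
    proof -
      have "b \<le> N" using N by simp
      then have "bnd W 1 (int b)" using N(1) by (intro le_R_bound) simp
      from bnd_add[OF this this W2] show ?thesis by (simp add: numeral_2_eq_2)
    qed
    note RB = reg_bound[OF this, unfolded abs_of_nat] reg_bound[OF le_R_bound[OF N4], unfolded abs_of_nat]
      reg_bound[OF le_R_bound[OF i], unfolded abs_of_nat] reg_bound[OF address_bound[OF BL], unfolded abs_of_nat]
    show "lwp (block [Arith Plus 21 13 7, Arith Quot 22 22 24, Arith Plus 23 23 23, Arith Minus 20 20 6])
      (\<lambda>\<sigma>'. pass_post \<rho> Bs N b i A \<sigma>') \<sigma>1"
      using post[unfolded \<sigma>'_def] by (simp add: D y e RB del: of_nat_add of_nat_mult of_nat_Suc of_nat_div)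
  qed simp
  have "ok pass_com (2 + (((\<Sum>j<N. (10 * b + 21) + 1) + 1) + 4)) \<sigma> (\<lambda>\<sigma>'. pass_post \<rho> Bs N b i A \<sigma>')"
    unfolding pass_com_def by (intro ok_Seq[OF ok_weaken[OF 1]] ok_Seq[OF ok_weaken[OF 2]] 3 order_refl)
  then show ?thesis by (simp add: algebra_simps)
qed

end

end

section \<open>The whole selection and the whole update\<close>

context sketch
begin

definition pass_len :: "nat \<Rightarrow> nat" where
  "pass_len i = 2 ^ (7 + 3 * l - 2 * i)"

definition pass_base :: "nat \<Rightarrow> nat" where
  "pass_base i = 32 + 2 * K + (\<Sum>j<i. pass_len j)"

lemma pass_len_Suc: "i \<le> l \<Longrightarrow> pass_len i = 4 * pass_len (Suc i)"
proof -
  assume "i \<le> l"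
  then have "7 + 3 * l - 2 * i = 2 + (7 + 3 * l - 2 * Suc i)" by simp
  then show ?thesis unfolding pass_len_def by (simp only: power_add) simp
qed

lemma pass_len_0: "pass_len 0 = R"
  by (simp add: pass_len_def groups_def)

lemma pass_len_le: "pass_len i \<le> R"
  unfolding pass_len_def groups_def by (intro power_increasing) auto

text \<open>Twice the current length leaves room for the array and its output. The claim is
  inherited by the next pass because its array starts right behind and is four times
  shorter.\<close>

lemma pass_base_bound: "i \<le> Suc l \<Longrightarrow> pass_base i + 2 * pass_len i \<le> cell_count k l"
proof (induction i)
  case 0
  then show ?case by (simp add: pass_base_def pass_len_0 cell_count_def)
next
  case (Suc i)
  then show ?case using pass_len_Suc[of i] by (simp add: pass_base_def)
qed

lemma sum_geometric_down: "m \<le> Suc a \<Longrightarrow> (\<Sum>i<m. 2 ^ (a - i)) + 2 ^ (Suc a - m) = (2::nat) ^ Suc a"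
proof (induction m)
  case (Suc m)
  then have "Suc a - m = Suc (a - m)" by simp
  with Suc show ?case by simp
qed simp

text \<open>Pass \<open>i\<close> takes about \<open>11 * 2 ^ (14 + 3 * l - i)\<close> steps, a
  geometric series with sum at most \<open>11 * 256 * R = 2816 * R\<close>. The rest,
  \<open>8 * Suc l + 11\<close>, is at most \<open>19 * R\<close>.\<close>

lemma pass_time: "(\<Sum>i<Suc l. (pass_len i * (10 * 2 ^ (7 + i) + 22) + 7) + 1) + 11 \<le> 2835 * R"
proof -
  have t: "(pass_len i * (10 * 2 ^ (7 + i) + 22) + 7) + 1 \<le> 11 * 2 ^ (14 + 3 * l - i) + 8" if "i < Suc l" for i
  proof -
    have "(22::nat) \<le> 2 ^ 7 * 2 ^ i" by (rule order_trans[of _ "2 ^ 7 * 1"], simp, intro mult_le_mono2) simp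
    then have "pass_len i * (10 * 2 ^ (7 + i) + 22) \<le> pass_len i * (11 * 2 ^ (7 + i))"
      by (intro mult_le_mono2) (simp add: power_add)
    also have "\<dots> = 11 * 2 ^ (14 + 3 * l - i)"
    proof -
      have "7 + 3 * l - 2 * i + (7 + i) = 14 + 3 * l - i" using that by simp
      then show ?thesis unfolding pass_len_def by (simp only: mult.left_commute[of _ 11] power_add[symmetric])
    qed
    finally show ?thesis by simp
  qed
  have "(\<Sum>i<Suc l. (pass_len i * (10 * 2 ^ (7 + i) + 22) + 7) + 1) \<le> (\<Sum>i<Suc l. 11 * 2 ^ (14 + 3 * l - i) + 8)"
    using t by (intro sum_mono) simp
  also have "\<dots> = 11 * (\<Sum>i<Suc l. 2 ^ (14 + 3 * l - i)) + 8 * Suc l"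
    by (simp only: sum.distrib sum_distrib_left sum_constant card_lessThan) simp
  also have "(\<Sum>i<Suc l. 2 ^ (14 + 3 * l - i)) \<le> (2::nat) ^ Suc (14 + 3 * l)"
    using sum_geometric_down[of "Suc l" "14 + 3 * l"] by linarith
  also have "(2::nat) ^ Suc (14 + 3 * l) = 256 * R" by (simp add: groups_def power_add)
  finally have le: "(\<Sum>i<Suc l. (pass_len i * (10 * 2 ^ (7 + i) + 22) + 7) + 1) \<le> 2816 * R + 8 * Suc l" by simp
  have "Suc l \<le> R"
  proof -
    have "Suc l \<le> 7 + 3 * l" by simp
    also have "\<dots> < R" unfolding groups_def by (rule less_exp)
    finally show ?thesis by simp
  qed
  then have "x + 11 \<le> 2835 * R" if "x \<le> 2816 * R + 8 * Suc l" for x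
    using that R_pos by auto
  then show ?thesis using le by blast
qed

lemma select_ok:
  assumes fr: "frame \<rho> \<sigma>" and \<rho>6: "\<rho> 6 = 1" and v: "\<And>q. q < R \<Longrightarrow> \<sigma> (32 + 2 * K + q) = v q"
  shows "ok (select_com k l) (2835 * R) \<sigma> (\<lambda>\<sigma>'. frame \<rho> \<sigma>' \<and> is_center l v (\<sigma>' 1))"
proof -
  \<comment> \<open>The sequence \<open>A\<close> records the arrays of all passes so far. It is
    needed in full at the end, because \<open>approx_median\<close> speaks about the whole
    history.\<close>
  define I where "I i \<sigma>' = (\<exists>A. (\<forall>p<R. A 0 p = v p) \<and> (\<forall>j<i. reduces R (2 ^ (7 + j)) (pass_len j) (A j) (A (Suc j))) \<and>
    frame \<rho> \<sigma>' \<and> \<sigma>' 7 = 0 \<and> \<sigma>' 12 = int R \<and> \<sigma>' 24 = 4 \<and> \<sigma>' 21 = int (pass_base i) \<and> \<sigma>' 22 = int (pass_len i) \<and>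
    \<sigma>' 23 = int (2 ^ (7 + i)) \<and> \<sigma>' 20 = int (Suc l - i) \<and> (\<forall>p<pass_len i. \<sigma>' (pass_base i + p) = A i p))" for i \<sigma>'
  have lR: "Suc l \<le> R"
  proof -
    have "Suc l \<le> 7 + 3 * l" by simp
    also have "\<dots> < R" unfolding groups_def by (rule less_exp)
    finally show ?thesis by simp
  qed
  have base0: "pass_base 0 = 32 + 2 * K" by (simp add: pass_base_def)
  have "(2::int) ^ 7 \<le> W ^ 7" using W2 by (intro power_mono) auto
  then have b: "bnd W 7 128" "bnd W 7 4" "bnd W 7 0" using W2 by (auto simp: bnd_def)
  have bL: "32 + 2 * K \<le> cell_count k l" by (simp add: cell_count_def)
  have 1: "ok (block [Const 7 0, Const 12 (int R), Const 20 (int (Suc l)), Const 21 (int (32 + 2 * K)),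
       Const 22 (int R), Const 23 128, Const 24 4]) 7 \<sigma> (I 0)"
  proof (rule ok_block)
    have "I 0 (\<sigma>(7 := 0, 12 := int R, 20 := int (Suc l), 21 := int (32 + 2 * K), 22 := int R, 23 := 128, 24 := 4))"
      unfolding I_def using fr v
      by (intro exI[of _ "\<lambda>_. v"]) (auto simp: frame_def base0 pass_len_0 simp del: of_nat_add of_nat_Suc)
    then show "lwp (block [Const 7 0, Const 12 (int R), Const 20 (int (Suc l)), Const 21 (int (32 + 2 * K)),
       Const 22 (int R), Const 23 128, Const 24 4]) (I 0) \<sigma>"
      by (simp add: reg_bound[OF b(1), unfolded abs_numeral] reg_bound[OF b(2), unfolded abs_numeral] reg_bound[OF b(3), unfolded abs_zero]
        reg_bound[OF le_R_bound[OF order_refl], unfolded abs_of_nat] reg_bound[OF le_R_bound[OF lR], unfolded abs_of_nat]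
        reg_bound[OF address_bound[OF bL], unfolded abs_of_nat] del: of_nat_add of_nat_Suc)
  qed simp
  have 2: "ok (While 20 pass_com) ((\<Sum>i<Suc l. (pass_len i * (10 * 2 ^ (7 + i) + 22) + 7) + 1) + 1) \<sigma>1 (I (Suc l))"
    if "I 0 \<sigma>1" for \<sigma>1
  proof (rule ok_While[where I = I])
    fix i \<sigma>2 assume i: "i < Suc l" and "I i \<sigma>2"
    then obtain A where A: "\<forall>p<R. A 0 p = v p" "\<forall>j<i. reduces R (2 ^ (7 + j)) (pass_len j) (A j) (A (Suc j))"
      and st: "frame \<rho> \<sigma>2" "\<sigma>2 7 = 0" "\<sigma>2 12 = int R" "\<sigma>2 24 = 4" "\<sigma>2 21 = int (pass_base i)" "\<sigma>2 22 = int (pass_len i)"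
        "\<sigma>2 23 = int (2 ^ (7 + i))" "\<sigma>2 20 = int (Suc l - i)" and val: "\<forall>p<pass_len i. \<sigma>2 (pass_base i + p) = A i p"
      unfolding I_def by blast
    have yi: "\<sigma>2 20 = int (Suc (l - i))" using st(8) i by (simp add: Suc_diff_le)
    have M: "pass_len i = 2 ^ (3 * (l - i)) * 2 ^ (7 + i)"
    proof -
      have "7 + 3 * l - 2 * i = 3 * (l - i) + (7 + i)" using i by simp
      then show ?thesis unfolding pass_len_def by (simp only: power_add)
    qed
    have d4: "4 dvd (2::nat) ^ (7 + i)" by (simp add: power_add)
    have base: "pass_base i + pass_len i = pass_base (Suc i)" by (simp add: pass_base_def)
    have b2: "2 * 2 ^ (7 + i) = (2::nat) ^ (7 + Suc i)" by (simp only: add_Suc_right power_Suc)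
    have li: "l - i = Suc l - Suc i" by simp
    have len: "pass_len i div 4 = pass_len (Suc i)" using pass_len_Suc[of i] i by simp
    have "ok pass_com (pass_len i * (10 * 2 ^ (7 + i) + 22) + 7) \<sigma>2 (I (Suc i))"
    proof (rule ok_weaken[OF pass_ok[where Bs = "pass_base i" and N = "pass_len i" and b = "2 ^ (7 + i)" and
          M = "2 ^ (3 * (l - i))" and A = "A i" and \<rho> = \<rho> and i = "l - i" and y = "int (Suc (l - i))"]])
      fix \<sigma>3
      assume "pass_post \<rho> (pass_base i) (pass_len i) (2 ^ (7 + i)) (l - i) (A i) \<sigma>3"
      then obtain A' where A': "reduces R (2 ^ (7 + i)) (pass_len i) (A i) A'" "frame \<rho> \<sigma>3" "\<sigma>3 7 = 0" "\<sigma>3 12 = int R" "\<sigma>3 24 = 4"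
        "\<sigma>3 21 = int (pass_base (Suc i))" "\<sigma>3 22 = int (pass_len (Suc i))" "\<sigma>3 23 = int (2 ^ (7 + Suc i))"
        "\<sigma>3 20 = int (Suc l - Suc i)" "\<forall>p. \<sigma>3 (pass_base (Suc i) + p) = A' p"
        unfolding pass_post_def base len b2 li by blast
      show "I (Suc i) \<sigma>3"
        unfolding I_def using A A' 
        by (intro exI[of _ "A(Suc i := A')"]) (auto simp: less_Suc_eq)
    qed (use i st yi val d4 M pass_base_bound[of i] pass_len_le[of i] \<rho>6 lR in \<open>auto simp: pass_base_def\<close>)
    with yi show "0 < \<sigma>2 20 \<and> ok pass_com (pass_len i * (10 * 2 ^ (7 + i) + 22) + 7) \<sigma>2 (I (Suc i))" by simp
  next
    fix \<sigma>2 assume "I (Suc l) \<sigma>2"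
    then show "\<not> 0 < \<sigma>2 20 \<and> I (Suc l) \<sigma>2" unfolding I_def by auto
  qed (use that in simp_all)
  have 3: "ok (block [Const 7 (2 ^ (l + 4)), Arith Plus 7 21 7, Load 1 7]) 3 \<sigma>1 (\<lambda>\<sigma>'. frame \<rho> \<sigma>' \<and> is_center l v (\<sigma>' 1))"
    if "I (Suc l) \<sigma>1" for \<sigma>1
  proof (rule ok_good)
    assume good: "good \<sigma>1"
    obtain A where A: "\<forall>p<R. A 0 p = v p" "\<forall>j<Suc l. reduces R (2 ^ (7 + j)) (pass_len j) (A j) (A (Suc j))"
      and st: "frame \<rho> \<sigma>1" "\<sigma>1 21 = int (pass_base (Suc l))"
      and val: "\<forall>p<pass_len (Suc l). \<sigma>1 (pass_base (Suc l) + p) = A (Suc l) p"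
      using \<open>I (Suc l) \<sigma>1\<close> unfolding I_def by blast
    define X where "X = pass_base (Suc l) + 2 ^ (l + 4)"
    have len: "2 ^ (l + 4) < pass_len (Suc l)"
      unfolding pass_len_def by (intro power_strict_increasing) auto
    have XL: "X < cell_count k l" "X \<le> cell_count k l" using pass_base_bound[of "Suc l"] len by (auto simp: X_def)
    have nX: "X \<noteq> a" if "a < 32" for a using that by (auto simp: X_def pass_base_def)
    have sX: "\<sigma>1 X = A (Suc l) (2 ^ (l + 4))" using val len by (simp add: X_def)
    have "\<bar>\<sigma>1 X\<bar> \<le> sketch_bd k l W X" using good XL by (simp add: good_def)
    then have "bnd W 3 (\<sigma>1 X)" by (simp add: bnd_def sketch_bd_def X_def pass_base_def)
    note RB = reg_bound[OF this, unfolded sX] reg_bound[OF address_bound[OF XL(2)], unfolded abs_of_nat]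
      reg_bound[OF le_R_bound[OF order_trans[OF less_imp_le[OF len] pass_len_le]], unfolded abs_of_nat]
    have c: "(2::int) ^ (l + 4) = int (2 ^ (l + 4))" by simp
    have a: "int (pass_base (Suc l)) + int (2 ^ (l + 4)) = int X" by (simp add: X_def)
    have "is_center l v (A (Suc l) (2 ^ (l + 4)))"
      unfolding is_center_def
    proof (intro allI impI)
      fix S assume S: "up_closed S \<or> down_closed S" "4 * card {p. p < R \<and> S (v p)} \<le> R"
      have "{p. p < R \<and> S (v p)} = {p. p < R \<and> S (A 0 p)}" using A(1) by auto
      with S(2) have few: "4 * card {p. p < 2 ^ (7 + 3 * l) \<and> S (A 0 p)} \<le> 2 ^ (7 + 3 * l)"
        by (simp add: groups_def)
      show "\<not> S (A (Suc l) (2 ^ (l + 4)))"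
        using A(2) by (intro approx_median[where A = A, OF _ S(1) few]) (simp add: groups_def pass_len_def)
    qed
    moreover have "frame \<rho> (\<sigma>1(7 := int X, 1 := A (Suc l) (2 ^ (l + 4))))"
      using st(1) by (auto simp: frame_def)
    ultimately show "ok (block [Const 7 (2 ^ (l + 4)), Arith Plus 7 21 7, Load 1 7]) 3 \<sigma>1 (\<lambda>\<sigma>'. frame \<rho> \<sigma>' \<and> is_center l v (\<sigma>' 1))"
      unfolding c by (intro ok_block) (simp_all add: st(2) a XL nX sX RB del: of_nat_power of_nat_add)
  qed
  have "ok (select_com k l) (7 + (((\<Sum>i<Suc l. (pass_len i * (10 * 2 ^ (7 + i) + 22) + 7) + 1) + 1) + 3)) \<sigma>
    (\<lambda>\<sigma>'. frame \<rho> \<sigma>' \<and> is_center l v (\<sigma>' 1))"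
    unfolding select_com_def by (intro ok_Seq[OF ok_weaken[OF 1]] ok_Seq[OF ok_weaken[OF 2]] 3 order_refl)
  then show ?thesis using pass_time by (rule_tac ok_weaken) auto
qed

lemma update_ok:
  assumes st: "step_ok \<sigma> c c'" and c: "\<And>i. i < K \<Longrightarrow> \<sigma> (32 + K + i) = c i" and mode: "0 < \<sigma> 3"
  shows "ok (update_com k l) (2874 * K) \<sigma> (\<lambda>\<sigma>'. (\<forall>a\<in>{2, 3, 4, 5, 6} \<union> {32..<32 + K}. \<sigma>' a = \<sigma> a) \<and>
    (\<forall>i<K. \<sigma>' (32 + K + i) = c' i) \<and> is_center l (group_sum k c') (\<sigma>' 1))"
proof -
  have 2: "ok (select_com k l) (2835 * R) \<sigma>1 (\<lambda>\<sigma>'. (\<forall>a\<in>{2, 3, 4, 5, 6} \<union> {32..<32 + K}. \<sigma>' a = \<sigma> a) \<and>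
    (\<forall>i<K. \<sigma>' (32 + K + i) = c' i) \<and> is_center l (group_sum k c') (\<sigma>' 1))"
    if inv: "counters_inv \<sigma> c c' K \<sigma>1 \<and> values_inv c' R \<sigma>1" for \<sigma>1
  proof (rule ok_weaken[OF select_ok[of \<sigma>1 \<sigma>1 "group_sum k c'"]])
    show "frame \<sigma>1 \<sigma>1" by (simp add: frame_def)
    show "\<sigma>1 6 = 1" using inv st by (simp add: counters_inv_def step_ok_def)
    show "\<sigma>1 (32 + 2 * K + q) = group_sum k c' q" if "q < R" for q using inv that by (simp add: values_inv_def)
    fix \<sigma>' assume \<sigma>': "frame \<sigma>1 \<sigma>' \<and> is_center l (group_sum k c') (\<sigma>' 1)"
    have "\<forall>a\<in>{2, 3, 4, 5, 6} \<union> {32..<32 + K}. \<sigma>' a = \<sigma> a"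
      using \<sigma>' inv unfolding frame_def counters_inv_def by auto
    moreover have "\<forall>i<K. \<sigma>' (32 + K + i) = c' i" using \<sigma>' inv unfolding frame_def counters_inv_def by auto
    ultimately show "(\<forall>a\<in>{2, 3, 4, 5, 6} \<union> {32..<32 + K}. \<sigma>' a = \<sigma> a) \<and>
      (\<forall>i<K. \<sigma>' (32 + K + i) = c' i) \<and> is_center l (group_sum k c') (\<sigma>' 1)" using \<sigma>' by blast
  qed simp
  have "ok (update_com k l) (Suc ((26 * K + 7 * R + 5) + 2835 * R)) \<sigma> (\<lambda>\<sigma>'. (\<forall>a\<in>{2, 3, 4, 5, 6} \<union> {32..<32 + K}. \<sigma>' a = \<sigma> a) \<and>
    (\<forall>i<K. \<sigma>' (32 + K + i) = c' i) \<and> is_center l (group_sum k c') (\<sigma>' 1))"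
    unfolding update_com_def using mode
    by (intro ok_Cond ok_Seq[OF ok_weaken[OF counters_ok[OF st c]]] 2) auto
  \<comment> \<open>2874 = 1 + 26 + 7 + 5 + 2835.\<close>
  moreover have "Suc ((26 * K + 7 * R + 5) + 2835 * R) \<le> 2874 * K" using RK K_pos by linarith
  ultimately show ?thesis by (rule_tac ok_weaken) auto
qed

end

section \<open>Processing a stream\<close>

context machine
begin

definition text_words :: "stream_alg \<Rightarrow> nat" where
  "text_words A = com_words w (init_prog A) + com_words w (update_prog A)"

text \<open>Lifts one update to the rest of the stream from time \<open>t\<close> on. Each reported
  estimate is tied to some store satisfying the invariant for its time, so accuracy can be discussed
  without the run.\<close>

lemma process_ok:
  assumes step: "\<And>t \<sigma>. t < length ps \<Longrightarrow> Inv t \<sigma> \<Longrightarrow> ok (update_prog A) T (\<sigma>(0 := int (ps ! t))) (Inv (Suc t))"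
    and item: "\<And>t. t < length ps \<Longrightarrow> int (ps ! t) \<le> bd 0"
    and "good \<sigma>" "Inv t \<sigma>" "t \<le> length ps"
  shows "\<exists>rs. process A w (drop t ps) (conc L \<sigma>) = return_spmf rs \<and> length rs = length ps - t \<and>
    (\<forall>i<length rs. (\<exists>\<sigma>'. Inv (Suc (t + i)) \<sigma>' \<and> estimate (rs ! i) = of_int (\<sigma>' 1) / of_int (\<sigma>' 2)) \<and>
      time (rs ! i) \<le> T * tick \<and> storage (rs ! i) \<le> P + text_words A)"
  using assms(3-5)
proof (induction "length ps - t" arbitrary: t \<sigma>)
  case 0
  then show ?case by simp
next
  case (Suc d)
  then have t: "t < length ps" by simp
  let ?\<sigma> = "\<sigma>(0 := int (ps ! t))"
  have good: "good ?\<sigma>" using Suc.prems(1) item[OF t] L by (auto simp: good_def)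
  from step[OF t Suc.prems(2)] good obtain \<sigma>1 where 1: "good \<sigma>1" "Inv (Suc t) \<sigma>1"
    "gives (exec w (update_prog A)) T ?\<sigma> \<sigma>1" unfolding ok_def by blast
  let ?s = "start w (conc L ?\<sigma>)"
  have "peak ?s \<le> P" using mem_words_conc[OF good] by (simp add: start_def)
  moreover have "memo ?s = conc L ?\<sigma>" "clock ?s = 0" by (simp_all add: start_def)
  ultimately obtain s where s: "exec w (update_prog A) ?s = return_spmf s" "memo s = conc L \<sigma>1"
    "clock s \<le> T * tick" "peak s \<le> P" using 1(3) unfolding gives_def by (metis add_0)
  from Suc.hyps(2) have d: "d = length ps - Suc t" by simp
  from Suc.hyps(1)[OF d 1(1,2)] t obtain rs where rs:
    "process A w (drop (Suc t) ps) (conc L \<sigma>1) = return_spmf rs" "length rs = length ps - Suc t"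
    "\<forall>i<length rs. (\<exists>\<sigma>'. Inv (Suc (Suc t + i)) \<sigma>' \<and> estimate (rs ! i) = of_int (\<sigma>' 1) / of_int (\<sigma>' 2)) \<and>
      time (rs ! i) \<le> T * tick \<and> storage (rs ! i) \<le> P + text_words A" by auto
  have "drop t ps = ps ! t # drop (Suc t) ps" using t by (simp add: Cons_nth_drop_Suc)
  then have "process A w (drop t ps) (conc L \<sigma>) = return_spmf (report_of A w s # rs)"
    using s(1,2) rs(1) by (simp add: conc_update)
  moreover have "estimate (report_of A w s) = of_int (\<sigma>1 1) / of_int (\<sigma>1 2)"
    "time (report_of A w s) \<le> T * tick" "storage (report_of A w s) \<le> P + text_words A"
    using s L by (simp_all add: report_of_def text_words_def)
  ultimately show ?case
    using rs(2,3) t 1(2) by (intro exI[of _ "report_of A w s # rs"]) (auto simp: nth_Cons split: nat.split)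
qed

end

section \<open>Small universes\<close>

text \<open>Table cells hold frequencies, of a constant number of words. Registers hold
  \<open>F2\<close> and addresses; if words are short compared with the number of cells, an address
  may take many words, so \<open>V\<close> depends on \<open>counters k l\<close>.\<close>

definition table_bd :: "int \<Rightarrow> int \<Rightarrow> nat \<Rightarrow> int" where
  "table_bd W V a = (if a < 32 then V else W)"

locale table = machine w "cell_count k l" "table_bd W V" V P \<kappa>
  for w k l :: nat and W V :: int and P \<kappa> :: nat +
  assumes W2: "2 \<le> W" and WV: "W\<^sup>2 + int (counters k l) + 128 \<le> V"
begin

lemma table_bounds: "0 \<le> V" "W \<le> V" "W\<^sup>2 \<le> V" "int (counters k l) + 128 \<le> V"
proof -
  have "W * 1 \<le> W\<^sup>2" unfolding power2_eq_square using W2 by (intro mult_left_mono) auto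
  then show "0 \<le> V" "W \<le> V" "W\<^sup>2 \<le> V" "int (counters k l) + 128 \<le> V" using WV W2 by (auto intro: order_trans)
qed

lemma table_ok:
  assumes p: "1 \<le> p" "p \<le> counters k l" and \<sigma>: "\<sigma> 0 = int p" "\<sigma> 6 = 1" "\<not> 0 < \<sigma> 3" "\<sigma> (31 + p) = int f" "\<sigma> 1 = int F"
    and f: "int (Suc f) \<le> W" "int (F + 2 * f + 1) \<le> W\<^sup>2"
  shows "ok (update_com k l) 8 \<sigma> (\<lambda>\<sigma>'. \<exists>u v y. \<sigma>' = \<sigma>(7 := u, 8 := v, 9 := y, 1 := int (F + 2 * f + 1), 31 + p := int (Suc f)))"
proof -
  have pL: "31 + p < cell_count k l" using p by (simp add: cell_count_def)
  define G where "G = F + 2 * f + 1"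
  have ne: "31 + p \<noteq> a" "a \<noteq> 31 + p" if "a < 32" for a using that p by auto
  have e: "int p + 31 = int (31 + p)" "int F + int f = int (F + f)" "int f + 1 = int (Suc f)"
    "int (F + f) + int (Suc f) = int G" by (auto simp: G_def)
  have b: "int f \<le> V" "int (Suc f) \<le> V" "int (F + f) \<le> V" "int G \<le> V" "int (31 + p) \<le> V" "31 \<le> V"
    using f table_bounds p by (auto simp: G_def)
  have tb: "table_bd W V (31 + p) = W" "\<And>a. a < 32 \<Longrightarrow> table_bd W V a = V" using p by (auto simp: table_bd_def)
  have "ok table_com 7 \<sigma> (\<lambda>\<sigma>'. \<exists>u v y. \<sigma>' = \<sigma>(7 := u, 8 := v, 9 := y, 1 := int G, 31 + p := int (Suc f)))"
    unfolding table_com_def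
  proof (rule ok_block)
    have "\<exists>u v y. \<sigma>(7 := 31, 8 := int (31 + p), 9 := int (Suc f), 1 := int G, 31 + p := int (Suc f))
      = \<sigma>(7 := u, 8 := v, 9 := y, 1 := int G, 31 + p := int (Suc f))" by blast
    then show "lwp (block [Const 7 31, Arith Plus 8 0 7, Load 9 8, Arith Plus 1 1 9, Arith Plus 9 9 6, Arith Plus 1 1 9,
      Store 8 9]) (\<lambda>\<sigma>'. \<exists>u v y. \<sigma>' = \<sigma>(7 := u, 8 := v, 9 := y, 1 := int G, 31 + p := int (Suc f))) \<sigma>"
      by (simp add: \<sigma> e pL ne b f tb del: of_nat_add of_nat_Suc of_nat_mult One_nat_def)
  qed simp
  then have "ok (update_com k l) (Suc 7) \<sigma> (\<lambda>\<sigma>'. \<exists>u v y. \<sigma>' = \<sigma>(7 := u, 8 := v, 9 := y, 1 := int G, 31 + p := int (Suc f)))"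
    unfolding update_com_def using \<sigma>(3) by (intro ok_Cond) auto
  then show ?thesis by (simp add: G_def)
qed

lemma table_init_ok:
  assumes n: "n \<le> counters k l" "int n \<le> W"
  shows "ok (init_com k l) 5 ((\<lambda>_. 0)(0 := int n)) (\<lambda>\<sigma>. \<sigma> = (\<lambda>_. 0)(0 := int n, 6 := 1, 2 := 1,
    7 := int (counters k l), 3 := int n - int (counters k l)))"
proof -
  have tb: "table_bd W V a = V" if "a < 32" for a using that by (simp add: table_bd_def)
  have b: "1 \<le> V" "int (counters k l) \<le> V" "\<bar>int n - int (counters k l)\<bar> \<le> V" using table_bounds n by auto
  have 1: "ok (block [Const 6 1, Const 2 1, Const 7 (int (counters k l)), Arith Minus 3 0 7]) 4 ((\<lambda>_. 0)(0 := int n))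
    (\<lambda>\<sigma>. \<sigma> = (\<lambda>_. 0)(0 := int n, 6 := 1, 2 := 1, 7 := int (counters k l), 3 := int n - int (counters k l)))"
    by (rule ok_block) (simp_all add: tb b)
  have "ok (init_com k l) (4 + Suc 0) ((\<lambda>_. 0)(0 := int n)) (\<lambda>\<sigma>. \<sigma> = (\<lambda>_. 0)(0 := int n, 6 := 1, 2 := 1,
    7 := int (counters k l), 3 := int n - int (counters k l)))"
    unfolding init_com_def
    by (rule ok_Seq, rule ok_weaken[OF 1], rule ok_Cond) (use n in \<open>auto intro: ok_Skip\<close>)
  then show ?thesis by simp
qed

end

section \<open>Initialisation of the sketch\<close>

text \<open>Registers have to accommodate \<open>B ^ K\<close>, where \<open>B <= W ^ 20\<close>;
  all other cells obey the bounds of the update phase.\<close>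

definition init_bd :: "nat \<Rightarrow> nat \<Rightarrow> int \<Rightarrow> nat \<Rightarrow> int" where
  "init_bd k l W a = (if a < 32 then W ^ (20 * counters k l + 32) else sketch_bd k l W a)"

locale sketch_init = machine w "cell_count k l" "init_bd k l W" "W ^ (20 * counters k l + 32)" P \<kappa>
  for w k l :: nat and W :: int and P \<kappa> :: nat +
  fixes n b :: nat
  assumes W2: "2 \<le> W" and k: "0 < k" and KW: "int (counters k l) \<le> W" and nW: "int n \<le> W"
    and b: "int n ^ 3 \<le> 2 ^ b" "\<And>i. i < b \<Longrightarrow> 2 ^ i < int n ^ 3" and hW: "2 * 2 ^ b \<le> W ^ 5"
    and nK: "counters k l < n"
begin

abbreviation "K \<equiv> counters k l"

definition B :: int where "B = (2 * 2 ^ b) ^ 4"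

lemma B_pos: "0 < B" by (simp add: B_def)

lemma B_le: "B \<le> W ^ 20"
  using power_mono[OF hW, of 4] by (simp add: B_def flip: power_mult)

lemma init_reg_bound: "bnd W e x \<Longrightarrow> e \<le> 20 * K + 32 \<Longrightarrow> a < 32 \<Longrightarrow> \<bar>x\<bar> \<le> init_bd k l W a"
  using bnd_mono[of W e x "20 * K + 32"] W2 by (simp add: init_bd_def bnd_def)

lemma init_reg_bound32: "bnd W e x \<Longrightarrow> e \<le> 32 \<Longrightarrow> a < 32 \<Longrightarrow> \<bar>x\<bar> \<le> init_bd k l W a"
  by (rule init_reg_bound) auto

lemma prepare_ok:
  "ok (block [Const 6 1, Const 2 1, Const 7 (int K), Arith Minus 3 0 7]) 4 ((\<lambda>_. 0)(0 := int n))
    (\<lambda>\<sigma>. \<sigma> = (\<lambda>_. 0)(0 := int n, 6 := 1, 2 := 1, 7 := int K, 3 := int n - int K))"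
proof -
  have "bnd W 1 1" "bnd W 1 (int K)" "bnd W 1 (int n - int K)" using W2 KW nW nK by (auto simp: bnd_def)
  note RB = this[THEN init_reg_bound32]
  show ?thesis by (rule ok_block) (simp_all add: RB[unfolded abs_of_nat abs_one])
qed

text \<open>The claimed time bound concerns the updates, so the time of the loops of the
  initialisation is just some number \<open>T\<close>.\<close>

lemma modulus_ok:
  assumes \<sigma>: "\<sigma> 0 = int n"
  shows "\<exists>T. ok modulus_com T \<sigma> (\<lambda>\<sigma>'. \<exists>u v. \<sigma>' = \<sigma>(8 := u, 9 := v, 5 := 2 ^ b, 4 := 2 * 2 ^ b, 10 := B) \<and> bnd W 3 u \<and> bnd W 6 v)"
proof -
  define N3 where "N3 = int n * int n * int n"
  have N3: "N3 = int n ^ 3" by (simp add: N3_def power3_eq_cube)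
  have b1: "bnd W 1 (int n)" by (rule bnd_nat[OF nW])
  have b2: "bnd W 2 (int n * int n)" using bnd_mult[OF b1 b1] by (simp only: one_add_one)
  have b3: "bnd W 3 N3" unfolding N3_def using bnd_mult[OF b2 b1] by simp
  have bp: "bnd W 5 (2 ^ i)" if "i \<le> b" for i
  proof -
    have "(2::int) ^ i \<le> 2 ^ b" using that by (intro power_increasing) auto
    then have "(2::int) ^ i \<le> W ^ 5" using hW zero_less_power[of "2::int" b] by linarith
    then show ?thesis by (simp add: bnd_def)
  qed
  have bd: "bnd W 6 (N3 - 2 ^ i)" if "i \<le> b" for i
    using bnd_diff[OF b3 bp[OF that] W2] by simp
  define J where "J i \<sigma>' \<longleftrightarrow> \<sigma>' = \<sigma>(8 := N3, 5 := 2 ^ i, 9 := N3 - 2 ^ i)" for i \<sigma>'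
  have 1: "ok (block [Arith Times 8 0 0, Arith Times 8 8 0, Const 5 1, Arith Minus 9 8 5]) 4 \<sigma> (J 0)"
    unfolding J_def using bp[of 0] bd[of 0]
    by (intro ok_block) (simp_all add: \<sigma> N3_def[symmetric] init_reg_bound32[OF b2, unfolded abs_mult abs_of_nat] init_reg_bound32[OF b3] init_reg_bound32[of 5]
      init_reg_bound32[of 6] init_reg_bound32[OF bp[of 0], unfolded power_0 abs_one])
  have 2: "ok (While 9 (block [Arith Plus 5 5 5, Arith Minus 9 8 5])) ((\<Sum>i<b. 2 + 1) + 1) \<sigma>1 (J b)" if "J 0 \<sigma>1" for \<sigma>1
  proof (rule ok_While[where I = J])
    fix i \<sigma>1 assume i: "i < b" and J: "J i \<sigma>1"
    have "bnd W 5 (2 ^ Suc i)" "bnd W 6 (N3 - 2 ^ Suc i)" using i bp[of "Suc i"] bd[of "Suc i"] by auto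
    note RB = this[THEN init_reg_bound32]
    have e: "(2::int) ^ i + 2 ^ i = 2 ^ Suc i" by simp
    have r5: "(2::int) ^ Suc i \<le> init_bd k l W 5" using RB(1)[of 5] by (simp del: power_Suc)
    have "ok (block [Arith Plus 5 5 5, Arith Minus 9 8 5]) 2 \<sigma>1 (J (Suc i))"
      using J unfolding J_def by (intro ok_block) (simp_all add: e r5 RB fun_upd_twist del: power_Suc)
    with J b(2)[OF i] show "0 < \<sigma>1 9 \<and> ok (block [Arith Plus 5 5 5, Arith Minus 9 8 5]) 2 \<sigma>1 (J (Suc i))"
      by (simp add: J_def N3)
  next
    fix \<sigma>1 assume "J b \<sigma>1"
    then show "\<not> 0 < \<sigma>1 9 \<and> J b \<sigma>1" using b(1) by (simp add: J_def N3)
  qed (use that in auto)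
  have 3: "ok (block [Arith Plus 4 5 5, Arith Times 10 4 4, Arith Times 10 10 10]) 3 \<sigma>1
    (\<lambda>\<sigma>'. \<exists>u v. \<sigma>' = \<sigma>(8 := u, 9 := v, 5 := 2 ^ b, 4 := 2 * 2 ^ b, 10 := B) \<and> bnd W 3 u \<and> bnd W 6 v)" if J: "J b \<sigma>1" for \<sigma>1
  proof -
    define M where "M = 2 * (2::int) ^ b"
    have e: "(2::int) ^ b + 2 ^ b = M" "M * M * (M * M) = B" by (simp_all add: M_def B_def eval_nat_numeral)
    have bM: "bnd W 5 M" using hW by (simp add: bnd_def M_def)
    have bMM: "bnd W 10 (M * M)" using bnd_mult[OF bM bM] by simp
    have bB: "bnd W 20 B" using B_le B_pos by (simp add: bnd_def)
    note RB = bM[THEN init_reg_bound32] bMM[THEN init_reg_bound32] bB[THEN init_reg_bound32]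
    have post: "\<exists>u v. \<sigma>(8 := N3, 5 := 2 ^ b, 9 := N3 - 2 ^ b, 4 := M, 10 := B)
      = \<sigma>(8 := u, 9 := v, 5 := 2 ^ b, 4 := M, 10 := B) \<and> bnd W 3 u \<and> bnd W 6 v"
      by (rule exI[of _ N3], rule exI[of _ "N3 - 2 ^ b"]) (simp add: b3 bd fun_eq_iff)
    show ?thesis
      unfolding J[unfolded J_def] M_def[symmetric]
    proof (rule ok_block)
      show "lwp (block [Arith Plus 4 5 5, Arith Times 10 4 4, Arith Times 10 10 10])
        (\<lambda>\<sigma>'. \<exists>u v. \<sigma>' = \<sigma>(8 := u, 9 := v, 5 := 2 ^ b, 4 := M, 10 := B) \<and> bnd W 3 u \<and> bnd W 6 v)
        (\<sigma>(8 := N3, 5 := 2 ^ b, 9 := N3 - 2 ^ b))"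
        using post by (simp add: e RB RB(2)[simplified])
    qed simp
  qed
  have "ok modulus_com (4 + (((\<Sum>i<b. 2 + 1) + 1) + 3)) \<sigma> (\<lambda>\<sigma>'. \<exists>u v. \<sigma>' = \<sigma>(8 := u, 9 := v, 5 := 2 ^ b, 4 := 2 * 2 ^ b, 10 := B)
    \<and> bnd W 3 u \<and> bnd W 6 v)"
    unfolding modulus_com_def by (intro ok_Seq[OF ok_weaken[OF 1]] ok_Seq[OF ok_weaken[OF 2]] 3 order_refl)
  then show ?thesis by blast
qed

lemma bnd_power_B: "i \<le> K \<Longrightarrow> bnd W (20 * K) (B ^ i)"
proof -
  assume i: "i \<le> K"
  have "B ^ i \<le> B ^ K" using i B_pos by (intro power_increasing) auto
  also have "\<dots> \<le> (W ^ 20) ^ K" using B_pos B_le by (intro power_mono) auto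
  finally show ?thesis using B_pos by (simp add: bnd_def flip: power_mult)
qed

lemma power_ok:
  assumes \<sigma>: "\<sigma> 6 = 1" "\<sigma> 10 = B"
  shows "\<exists>T. ok (power_com K) T \<sigma> (\<lambda>\<sigma>'. \<sigma>' = \<sigma>(11 := B ^ K, 12 := 0))"
proof -
  define J where "J i \<sigma>' \<longleftrightarrow> \<sigma>' = \<sigma>(11 := B ^ i, 12 := int (K - i))" for i \<sigma>'
  have bK: "bnd W 1 (int i)" if "i \<le> K" for i using that KW by (intro bnd_nat) linarith
  have bB: "\<bar>B ^ i\<bar> \<le> init_bd k l W a" if "i \<le> K" "a < 32" for i a
    by (rule init_reg_bound[OF bnd_power_B[OF that(1)] _ that(2)]) simp
  have 1: "ok (block [Const 11 1, Const 12 (int K)]) 2 \<sigma> (J 0)"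
    unfolding J_def using bB[of 0] init_reg_bound32[OF bK[OF order_refl], unfolded abs_of_nat] by (intro ok_block) simp_all
  have 2: "ok (While 12 (block [Arith Times 11 11 10, Arith Minus 12 12 6])) ((\<Sum>i<K. 2 + 1) + 1) \<sigma>1 (\<lambda>\<sigma>'. \<sigma>' = \<sigma>(11 := B ^ K, 12 := 0))"
    if "J 0 \<sigma>1" for \<sigma>1
  proof (rule ok_While[where I = J])
    fix i \<sigma>1 assume i: "i < K" and J: "J i \<sigma>1"
    have e: "B ^ i * B = B ^ Suc i" "int (K - i) - 1 = int (K - Suc i)" using i by simp_all
    have i': "Suc i \<le> K" using i by simp
    have "ok (block [Arith Times 11 11 10, Arith Minus 12 12 6]) 2 \<sigma>1 (J (Suc i))"
      using J unfolding J_def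
      by (intro ok_block) (simp_all add: \<sigma> e bB[OF i'] init_reg_bound32[OF bK[OF diff_le_self], unfolded abs_of_nat] fun_upd_twist
        del: power_Suc of_nat_diff)
    with J i show "0 < \<sigma>1 12 \<and> ok (block [Arith Times 11 11 10, Arith Minus 12 12 6]) 2 \<sigma>1 (J (Suc i))" by (simp add: J_def)
  next
    fix \<sigma>1 assume "J K \<sigma>1"
    then show "\<not> 0 < \<sigma>1 12 \<and> \<sigma>1 = \<sigma>(11 := B ^ K, 12 := 0)" by (simp add: J_def)
  qed (use that in auto)
  have "ok (power_com K) (2 + ((\<Sum>i<K. 2 + 1) + 1)) \<sigma> (\<lambda>\<sigma>'. \<sigma>' = \<sigma>(11 := B ^ K, 12 := 0))"
    unfolding power_com_def by (intro ok_Seq[OF ok_weaken[OF 1]] 2 order_refl)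
  then show ?thesis by blast
qed

lemma unpack_ok:
  assumes \<sigma>: "\<sigma> 6 = 1" "\<sigma> 10 = B" "\<sigma> 11 = X" "\<bar>\<sigma> 14\<bar> \<le> W ^ 20" and X: "0 \<le> X" "X < B ^ K"
  shows "\<exists>T. ok (unpack_com K) T \<sigma> (\<lambda>\<sigma>'. \<exists>u. \<bar>u\<bar> \<le> W ^ 20 \<and> \<sigma>' = (\<lambda>a. if 32 \<le> a \<and> a < 32 + K then dig B (a - 32) X
    else (\<sigma>(11 := 0, 12 := 0, 13 := int (32 + K), 14 := u)) a))"
proof -
  \<comment> \<open>The bound \<open>W ^ 20\<close> on register 14 is carried along because the
    final store must satisfy the smaller bounds of the update phase.\<close>
  define J where "J i \<sigma>' \<longleftrightarrow> (\<exists>u. \<bar>u\<bar> \<le> W ^ 20 \<and> \<sigma>' = (\<lambda>a. if 32 \<le> a \<and> a < 32 + i then dig B (a - 32) X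
    else (\<sigma>(11 := X div B ^ i, 12 := int (K - i), 13 := int (32 + i), 14 := u)) a))" for i \<sigma>'
  have bK: "bnd W 1 (int i)" if "i \<le> K" for i using that KW by (intro bnd_nat) linarith
  have bA: "bnd W 7 (int (32 + i))" if "i \<le> K" for i
    using that KW W2 by (intro bnd_address) simp_all
  have bX: "\<bar>X div B ^ i\<bar> \<le> init_bd k l W a" if "a < 32" for i a
  proof -
    have "bnd W (20 * K) X" using X bnd_power_B[of K] by (simp add: bnd_def)
    then have "bnd W (20 * K) (X div B ^ i)" using X B_pos by (intro bnd_div) auto
    then show ?thesis using that by (rule_tac init_reg_bound) auto
  qed
  have bdig: "\<bar>dig B i X\<bar> \<le> W ^ 20" for i
    using dig_range[OF B_pos, of i X] B_le by simp
  then have bdig': "\<bar>dig B i X\<bar> \<le> init_bd k l W a" if "a < 32" for i a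
    using that by (intro init_reg_bound32[of 20]) (auto simp: bnd_def)
  have 1: "ok (block [Const 12 (int K), Const 13 32]) 2 \<sigma> (J 0)"
  proof (rule ok_block)
    have "J 0 (\<sigma>(12 := int K, 13 := 32))"
      unfolding J_def using \<sigma> by (intro exI[of _ "\<sigma> 14"]) (auto simp: fun_eq_iff)
    then show "lwp (block [Const 12 (int K), Const 13 32]) (J 0) \<sigma>"
      using init_reg_bound32[OF bK[OF order_refl], unfolded abs_of_nat] init_reg_bound32[OF bA[of 0]] by simp
  qed simp
  have 2: "ok (While 12 (block [Arith Rem 14 11 10, Store 13 14, Arith Quot 11 11 10, Arith Plus 13 13 6, Arith Minus 12 12 6]))
    ((\<Sum>i<K. 5 + 1) + 1) \<sigma>1 (J K)" if "J 0 \<sigma>1" for \<sigma>1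
  proof (rule ok_While[where I = J])
    fix i \<sigma>1 assume i: "i < K" and J: "J i \<sigma>1"
    then obtain u where u: "\<sigma>1 = (\<lambda>a. if 32 \<le> a \<and> a < 32 + i then dig B (a - 32) X
      else (\<sigma>(11 := X div B ^ i, 12 := int (K - i), 13 := int (32 + i), 14 := u)) a)" unfolding J_def by blast
    then have regs: "\<sigma>1 6 = 1" "\<sigma>1 10 = B" "\<sigma>1 11 = X div B ^ i" "\<sigma>1 12 = int (K - i)" "\<sigma>1 13 = int (32 + i)"
      using \<sigma> by auto
    have "X div B ^ i div B = X div B ^ Suc i"
      using B_pos by (simp only: power_Suc2 zdiv_zmult2_eq less_imp_le)
    moreover have "X div B ^ i mod B = dig B i X" "int (K - i) - 1 = int (K - Suc i)" "int (32 + i) + 1 = int (33 + i)"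
      using i by (auto simp: dig_def)
    ultimately have e: "X div B ^ i mod B = dig B i X" "X div B ^ i div B = X div B ^ Suc i"
      "int (K - i) - 1 = int (K - Suc i)" "int (32 + i) + 1 = int (33 + i)" by blast+
    have iL: "32 + i < cell_count k l" using i by (simp add: cell_count_def)
    have ne: "32 + i \<noteq> a" "a \<noteq> 32 + i" if "a < 32" for a using that by auto
    have bS: "\<bar>dig B i X\<bar> \<le> init_bd k l W (32 + i)" using bdig i by (simp add: init_bd_def sketch_bd_def)
    have bA': "bnd W 7 (int (33 + i))" using bA[of "Suc i"] i by simp
    have post: "J (Suc i) (\<sigma>1(14 := dig B i X, 32 + i := dig B i X, 11 := X div B ^ Suc i, 13 := int (33 + i), 12 := int (K - Suc i)))"
      unfolding J_def u using bdig[of i] by (intro exI[of _ "dig B i X"]) (auto simp: fun_eq_iff less_Suc_eq)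
    have "ok (block [Arith Rem 14 11 10, Store 13 14, Arith Quot 11 11 10, Arith Plus 13 13 6, Arith Minus 12 12 6]) 5 \<sigma>1 (J (Suc i))"
      using post by (intro ok_block) (simp_all add: regs e iL ne bS bX bdig' init_reg_bound32[OF bA', unfolded abs_of_nat]
        init_reg_bound32[OF bK[OF diff_le_self], unfolded abs_of_nat] del: of_nat_add of_nat_Suc of_nat_diff power_Suc)
    with regs i show "0 < \<sigma>1 12 \<and>
      ok (block [Arith Rem 14 11 10, Store 13 14, Arith Quot 11 11 10, Arith Plus 13 13 6, Arith Minus 12 12 6]) 5 \<sigma>1 (J (Suc i))" by simp
  next
    fix \<sigma>1 assume "J K \<sigma>1"
    then show "\<not> 0 < \<sigma>1 12 \<and> J K \<sigma>1" unfolding J_def by auto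
  qed (use that in auto)
  have "ok (unpack_com K) (2 + ((\<Sum>i<K. 5 + 1) + 1)) \<sigma> (J K)"
    unfolding unpack_com_def by (intro ok_Seq[OF ok_weaken[OF 1]] 2 order_refl)
  moreover have z: "X div B ^ K = 0" "int (K - K) = 0" using X by simp_all
  ultimately show ?thesis unfolding J_def z by blast
qed


text \<open>The first conjunct is goodness with respect to the bounds of the update phase: registers
  have held a huge number, but only small ones are left behind. It hands over from one set of bounds
  to the other.\<close>

definition init_state :: "int \<Rightarrow> store \<Rightarrow> bool" where
  "init_state X \<sigma> \<longleftrightarrow> (\<forall>a<cell_count k l. \<bar>\<sigma> a\<bar> \<le> sketch_bd k l W a) \<and> \<sigma> 1 = 0 \<and> \<sigma> 2 = int k \<and> 0 < \<sigma> 3 \<and>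
     \<sigma> 4 = 2 * 2 ^ b \<and> \<sigma> 5 = 2 ^ b \<and> \<sigma> 6 = 1 \<and> (\<forall>j<K. \<sigma> (32 + j) = dig B j X) \<and> (\<forall>a\<ge>32 + K. \<sigma> a = 0)"

definition prepared :: "int \<Rightarrow> int \<Rightarrow> store" where
  "prepared u v = (\<lambda>_. 0)(0 := int n, 6 := 1, 2 := int k, 7 := int K, 3 := int n - int K, 8 := u, 9 := v, 5 := 2 ^ b,
     4 := 2 * 2 ^ b, 10 := B, 11 := B ^ K, 12 := 0)"

lemma before_random_ok:
  "\<exists>T. ok (Seq (Instr (Const 2 (int k))) (Seq modulus_com (power_com K))) T
    ((\<lambda>_. 0)(0 := int n, 6 := 1, 2 := 1, 7 := int K, 3 := int n - int K))
    (\<lambda>\<sigma>. \<exists>u v. \<sigma> = prepared u v \<and> bnd W 3 u \<and> bnd W 6 v)"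
proof -
  define \<sigma>1 :: store where "\<sigma>1 = (\<lambda>_. 0)(0 := int n, 6 := 1, 2 := int k, 7 := int K, 3 := int n - int K)"
  have kK: "k \<le> K" by (simp add: counters_def groups_def)
  then have "bnd W 1 (int k)" using KW by (intro bnd_nat) linarith
  note kb = init_reg_bound32[OF this, unfolded abs_of_nat]
  have 1: "ok (Instr (Const 2 (int k))) 1 ((\<lambda>_. 0)(0 := int n, 6 := 1, 2 := 1, 7 := int K, 3 := int n - int K)) (\<lambda>\<sigma>. \<sigma> = \<sigma>1)"
    by (rule ok_Instr) (simp_all add: kb \<sigma>1_def fun_eq_iff)
  obtain T2 where 2: "ok modulus_com T2 \<sigma>1 (\<lambda>\<sigma>'. \<exists>u v. \<sigma>' = \<sigma>1(8 := u, 9 := v, 5 := 2 ^ b, 4 := 2 * 2 ^ b, 10 := B) \<and>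
      bnd W 3 u \<and> bnd W 6 v)"
    using modulus_ok[of \<sigma>1] by (auto simp: \<sigma>1_def)
  define \<sigma>2 where "\<sigma>2 u v = \<sigma>1(8 := u, 9 := v, 5 := 2 ^ b, 4 := 2 * 2 ^ b, 10 := B)" for u v
  have "\<exists>T. ok (power_com K) T (\<sigma>2 u v) (\<lambda>\<sigma>'. \<sigma>' = (\<sigma>2 u v)(11 := B ^ K, 12 := 0))" for u v
    by (rule power_ok) (simp_all add: \<sigma>2_def \<sigma>1_def)
  then obtain T3 where 3: "ok (power_com K) (T3 u v) (\<sigma>2 u v) (\<lambda>\<sigma>'. \<sigma>' = (\<sigma>2 u v)(11 := B ^ K, 12 := 0))" for u v
    by metis
  have prep: "(\<sigma>2 u v)(11 := B ^ K, 12 := 0) = prepared u v" for u v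
    by (simp add: \<sigma>2_def \<sigma>1_def prepared_def)
  show ?thesis
  \<comment> \<open>The budget \<open>T3\<close> depends on \<open>u\<close> and \<open>v\<close>,
    which are determined only by an actual run; without goodness there is none and the claim is
    vacuous.\<close>
  proof (cases "good \<sigma>1")
    case False
    then show ?thesis using 1 by (auto simp: ok_def)
  next
    case True
    with 2 obtain u v where uv: "good (\<sigma>2 u v)" "gives (exec w modulus_com) T2 \<sigma>1 (\<sigma>2 u v)" "bnd W 3 u" "bnd W 6 v"
      unfolding ok_def \<sigma>2_def by blast
    have "ok modulus_com T2 \<sigma>1 (\<lambda>\<sigma>'. ok (power_com K) (T3 u v) \<sigma>' (\<lambda>\<sigma>. \<exists>u v. \<sigma> = prepared u v \<and> bnd W 3 u \<and> bnd W 6 v))"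
      unfolding ok_def[of modulus_com]
    proof (intro impI exI conjI)
      show "ok (power_com K) (T3 u v) (\<sigma>2 u v) (\<lambda>\<sigma>. \<exists>u v. \<sigma> = prepared u v \<and> bnd W 3 u \<and> bnd W 6 v)"
        by (rule ok_weaken[OF 3]) (use uv prep in blast)+
    qed (use uv in auto)
    from ok_Seq[OF this] have 4: "ok (Seq modulus_com (power_com K)) (T2 + T3 u v) \<sigma>1 (\<lambda>\<sigma>. \<exists>u v. \<sigma> = prepared u v \<and> bnd W 3 u \<and> bnd W 6 v)" .
    have "ok (Seq (Instr (Const 2 (int k))) (Seq modulus_com (power_com K))) (1 + (T2 + T3 u v))
      ((\<lambda>_. 0)(0 := int n, 6 := 1, 2 := 1, 7 := int K, 3 := int n - int K)) (\<lambda>\<sigma>. \<exists>u v. \<sigma> = prepared u v \<and> bnd W 3 u \<and> bnd W 6 v)"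
      by (rule ok_Seq, rule ok_weaken[OF 1], erule ssubst, rule 4, rule order_refl)
    then show ?thesis by blast
  qed
qed

lemma init_state_unpacked:
  assumes uv: "bnd W 3 u" "bnd W 6 v" and y: "\<bar>y\<bar> \<le> W ^ 20" and X: "0 \<le> X" "X < B ^ K"
  shows "init_state X (\<lambda>a. if 32 \<le> a \<and> a < 32 + K then dig B (a - 32) X
    else ((prepared u v)(11 := 0, 12 := 0, 13 := int (32 + K), 14 := y)) a)" (is "init_state X ?\<sigma>")
proof -
  have kK: "k \<le> K" by (simp add: counters_def groups_def)
  have up: "bnd W 32 x" if "bnd W e x" "e \<le> 32" for e x using that W2 by (auto intro: bnd_mono)
  have b1: "bnd W 1 1" "bnd W 1 (int n)" "bnd W 1 (int k)" "bnd W 1 (int K)" "bnd W 1 (int n - int K)" "bnd W 1 0"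
    using W2 KW nW nK kK by (auto simp: bnd_def)
  have b5: "bnd W 5 (2 * 2 ^ b)" "bnd W 5 (2 ^ b)"
  proof -
    show *: "bnd W 5 (2 * 2 ^ b)" using hW by (simp add: bnd_def)
    have "(2::int) ^ b \<le> 2 * 2 ^ b" by simp
    then have "(2::int) ^ b \<le> W ^ 5" using hW by (rule order_trans)
    then show "bnd W 5 (2 ^ b)" by (simp add: bnd_def)
  qed
  have bB: "bnd W 20 B" "bnd W 20 y" using B_le B_pos y by (auto simp: bnd_def)
  have bA: "bnd W 7 (int (32 + K))"
    using KW W2 by (intro bnd_address) simp_all
  note U = b1[THEN up] b5[THEN up] bB[THEN up] uv[THEN up] bA[THEN up]
  have "\<bar>?\<sigma> a\<bar> \<le> sketch_bd k l W a" if "a < cell_count k l" for a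
  proof (cases "a < 32")
    case True
    have "bnd W 32 (((prepared u v)(11 := 0, 12 := 0, 13 := int (32 + K), 14 := y)) a)"
      unfolding prepared_def fun_upd_apply using U by simp
    with True show ?thesis by (simp add: sketch_bd_def bnd_def)
  next
    case False
    show ?thesis
    proof (cases "a < 32 + K")
      case True
      have "\<bar>dig B (a - 32) X\<bar> \<le> W ^ 20" using dig_range[OF B_pos, of "a - 32" X] B_le by simp
      with True False show ?thesis by (simp add: sketch_bd_def)
    next
      case False
      then show ?thesis using W2 by (simp add: prepared_def sketch_bd_def)
    qed
  qed
  then show ?thesis using nK unfolding init_state_def by (auto simp: prepared_def)
qed

text \<open>\<open>Rand\<close> lies outside the logic, so the program is cut there: before it the
  run has a single outcome, and after it the outcome is a function of the number \<open>X\<close>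
  drawn.\<close>

lemma init_ok:
  "\<exists>fin. exec w (init_com k l) (start w (conc (cell_count k l) ((\<lambda>_. 0)(0 := int n)))) = map_spmf fin (spmf_of_set {0..<B ^ K}) \<and>
    (\<forall>X\<in>{0..<B ^ K}. \<exists>\<sigma>. memo (fin X) = conc (cell_count k l) \<sigma> \<and> peak (fin X) \<le> P \<and> init_state X \<sigma>)"
proof -
  let ?L = "cell_count k l"
  let ?\<sigma>0 = "(\<lambda>_. 0)(0 := int n) :: store"
  let ?pre = "Seq (Instr (Const 2 (int k))) (Seq modulus_com (power_com K))"
  let ?post = "Seq (Instr (Rand 11 11)) (unpack_com K)"
  have WW: "0 \<le> W" using W2 by simp
  have good0: "good ?\<sigma>0"
    unfolding good_def
  proof (intro allI impI)
    fix a assume "a < ?L"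
    have "bnd W 1 (int n)" by (rule bnd_nat[OF nW])
    from init_reg_bound32[OF this, of 0] WW show "\<bar>?\<sigma>0 a\<bar> \<le> init_bd k l W a"
      by (auto simp: init_bd_def sketch_bd_def)
  qed
  define \<sigma>1 :: store where "\<sigma>1 = (\<lambda>_. 0)(0 := int n, 6 := 1, 2 := 1, 7 := int K, 3 := int n - int K)"
  let ?blk = "block [Const 6 1, Const 2 1, Const 7 (int K), Arith Minus 3 0 7]"
  let ?s0 = "start w (conc ?L ?\<sigma>0)"
  have s0: "memo ?s0 = conc ?L ?\<sigma>0" "peak ?s0 \<le> P" using mem_words_conc[OF good0] by (auto simp: start_def)
  from prepare_ok good0 have 1: "good \<sigma>1" "gives (exec w ?blk) 4 ?\<sigma>0 \<sigma>1" unfolding ok_def \<sigma>1_def by blast+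
  from gives_bind[OF 1(2) gives_charge[OF 1(1), of 3]] s0 obtain s1 where
    "exec w ?blk ?s0 \<bind> (\<lambda>s. return_spmf (charge_test w 3 s)) = return_spmf s1" "memo s1 = conc ?L \<sigma>1" "peak s1 \<le> P"
    unfolding gives_def by (auto simp del: start_def)
  moreover from 1(2) s0 obtain s1' where s1': "exec w ?blk ?s0 = return_spmf s1'" "memo s1' = conc ?L \<sigma>1" unfolding gives_def by blast
  ultimately have s1: "memo (charge_test w 3 s1') = conc ?L \<sigma>1" "peak (charge_test w 3 s1') \<le> P" by auto
  obtain T where "ok ?pre T \<sigma>1 (\<lambda>\<sigma>. \<exists>u v. \<sigma> = prepared u v \<and> bnd W 3 u \<and> bnd W 6 v)"
    using before_random_ok unfolding \<sigma>1_def by blast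
  with 1(1) obtain u v where uv: "good (prepared u v)" "gives (exec w ?pre) T \<sigma>1 (prepared u v)" "bnd W 3 u" "bnd W 6 v"
    unfolding ok_def by blast
  with s1 obtain s2 where s2: "exec w ?pre (charge_test w 3 s1') = return_spmf s2" "memo s2 = conc ?L (prepared u v)" "peak s2 \<le> P"
    unfolding gives_def by blast
  have pos: "positive 3 s1'" using s1'(2) L nK by (simp add: positive_def \<sigma>1_def)
  have run: "exec w (init_com k l) ?s0 = exec w ?post s2"
    unfolding init_com_def exec.simps s1'(1) using pos s2(1) by simp
  define c where "c = instr_cost w (Rand 11 11) (memo s2)"
  define s3 where "s3 = (\<lambda>X. advance w c (conc ?L ((prepared u v)(11 := X))) s2)"
  have r11: "rd (memo s2) 11 = B ^ K" unfolding s2(2) using L by (simp add: prepared_def)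
  have "exec w (Instr (Rand 11 11)) s2 = map_spmf s3 (spmf_of_set {0..<B ^ K})"
    using r11 B_pos by (simp add: s3_def c_def spmf.map_comp comp_def s2(2) conc_update)
  then have post: "exec w ?post s2 = spmf_of_set {0..<B ^ K} \<bind> (\<lambda>X. exec w (unpack_com K) (s3 X))"
    by (simp add: map_spmf_conv_bind_spmf)
  have "\<exists>s. exec w (unpack_com K) (s3 X) = return_spmf s \<and> (\<exists>\<sigma>. memo s = conc ?L \<sigma> \<and> peak s \<le> P \<and> init_state X \<sigma>)"
    if X: "X \<in> {0..<B ^ K}" for X
  proof -
    let ?\<sigma>3 = "(prepared u v)(11 := X)"
    have "bnd W (20 * K) X" using X bnd_power_B[of K] by (simp add: bnd_def)
    then have "\<bar>X\<bar> \<le> init_bd k l W 11" by (rule init_reg_bound) auto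
    then have good3: "good ?\<sigma>3" using uv(1) by (auto simp: good_def)
    have s3: "memo (s3 X) = conc ?L ?\<sigma>3" "peak (s3 X) \<le> P"
      using peak_advance[OF good3 s2(3)] by (auto simp: s3_def advance_def)
    have "\<exists>T. ok (unpack_com K) T ?\<sigma>3 (\<lambda>\<sigma>'. \<exists>y. \<bar>y\<bar> \<le> W ^ 20 \<and> \<sigma>' = (\<lambda>a. if 32 \<le> a \<and> a < 32 + K then dig B (a - 32) X
      else (?\<sigma>3(11 := 0, 12 := 0, 13 := int (32 + K), 14 := y)) a))"
      by (rule unpack_ok) (use X WW in \<open>auto simp: prepared_def\<close>)
    with good3 obtain T \<sigma> y where y: "\<bar>y\<bar> \<le> W ^ 20" and \<sigma>: "\<sigma> = (\<lambda>a. if 32 \<le> a \<and> a < 32 + K then dig B (a - 32) X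
      else (?\<sigma>3(11 := 0, 12 := 0, 13 := int (32 + K), 14 := y)) a)" and g: "gives (exec w (unpack_com K)) T ?\<sigma>3 \<sigma>"
      unfolding ok_def by blast
    have "init_state X \<sigma>"
      unfolding \<sigma> fun_upd_upd using init_state_unpacked[OF uv(3,4) y, of X] X by auto
    moreover obtain s where "exec w (unpack_com K) (s3 X) = return_spmf s" "memo s = conc ?L \<sigma>" "peak s \<le> P"
      using g s3 unfolding gives_def by blast
    ultimately show ?thesis by blast
  qed
  then obtain fin where fin: "\<And>X. X \<in> {0..<B ^ K} \<Longrightarrow> exec w (unpack_com K) (s3 X) = return_spmf (fin X) \<and>
    (\<exists>\<sigma>. memo (fin X) = conc ?L \<sigma> \<and> peak (fin X) \<le> P \<and> init_state X \<sigma>)" by metis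
  have "exec w (init_com k l) ?s0 = spmf_of_set {0..<B ^ K} \<bind> (\<lambda>X. return_spmf (fin X))"
    unfolding run post by (rule bind_spmf_cong) (use fin in auto)
  then show ?thesis using fin by (intro exI[of _ fin]) (simp add: map_spmf_conv_bind_spmf)
qed

end

section \<open>Resources\<close>

primrec nodes :: "com \<Rightarrow> nat" where
  "nodes Skip = 1"
| "nodes (Instr i) = 1"
| "nodes (Seq c d) = nodes c + nodes d"
| "nodes (Cond a c d) = 1 + nodes c + nodes d"
| "nodes (While a c) = 1 + nodes c"

fun iwf :: "(int \<Rightarrow> bool) \<Rightarrow> instr \<Rightarrow> bool" where
  "iwf Q (Const a c) \<longleftrightarrow> a < 32 \<and> Q c"
| "iwf Q (Arith f a b c) \<longleftrightarrow> a < 32 \<and> b < 32 \<and> c < 32"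
| "iwf Q (Load a b) \<longleftrightarrow> a < 32 \<and> b < 32"
| "iwf Q (Store a b) \<longleftrightarrow> a < 32 \<and> b < 32"
| "iwf Q (Rand a b) \<longleftrightarrow> a < 32 \<and> b < 32"

primrec cwf :: "(int \<Rightarrow> bool) \<Rightarrow> com \<Rightarrow> bool" where
  "cwf Q Skip \<longleftrightarrow> True"
| "cwf Q (Instr i) \<longleftrightarrow> iwf Q i"
| "cwf Q (Seq c d) \<longleftrightarrow> cwf Q c \<and> cwf Q d"
| "cwf Q (Cond a c d) \<longleftrightarrow> a < 32 \<and> cwf Q c \<and> cwf Q d"
| "cwf Q (While a c) \<longleftrightarrow> a < 32 \<and> cwf Q c"

text \<open>As in \<open>tick\<close>, one operation code and three register names take at most 19
  words; \<kappa> is for a constant.\<close>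

lemma com_words_le:
  assumes "cwf (\<lambda>c. words w c \<le> \<kappa>) c" "0 < w"
  shows "com_words w c \<le> nodes c * (19 + \<kappa>)"
proof -
  have reg: "awords w a \<le> 6" if "a < 32" for a
    using assms(2) that by (intro words_le_bits[where b = 5, simplified]) auto
  show ?thesis using assms(1)
  proof (induction c)
    case (Instr i)
    then show ?case using reg by (cases i) (fastforce dest: reg)+
  next
    case (Seq c d)
    then have "com_words w c \<le> nodes c * (19 + \<kappa>)" "com_words w d \<le> nodes d * (19 + \<kappa>)" by auto
    then show ?case by (simp add: algebra_simps)
  next
    case (Cond a c d)
    then have "com_words w c \<le> nodes c * (19 + \<kappa>)" "com_words w d \<le> nodes d * (19 + \<kappa>)" "awords w a \<le> 6"
      using reg by auto
    then show ?case by (simp add: algebra_simps)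
  next
    case (While a c)
    then have "com_words w c \<le> nodes c * (19 + \<kappa>)" "awords w a \<le> 6" using reg by auto
    then show ?case by (simp add: algebra_simps)
  qed simp
qed

lemma counters_bits:
  assumes "0 < k"
  obtains e where "counters k l < 2 ^ e" "2 ^ e \<le> 2 * counters k l"
proof -
  have "1 \<le> counters k l" using assms by (simp add: counters_def groups_def)
  from ex_power_ivl1[of 2, OF _ this] obtain e where "2 ^ e \<le> counters k l" "counters k l < 2 ^ (e + 1)" by auto
  then show ?thesis by (intro that[of "e + 1"]) auto
qed

text \<open>With one-bit words an address takes log \<open>K\<close> words and arithmetic on
  addresses takes the square of that in time; the bound shows that both are
  O(\<open>K\<close>).\<close>

lemma square_le_power2: "(e + 12)\<^sup>2 \<le> 144 * 2 ^ e" for e :: nat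
proof (induction e)
  case (Suc e)
  have "(Suc e + 12)\<^sup>2 \<le> 2 * (e + 12)\<^sup>2" by (simp add: power2_eq_square algebra_simps)
  also have "\<dots> \<le> 2 * (144 * 2 ^ e)" by (intro mult_le_mono2 Suc.IH)
  finally show ?case by simp
qed simp

text \<open>The constants in the text are below \<open>2 ^ (e + 8)\<close> and take at most
  \<open>e + 9\<close> words, whatever the word size. The two programs have at most 150 nodes, and
  43200 = 150 * 288.\<close>

lemma text_words_bound:
  assumes k: "0 < k" and w: "0 < w"
  shows "com_words w (init_com k l) + com_words w (update_com k l) \<le> 43200 * counters k l"
proof -
  obtain e where e: "counters k l < 2 ^ e" "2 ^ e \<le> 2 * counters k l" using counters_bits[OF k] .
  define Q where "Q c \<longleftrightarrow> words w c \<le> e + 9" for c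
  have gk: "groups l \<le> counters k l" "k \<le> counters k l" using k by (simp_all add: counters_def groups_def)
  have Q: "Q (int x)" if "x \<le> 32 + 2 * counters k l" for x
  proof -
    have "(1::nat) \<le> 2 ^ e" by simp
    then have "x < 256 * 2 ^ e" using that e(1) by linarith
    then have "int x < 256 * 2 ^ e" by (metis of_nat_less_iff of_nat_mult of_nat_numeral of_nat_power)
    then have "\<bar>int x\<bar> < 2 ^ (e + 8)" by (simp add: power_add)
    from words_le_bits[OF this w] show ?thesis by (simp add: Q_def)
  qed
  have num: "Q 0" "Q 1" "Q 4" "Q 31" "Q 32" using Q[of 0] Q[of 1] Q[of 4] Q[of 31] Q[of 32] by simp_all
  have "128 \<le> groups l" unfolding groups_def by (simp add: power_add)
  then have 128: "Q 128" using Q[of 128] gk by simp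
  have lg: "Suc l \<le> groups l"
  proof -
    have "Suc l \<le> 7 + 3 * l" by simp
    also have "\<dots> < groups l" unfolding groups_def by (rule less_exp)
    finally show ?thesis by simp
  qed
  have "(2::nat) ^ (l + 4) \<le> groups l" unfolding groups_def by (intro power_increasing) auto
  then have pw: "Q (2 ^ (l + 4))" using Q[of "2 ^ (l + 4)"] gk by simp
  have par: "Q (int k)" "Q (int (groups l))" "Q (int (counters k l))" "Q (int (32 + 2 * counters k l))" "Q (int (Suc l))"
    using gk lg by (intro Q; linarith)+
  note defs = hash_com_def counter_com_def group_com_def counters_com_def compare_com_def entry_com_def pass_com_def
    select_com_def table_com_def update_com_def modulus_com_def power_com_def unpack_com_def init_com_def
  have "cwf Q (init_com k l)" "cwf Q (update_com k l)"
    using num 128 pw par unfolding defs by (simp_all del: of_nat_add of_nat_mult of_nat_Suc)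
  then have "com_words w (init_com k l) \<le> nodes (init_com k l) * (19 + (e + 9))"
    "com_words w (update_com k l) \<le> nodes (update_com k l) * (19 + (e + 9))"
    unfolding Q_def by (simp_all only: com_words_le[OF _ w])
  moreover have "nodes (init_com k l) + nodes (update_com k l) \<le> 150"
    unfolding defs by simp
  then have "(nodes (init_com k l) + nodes (update_com k l)) * (e + 28) \<le> 150 * (e + 28)" by (rule mult_le_mono1)
  moreover have "e + 28 \<le> 288 * counters k l"
  proof -
    have "e + 28 \<le> (e + 12)\<^sup>2" by (simp add: power2_eq_square algebra_simps)
    also have "\<dots> \<le> 144 * 2 ^ e" by (rule square_le_power2)
    finally show ?thesis using e(2) by linarith
  qed
  ultimately show ?thesis by (simp add: algebra_simps)
qed

lemma start_memory: "(replicate L 0)[0 := int n] = conc L ((\<lambda>_. 0)(0 := int n))"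
proof -
  have "replicate L 0 = conc L (\<lambda>_. 0)" by (simp add: conc_def map_replicate_const)
  then show ?thesis by (simp add: conc_update)
qed

lemma freq_le: "freq ps t x \<le> t"
  by (induction t) (auto simp: freq_Suc)

lemma F2_le: "t \<le> length ps \<Longrightarrow> set ps \<subseteq> {1..n} \<Longrightarrow> F2 n ps t \<le> t\<^sup>2"
proof (induction t)
  case (Suc t)
  then have "ps ! t \<in> {1..n}" by (meson Suc_le_lessD nth_mem subsetD)
  then have "F2 n ps (Suc t) = F2 n ps t + 2 * freq ps t (ps ! t) + 1" by (rule F2_Suc)
  also have "\<dots> \<le> t\<^sup>2 + 2 * t + 1" using Suc freq_le[of ps t] by (simp add: add_mono)
  finally show ?case by (simp add: power2_eq_square)
qed simp

lemma cell_count_le: "0 < k \<Longrightarrow> cell_count k l \<le> 36 * counters k l"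
proof -
  assume "0 < k"
  then have "groups l \<le> counters k l" "1 \<le> counters k l" by (simp_all add: counters_def groups_def)
  then show ?thesis by (simp add: cell_count_def)
qed

section \<open>The two modes of the algorithm\<close>

definition run_bounds :: "nat \<Rightarrow> nat \<Rightarrow> nat \<Rightarrow> report list \<Rightarrow> bool" where
  "run_bounds k l m rs \<longleftrightarrow> length rs = Suc m \<and> (\<forall>t\<le>m. storage (rs ! t) \<le> 57000 * counters k l) \<and>
     (\<forall>t\<in>{1..m}. time (rs ! t) \<le> 4000000 * counters k l)"

lemma run_table:
  assumes k: "0 < k" and n: "n \<le> counters k l" and ps: "length ps = m" "set ps \<subseteq> {1..n}"
    and wd: "0 < w" "n \<le> 2 ^ w" "m \<le> 2 ^ w"
  shows "\<exists>rs. run (F2_alg k l) w n ps = return_spmf rs \<and> run_bounds k l m rs \<and>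
    (\<forall>t\<le>m. estimate (rs ! t) = real (F2 n ps t))"
proof -
  obtain e where e: "counters k l < 2 ^ e" "2 ^ e \<le> 2 * counters k l" using counters_bits[OF k] .
  define W :: int where "W = 2 ^ w"
  define V :: int where "V = 2 ^ (2 * w + e + 8)"
  define L where "L = cell_count k l"
  \<comment> \<open>\<open>V\<close> with its sign takes \<open>2 * w + e + 10\<close> bits. For
    \<open>w = 1\<close> these are exactly \<open>e + 12\<close> words, and longer words need no
    more.\<close>
  define \<kappa> where "\<kappa> = e + 12"
  define P where "P = 32 * \<kappa> + L * 3"
  have W2: "2 \<le> W" using wd(1) power_increasing[of 1 w "2::int"] by (simp add: W_def)
  have kap: "words w V \<le> \<kappa>"
  proof (rule words_le[where b = "2 * w + e + 9"])
    show "Suc (2 * w + e + 9) \<le> \<kappa> * w" using wd(1) by (cases w) (auto simp: \<kappa>_def algebra_simps)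
  qed (use wd(1) in \<open>auto simp: V_def\<close>)
  have V: "V = W\<^sup>2 * 2 ^ e * 256" by (simp add: V_def W_def power_add power_mult[symmetric] mult.commute)
  have e1: "(1::int) \<le> 2 ^ e" by simp
  have Ke: "int (counters k l) < 2 ^ e" using e(1) by (metis of_nat_less_iff of_nat_numeral of_nat_power)
  have W4: "4 \<le> W\<^sup>2" using power_mono[OF W2, of 2] by simp
  have We: "W\<^sup>2 \<le> W\<^sup>2 * 2 ^ e" "2 ^ e \<le> W\<^sup>2 * 2 ^ e" "4 \<le> W\<^sup>2 * 2 ^ e"
    using mult_left_mono[OF e1, of "W\<^sup>2"] mult_right_mono[OF W4, of "2 ^ e"] W4 e1 by auto
  have WV: "W\<^sup>2 + int (counters k l) + 128 \<le> V" unfolding V using We Ke by linarith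
  have WW: "W \<le> W\<^sup>2" using W2 by (simp add: power2_eq_square)
  have V0: "0 \<le> V" by (simp add: V_def)
  interpret table w k l W V P \<kappa>
  proof
    show "0 < w" by fact
    show "32 \<le> cell_count k l" by (simp add: cell_count_def)
    have "W \<le> V" using WW We unfolding V by linarith
    then show "\<bar>table_bd W V a\<bar> \<le> V" for a using V0 W2 by (simp add: table_bd_def)
    have "(\<Sum>a<L. words w (table_bd W V a)) \<le> (\<Sum>a<L. (if a < 32 then \<kappa> else 0) + 3)"
    proof (rule sum_mono)
      fix a
      have "words w W \<le> 3" using wd(1) by (intro words_le[where b = "w + 1"]) (auto simp: W_def)
      then show "words w (table_bd W V a) \<le> (if a < 32 then \<kappa> else 0) + 3" using kap by (simp add: table_bd_def)
    qed
    also have "\<dots> = card {a. a < L \<and> a < 32} * \<kappa> + L * 3"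
      by (simp add: sum.distrib sum.If_cases Int_def)
    also have "\<dots> \<le> P"
    proof -
      have "card {a. a < L \<and> a < 32} \<le> card {..<32::nat}" by (intro card_mono) auto
      then show ?thesis by (simp add: P_def)
    qed
    finally show "(\<Sum>a<cell_count k l. words w (table_bd W V a)) \<le> P" by (simp add: L_def)
  qed (use kap W2 WV in auto)
  have K: "1 \<le> counters k l" using k by (simp add: counters_def groups_def)
  have ek: "(e + 12)\<^sup>2 \<le> 288 * counters k l" using square_le_power2[of e] e(2) by linarith
  have el: "e + 12 \<le> (e + 12)\<^sup>2" by (simp add: power2_eq_square)
  have PK: "P + 43200 * counters k l \<le> 57000 * counters k l"
  proof -
    have "32 * (e + 12) \<le> 32 * (288 * counters k l)" by (intro mult_le_mono2 order_trans[OF el ek])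
    moreover have "cell_count k l * 3 \<le> 36 * counters k l * 3" by (intro mult_le_mono1 cell_count_le k)
    ultimately show ?thesis unfolding P_def \<kappa>_def L_def by simp
  qed
  have tickK: "8 * tick \<le> 4000000 * counters k l"
  proof -
    have "tick = 19 + 2 * (e + 12) + (e + 12)\<^sup>2" unfolding tick_def unfolding \<kappa>_def by (simp add: power2_eq_square)
    also have "\<dots> \<le> 19 * counters k l + 2 * (288 * counters k l) + 288 * counters k l"
      using ek order_trans[OF el ek] K by (intro add_mono mult_le_mono2) auto
    finally have "8 * tick \<le> 8 * (19 * counters k l + 2 * (288 * counters k l) + 288 * counters k l)"
      by (rule mult_le_mono2)
    then show ?thesis by simp
  qed
  have tw: "text_words (F2_alg k l) \<le> 43200 * counters k l"
    using text_words_bound[OF k wd(1)] by (simp add: text_words_def F2_alg_def)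
  define \<sigma>0 :: store where "\<sigma>0 = (\<lambda>_. 0)(0 := int n)"
  define \<sigma>1 :: store where "\<sigma>1 = (\<lambda>_. 0)(0 := int n, 6 := 1, 2 := 1, 7 := int (counters k l), 3 := int n - int (counters k l))"
  have nW: "int n \<le> W" "int m \<le> W" using wd(2,3) by (simp_all add: W_def)
  have good0: "good \<sigma>0"
    using nW table_bounds W2 unfolding good_def \<sigma>0_def by (auto simp: table_bd_def)
  from table_init_ok[OF n nW(1)] good0 have init: "good \<sigma>1" "gives (exec w (init_com k l)) 5 \<sigma>0 \<sigma>1"
    unfolding ok_def \<sigma>0_def \<sigma>1_def by blast+
  let ?s0 = "start w (conc (cell_count k l) \<sigma>0)"
  have "memo ?s0 = conc (cell_count k l) \<sigma>0" "peak ?s0 \<le> P" using mem_words_conc[OF good0] by (auto simp: start_def)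
  with init(2) obtain s where s: "exec w (init_com k l) ?s0 = return_spmf s" "memo s = conc (cell_count k l) \<sigma>1" "peak s \<le> P"
    unfolding gives_def by blast
  define Inv where "Inv t \<sigma> \<longleftrightarrow> \<sigma> 1 = int (F2 n ps t) \<and> \<sigma> 2 = 1 \<and> \<not> 0 < \<sigma> 3 \<and> \<sigma> 6 = 1 \<and>
    (\<forall>j\<in>{1..n}. \<sigma> (31 + j) = int (freq ps t j))" for t \<sigma>
  have inv1: "Inv 0 \<sigma>1" unfolding Inv_def \<sigma>1_def using n by auto
  have "\<exists>rs. process (F2_alg k l) w (drop 0 ps) (conc (cell_count k l) \<sigma>1) = return_spmf rs \<and> length rs = length ps - 0 \<and>
    (\<forall>i<length rs. (\<exists>\<sigma>'. Inv (Suc (0 + i)) \<sigma>' \<and> estimate (rs ! i) = of_int (\<sigma>' 1) / of_int (\<sigma>' 2)) \<and>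
      time (rs ! i) \<le> 8 * tick \<and> storage (rs ! i) \<le> P + text_words (F2_alg k l))"
  proof (rule process_ok[where Inv = Inv and T = 8])
    fix t \<sigma> assume t: "t < length ps" and inv: "Inv t \<sigma>"
    define p where "p = ps ! t"
    have p: "p \<in> {1..n}" using t ps nth_mem unfolding p_def by blast
    define f where "f = freq ps t p"
    have F: "F2 n ps (Suc t) = F2 n ps t + 2 * f + 1" using p F2_Suc[of ps t n] by (simp add: p_def f_def)
    have tW: "int (Suc t) \<le> W" using t ps(1) nW(2) by linarith
    have fW: "int (Suc f) \<le> W" using freq_le[of ps t p] tW by (simp add: f_def)
    have FW: "int (F2 n ps t + 2 * f + 1) \<le> W\<^sup>2"
    proof -
      have "F2 n ps (Suc t) \<le> (Suc t)\<^sup>2" using t ps by (intro F2_le) auto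
      then have "int (F2 n ps (Suc t)) \<le> (int (Suc t))\<^sup>2" by (metis of_nat_le_iff of_nat_power)
      also have "\<dots> \<le> W\<^sup>2" using tW by (intro power_mono) auto
      finally show ?thesis unfolding F .
    qed
    have "ok (update_com k l) 8 (\<sigma>(0 := int p)) (\<lambda>\<sigma>'. \<exists>u v y. \<sigma>' = (\<sigma>(0 := int p))(7 := u, 8 := v, 9 := y,
      1 := int (F2 n ps t + 2 * f + 1), 31 + p := int (Suc f)))"
      using p n inv fW FW by (intro table_ok) (auto simp: Inv_def f_def)
    then have "ok (update_com k l) 8 (\<sigma>(0 := int p)) (Inv (Suc t))"
    proof (rule ok_weaken)
      fix \<sigma>' assume "\<exists>u v y. \<sigma>' = (\<sigma>(0 := int p))(7 := u, 8 := v, 9 := y, 1 := int (F2 n ps t + 2 * f + 1), 31 + p := int (Suc f))"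
      then obtain u v y where \<sigma>': "\<sigma>' = (\<sigma>(0 := int p))(7 := u, 8 := v, 9 := y, 1 := int (F2 n ps (Suc t)), 31 + p := int (Suc f))"
        unfolding F by blast
      show "Inv (Suc t) \<sigma>'"
        using inv p unfolding Inv_def \<sigma>' by (auto simp: freq_Suc p_def[symmetric] f_def)
    qed simp
    then show "ok (update_prog (F2_alg k l)) 8 (\<sigma>(0 := int (ps ! t))) (Inv (Suc t))"
      by (simp add: F2_alg_def p_def)
  next
    fix t assume t: "t < length ps"
    then have "ps ! t \<in> {1..n}" using ps nth_mem by blast
    then show "int (ps ! t) \<le> table_bd W V 0" using nW(1) table_bounds by (simp add: table_bd_def)
  qed (use init(1) inv1 in auto)
  then obtain rs where rs: "process (F2_alg k l) w ps (conc (cell_count k l) \<sigma>1) = return_spmf rs" "length rs = m"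
    "\<And>i. i < m \<Longrightarrow> (\<exists>\<sigma>'. Inv (Suc i) \<sigma>' \<and> estimate (rs ! i) = of_int (\<sigma>' 1) / of_int (\<sigma>' 2)) \<and>
      time (rs ! i) \<le> 8 * tick \<and> storage (rs ! i) \<le> P + text_words (F2_alg k l)" using ps(1) by auto
  define r0 where "r0 = report_of (F2_alg k l) w s"
  have "run (F2_alg k l) w n ps = return_spmf (r0 # rs)"
    using s rs(1) unfolding run_def start_memory \<sigma>0_def by (simp add: F2_alg_def r0_def)
  moreover have "run_bounds k l m (r0 # rs)"
  proof -
    have PT: "P + text_words (F2_alg k l) \<le> 57000 * counters k l" using PK tw by simp
    have "storage r0 \<le> P + text_words (F2_alg k l)"
      using s(3) by (simp add: r0_def report_of_def text_words_def)
    then have "storage r0 \<le> 57000 * counters k l" using PT by (rule order_trans)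
    moreover have "storage (rs ! i) \<le> 57000 * counters k l" "time (rs ! i) \<le> 4000000 * counters k l" if "i < m" for i
      using rs(3)[OF that] PT tickK by (blast intro: order_trans)+
    ultimately show ?thesis unfolding run_bounds_def using rs(2) by (auto simp: nth_Cons split: nat.split)
  qed
  moreover have "estimate ((r0 # rs) ! t) = real (F2 n ps t)" if "t \<le> m" for t
  proof (cases t)
    case 0
    then show ?thesis using s(2) L by (simp add: r0_def report_of_def \<sigma>1_def)
  next
    case (Suc i)
    with rs(3)[of i] that show ?thesis by (auto simp: Inv_def)
  qed
  ultimately show ?thesis by blast
qed


text \<open>The seeds of all counters are the digits of the single random number \<open>X\<close>.\<close>

definition counter_value :: "nat \<Rightarrow> nat list \<Rightarrow> int \<Rightarrow> nat \<Rightarrow> nat \<Rightarrow> int" where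
  "counter_value b ps X t j = (\<Sum>i<t. hash_sign (2 ^ b) (dig ((2 * 2 ^ b) ^ 4) j X) (int (ps ! i)))"

lemma abs_hash_sign: "\<bar>hash_sign h s x\<bar> = 1"
  by (simp add: hash_sign_def)

lemma counter_value_le: "\<bar>counter_value b ps X t j\<bar> \<le> int t"
proof -
  have "\<bar>counter_value b ps X t j\<bar> \<le> (\<Sum>i<t. \<bar>hash_sign (2 ^ b) (dig ((2 * 2 ^ b) ^ 4) j X) (int (ps ! i))\<bar>)"
    unfolding counter_value_def by (rule sum_abs)
  also have "\<dots> = int t" by (simp add: abs_hash_sign)
  finally show ?thesis .
qed

text \<open>Here \<open>counters k l < n <= 2 ^ w\<close>, so addresses fit into a constant number
  of words and every operation of an update takes constant time. All randomness is in
  \<open>X\<close>, so the distribution of the reports is the image of the uniform one.\<close>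

lemma run_sketch:
  assumes k0: "0 < k" and nK: "counters k l < n" and ps: "length ps = m" "set ps \<subseteq> {1..n}"
    and wd: "0 < w" "n \<le> 2 ^ w" "m \<le> 2 ^ w"
  shows "\<exists>b f. int n ^ 3 \<le> 2 ^ b \<and> run (F2_alg k l) w n ps = map_spmf f (spmf_of_set {0..<((2 * 2 ^ b) ^ 4) ^ counters k l}) \<and>
    (\<forall>X\<in>{0..<((2 * 2 ^ b) ^ 4) ^ counters k l}. run_bounds k l m (f X) \<and> estimate (f X ! 0) = 0 \<and>
      (\<forall>t\<in>{1..m}. \<exists>z. estimate (f X ! t) = of_int z / k \<and>
        is_center l (group_sum k (counter_value b ps X t)) z))"
proof -
  define W :: int where "W = 2 ^ w"
  define L where "L = cell_count k l"
  define b where "b = (LEAST b. int n ^ 3 \<le> 2 ^ b)"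
  define Pi where "Pi = 32 * (20 * counters k l + 34) + L * 34"
  define P where "P = L * 34"
  have nW: "int n \<le> W" "int m \<le> W" using wd(2,3) by (simp_all add: W_def)
  have W2: "2 \<le> W" using wd(1) power_increasing[of 1 w "2::int"] by (simp add: W_def)
  have KW: "int (counters k l) \<le> W" using nK nW(1) by linarith
  have ex: "\<exists>b. int n ^ 3 \<le> 2 ^ b"
  proof
    have "int n ^ 3 < 2 ^ (n ^ 3)" using less_exp[of "n ^ 3"] by (metis of_nat_less_iff of_nat_numeral of_nat_power)
    then show "int n ^ 3 \<le> 2 ^ (n ^ 3)" by simp
  qed
  have b: "int n ^ 3 \<le> 2 ^ b" "\<And>i. i < b \<Longrightarrow> 2 ^ i < int n ^ 3"
    using LeastI_ex[OF ex] not_less_Least[of _ "\<lambda>b. int n ^ 3 \<le> 2 ^ b"] by (auto simp: b_def not_le)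
  \<comment> \<open>By minimality of \<open>b\<close>, \<open>2 ^ b\<close> is less than twice the
    cube of \<open>n\<close>; the two factors 2 are absorbed by \<open>W * W\<close>.\<close>
  have hW: "2 * 2 ^ b \<le> W ^ 5"
  proof (cases b)
    case 0
    then show ?thesis using W2 power_increasing[of 1 5 W] by simp
  next
    case (Suc i)
    then have "(2::int) ^ b < 2 * int n ^ 3" using b(2)[of i] by simp
    then have "2 * (2::int) ^ b \<le> 2 * 2 * int n ^ 3" by simp
    also have "\<dots> \<le> W * W * W ^ 3" using W2 nW(1) by (intro mult_mono power_mono) auto
    finally show ?thesis by (simp add: eval_nat_numeral)
  qed
  define B :: int where "B = (2 * 2 ^ b) ^ 4"
  have B0: "0 < B" by (simp add: B_def)
  have kap: "words w (W ^ 32) \<le> 34"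
  proof (rule words_le[where b = "32 * w + 1"])
    show "Suc (32 * w + 1) \<le> 34 * w" using wd(1) by simp
  qed (use wd(1) in \<open>auto simp: W_def power_mult[symmetric] mult.commute\<close>)
  have bd_le: "\<bar>sketch_bd k l W a\<bar> \<le> W ^ 32" for a
    using W2 by (auto simp: sketch_bd_def intro!: power_increasing)
  have bd_words: "words w (sketch_bd k l W a) \<le> 34" for a
    using words_mono[of "sketch_bd k l W a" "W ^ 32" w] bd_le[of a] W2 kap by simp
  have kapi: "words w (W ^ (20 * counters k l + 32)) \<le> 20 * counters k l + 34"
  proof (rule words_le[where b = "(20 * counters k l + 32) * w + 1"])
    show "Suc ((20 * counters k l + 32) * w + 1) \<le> (20 * counters k l + 34) * w" using wd(1) by (simp add: algebra_simps)
  qed (use wd(1) in \<open>auto simp: W_def power_mult[symmetric] mult.commute\<close>)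
  \<comment> \<open>Two instances of the logic for the same memory: \<open>S\<close> with small
    bounds for the updates, and \<open>I\<close> with room for \<open>B ^ K\<close> in the registers
    for the initialisation.\<close>
  interpret S: sketch w k l W P 34 "2 ^ b"
  proof
    show "(\<Sum>a<cell_count k l. words w (sketch_bd k l W a)) \<le> P"
      using sum_bounded_above[of "{..<cell_count k l}" "\<lambda>a. words w (sketch_bd k l W a)" 34] bd_words
      by (simp add: P_def L_def)
  qed (use wd(1) kap W2 k0 KW hW bd_le in \<open>auto simp: cell_count_def\<close>)
  interpret I: sketch_init w k l W Pi "20 * counters k l + 34" n b
  proof
    show "\<bar>init_bd k l W a\<bar> \<le> W ^ (20 * counters k l + 32)" for a
    proof -
      have "W ^ 32 \<le> W ^ (20 * counters k l + 32)" using W2 by (intro power_increasing) auto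
      from order_trans[OF bd_le this] show ?thesis using W2 by (simp add: init_bd_def)
    qed
    have "(\<Sum>a<L. words w (init_bd k l W a)) \<le> (\<Sum>a<L. (if a < 32 then 20 * counters k l + 34 else 0) + 34)"
      using kapi bd_words by (intro sum_mono) (simp add: init_bd_def)
    also have "\<dots> = card {a. a < L \<and> a < 32} * (20 * counters k l + 34) + L * 34"
      by (simp add: sum.distrib sum.If_cases Int_def)
    also have "\<dots> \<le> Pi"
    proof -
      have "card {a. a < L \<and> a < 32} \<le> card {..<32::nat}" by (intro card_mono) auto
      then have "card {a. a < L \<and> a < 32} \<le> 32" by simp
      then show ?thesis unfolding Pi_def by (intro add_right_mono mult_le_mono1)
    qed
    finally show "(\<Sum>a<cell_count k l. words w (init_bd k l W a)) \<le> Pi" by (simp add: L_def)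
  qed (use wd(1) kapi W2 k0 KW nW(1) b hW nK in \<open>auto simp: cell_count_def\<close>)
  have IB: "I.B = B" by (simp add: I.B_def B_def)
  have K: "1 \<le> counters k l" using k0 by (simp add: counters_def groups_def)
  have tw: "com_words w (init_com k l) + com_words w (update_com k l) \<le> 43200 * counters k l"
    by (rule text_words_bound[OF k0 wd(1)])
  have LK: "L \<le> 36 * counters k l" unfolding L_def by (rule cell_count_le[OF k0])
  have PiK: "Pi + 43200 * counters k l \<le> 57000 * counters k l"
  proof -
    have "Pi \<le> 32 * (20 * counters k l + 34 * counters k l) + 36 * counters k l * 34"
      unfolding Pi_def using K LK by (intro add_mono mult_le_mono mult_le_mono2) auto
    then show ?thesis by simp
  qed
  have PPi: "P \<le> Pi" by (simp add: P_def Pi_def)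
  \<comment> \<open>1243 = 19 + 2 * 34 + 34 * 34, and 2874 * 1243 is below 4000000.\<close>
  have "S.tick = 1243" unfolding S.tick_def by simp
  then have timeK: "2874 * counters k l * S.tick \<le> 4000000 * counters k l" by simp
  obtain fin where fin: "exec w (init_com k l) (start w (conc (cell_count k l) ((\<lambda>_. 0)(0 := int n)))) =
      map_spmf fin (spmf_of_set {0..<B ^ counters k l})"
    "\<And>X. X \<in> {0..<B ^ counters k l} \<Longrightarrow> \<exists>\<sigma>. memo (fin X) = conc (cell_count k l) \<sigma> \<and> peak (fin X) \<le> Pi \<and> I.init_state X \<sigma>"
    using I.init_ok unfolding IB by blast
  define Inv where "Inv X t \<sigma> \<longleftrightarrow> \<sigma> 2 = int k \<and> 0 < \<sigma> 3 \<and> \<sigma> 4 = 2 * 2 ^ b \<and> \<sigma> 5 = 2 ^ b \<and> \<sigma> 6 = 1 \<and>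
    (\<forall>j<counters k l. \<sigma> (32 + j) = dig B j X) \<and>
    (\<forall>j<counters k l. \<sigma> (32 + counters k l + j) = counter_value b ps X t j) \<and>
    (0 < t \<longrightarrow> is_center l (group_sum k (counter_value b ps X t)) (\<sigma> 1))" for X t \<sigma>
  have step: "S.ok (update_prog (F2_alg k l)) (2874 * counters k l) (\<sigma>(0 := int (ps ! t))) (Inv X (Suc t))"
    if t: "t < length ps" and inv: "Inv X t \<sigma>" for X t \<sigma>
  proof -
    have p: "ps ! t \<in> {1..n}" using t ps nth_mem by blast
    have "S.step_ok (\<sigma>(0 := int (ps ! t))) (counter_value b ps X t) (counter_value b ps X (Suc t))"
      unfolding S.step_ok_def
    proof (intro conjI allI impI)
      fix g assume g: "g < counters k l"
      have s: "(\<sigma>(0 := int (ps ! t))) (32 + g) = dig B g X" using inv g by (simp add: Inv_def)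
      show "0 \<le> (\<sigma>(0 := int (ps ! t))) (32 + g)" "(\<sigma>(0 := int (ps ! t))) (32 + g) < (2 * 2 ^ b) ^ 4"
        using dig_range[OF B0, of g X] unfolding s by (auto simp: B_def)
      show "counter_value b ps X (Suc t) g = counter_value b ps X t g +
          hash_sign (2 ^ b) ((\<sigma>(0 := int (ps ! t))) (32 + g)) ((\<sigma>(0 := int (ps ! t))) 0)"
        unfolding s by (simp add: counter_value_def B_def)
      show "\<bar>counter_value b ps X (Suc t) g\<bar> \<le> W"
        using counter_value_le[of b ps X "Suc t" g] t ps(1) nW(2) by linarith
    qed (use inv p nW(1) in \<open>auto simp: Inv_def\<close>)
    then have "S.ok (update_com k l) (2874 * counters k l) (\<sigma>(0 := int (ps ! t))) (Inv X (Suc t))"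
    proof (rule S.ok_weaken[OF S.update_ok])
      fix \<sigma>'
      assume new: "(\<forall>a\<in>{2, 3, 4, 5, 6} \<union> {32..<32 + counters k l}. \<sigma>' a = (\<sigma>(0 := int (ps ! t))) a) \<and>
        (\<forall>i<counters k l. \<sigma>' (32 + counters k l + i) = counter_value b ps X (Suc t) i) \<and>
        is_center l (group_sum k (counter_value b ps X (Suc t))) (\<sigma>' 1)"
      then have "\<sigma>' (32 + j) = \<sigma> (32 + j)" if "j < counters k l" for j using that by simp
      with new inv show "Inv X (Suc t) \<sigma>'" by (simp add: Inv_def)
    qed (use inv in \<open>auto simp: Inv_def\<close>)
    then show ?thesis by (simp add: F2_alg_def)
  qed
  define F where "F = F2_alg k l"
  have "\<exists>rs. process F w ps (memo (fin X)) = return_spmf rs \<and> run_bounds k l m (report_of F w (fin X) # rs) \<and>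
    estimate (report_of F w (fin X)) = 0 \<and>
    (\<forall>i<m. \<exists>z. estimate (rs ! i) = of_int z / k \<and> is_center l (group_sum k (counter_value b ps X (Suc i))) z)"
    if X: "X \<in> {0..<B ^ counters k l}" for X
  proof -
    obtain \<sigma> where \<sigma>: "memo (fin X) = conc (cell_count k l) \<sigma>" "peak (fin X) \<le> Pi" "I.init_state X \<sigma>"
      using fin(2)[OF X] by blast
    have good: "S.good \<sigma>" using \<sigma>(3) by (simp add: I.init_state_def S.good_def)
    have inv: "Inv X 0 \<sigma>" using \<sigma>(3) by (auto simp: I.init_state_def Inv_def IB counter_value_def)
    have "\<exists>rs. process (F2_alg k l) w (drop 0 ps) (conc (cell_count k l) \<sigma>) = return_spmf rs \<and> length rs = length ps - 0 \<and>
      (\<forall>i<length rs. (\<exists>\<sigma>'. Inv X (Suc (0 + i)) \<sigma>' \<and> estimate (rs ! i) = of_int (\<sigma>' 1) / of_int (\<sigma>' 2)) \<and>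
        time (rs ! i) \<le> 2874 * counters k l * S.tick \<and> storage (rs ! i) \<le> P + S.text_words (F2_alg k l))"
    proof (rule S.process_ok[where Inv = "Inv X" and T = "2874 * counters k l"])
      fix t assume "t < length ps"
      then have "ps ! t \<in> {1..n}" using ps nth_mem by blast
      then show "int (ps ! t) \<le> sketch_bd k l W 0"
        using nW(1) W2 power_increasing[of 1 32 W] by (simp add: sketch_bd_def)
    qed (use step good inv in auto)
    then obtain rs where rs: "process F w ps (memo (fin X)) = return_spmf rs" "length rs = m"
      "\<And>i. i < m \<Longrightarrow> (\<exists>\<sigma>'. Inv X (Suc i) \<sigma>' \<and> estimate (rs ! i) = of_int (\<sigma>' 1) / of_int (\<sigma>' 2)) \<and>
        time (rs ! i) \<le> 2874 * counters k l * S.tick \<and> storage (rs ! i) \<le> P + S.text_words (F2_alg k l)"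
      using ps(1) \<sigma>(1) by (auto simp: F_def)
    have tw': "S.text_words (F2_alg k l) \<le> 43200 * counters k l"
      using tw by (simp add: S.text_words_def F2_alg_def)
    have r0: "storage (report_of F w (fin X)) \<le> 57000 * counters k l"
      using \<sigma>(2) tw PiK by (simp add: report_of_def F_def F2_alg_def)
    have st: "storage (rs ! i) \<le> 57000 * counters k l" "time (rs ! i) \<le> 4000000 * counters k l" if "i < m" for i
    proof -
      have "storage (rs ! i) \<le> P + S.text_words (F2_alg k l)" using rs(3)[OF that] by blast
      also have "\<dots> \<le> Pi + 43200 * counters k l" by (intro add_mono PPi tw')
      also note PiK
      finally show "storage (rs ! i) \<le> 57000 * counters k l" .
      show "time (rs ! i) \<le> 4000000 * counters k l" using rs(3)[OF that] timeK by (blast intro: order_trans)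
    qed
    have "run_bounds k l m (report_of F w (fin X) # rs)"
      unfolding run_bounds_def using rs(2) r0 st by (auto simp: nth_Cons split: nat.split)
    moreover have "estimate (report_of F w (fin X)) = 0"
      using \<sigma> by (simp add: report_of_def I.init_state_def cell_count_def)
    moreover have "\<exists>z. estimate (rs ! i) = of_int z / k \<and> is_center l (group_sum k (counter_value b ps X (Suc i))) z"
      if "i < m" for i
      using rs(3)[OF that] by (auto simp: Inv_def)
    ultimately show ?thesis using rs(1) by blast
  qed
  then obtain g where g: "\<And>X. X \<in> {0..<B ^ counters k l} \<Longrightarrow> process F w ps (memo (fin X)) = return_spmf (g X) \<and>
    run_bounds k l m (report_of F w (fin X) # g X) \<and> estimate (report_of F w (fin X)) = 0 \<and>
    (\<forall>i<m. \<exists>z. estimate (g X ! i) = of_int z / k \<and> is_center l (group_sum k (counter_value b ps X (Suc i))) z)"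
    by metis
  define f where "f X = report_of F w (fin X) # g X" for X
  have "run F w n ps = spmf_of_set {0..<B ^ counters k l} \<bind>
      (\<lambda>X. map_spmf ((#) (report_of F w (fin X))) (process F w ps (memo (fin X))))"
    using fin(1) unfolding run_def start_memory by (simp add: F_def F2_alg_def bind_map_spmf comp_def)
  also have "\<dots> = spmf_of_set {0..<B ^ counters k l} \<bind> (\<lambda>X. return_spmf (f X))"
    by (rule bind_spmf_cong) (use g in \<open>auto simp: f_def\<close>)
  finally have "run F w n ps = map_spmf f (spmf_of_set {0..<B ^ counters k l})"
    by (simp add: map_spmf_conv_bind_spmf)
  moreover have "run_bounds k l m (f X)" "estimate (f X ! 0) = 0" if "X \<in> {0..<B ^ counters k l}" for X
    using g[OF that] by (auto simp: f_def)
  moreover have "\<exists>z. estimate (f X ! t) = of_int z / k \<and> is_center l (group_sum k (counter_value b ps X t)) z"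
    if "X \<in> {0..<B ^ counters k l}" "t \<in> {1..m}" for X t
    using g[OF that(1)] that(2) by (cases t) (auto simp: f_def)
  ultimately show ?thesis using b(1) unfolding F_def B_def by blast
qed

section \<open>Accuracy and choice of parameters\<close>

lemma map_spmf_of_set_facts:
  assumes "finite A" "A \<noteq> {}" "p = map_spmf f (spmf_of_set A)"
  shows "lossless_spmf p" "set_spmf p = f ` A"
    "measure (measure_spmf p) E = real (card {x \<in> A. f x \<in> E}) / real (card A)"
proof -
  have "A \<inter> f -` E = {x \<in> A. f x \<in> E}" by auto
  then show "measure (measure_spmf p) E = real (card {x \<in> A. f x \<in> E}) / real (card A)"
    by (simp add: assms(3) measure_map_spmf measure_spmf_of_set)
qed (use assms in simp_all)

text \<open>The values above \<open>x + d\<close> and the values below \<open>x - d\<close> each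
  form a half-line after scaling by \<open>c\<close>. Each contains at most a quarter of the
  entries, so a center lies in neither.\<close>

lemma is_center_close:
  fixes lo hi c :: real
  assumes z: "is_center l v z" and c: "0 < c"
    and few: "4 * card {r. r < groups l \<and> \<bar>of_int (v r) / c - x\<bar> > d} \<le> groups l"
  shows "\<bar>of_int z / c - x\<bar> \<le> d"
proof -
  have far: "4 * card {r. r < groups l \<and> S (v r)} \<le> groups l"
    if "\<And>y. S y \<Longrightarrow> \<bar>of_int y / c - x\<bar> > d" for S
  proof -
    have "card {r. r < groups l \<and> S (v r)} \<le> card {r. r < groups l \<and> \<bar>of_int (v r) / c - x\<bar> > d}"
      using that by (intro card_mono) auto
    then show ?thesis using few by linarith
  qed
  have mono: "of_int y / c \<le> of_int y' / c" if "y \<le> y'" for y y' :: int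
    using that c by (intro divide_right_mono) auto
  have "up_closed (\<lambda>y. of_int y / c - x > d)"
    unfolding up_closed_def using mono by force
  then have "\<not> of_int z / c - x > d"
    using z far[of "\<lambda>y. of_int y / c - x > d"] unfolding is_center_def by fastforce
  moreover have "down_closed (\<lambda>y. x - of_int y / c > d)"
    unfolding down_closed_def using mono by force
  then have "\<not> x - of_int z / c > d"
    using z far[of "\<lambda>y. x - of_int y / c > d"] unfolding is_center_def by fastforce
  ultimately show ?thesis by linarith
qed

text \<open>Outside the exceptional set of \<open>tracking\<close> at most a quarter of the groups
  is off at any time, so the selected value is accurate at all times.\<close>

lemma sketch_accurate:
  fixes \<epsilon> \<delta> :: real
  assumes b: "int n ^ 3 \<le> 2 ^ b" and ps: "length ps = m" "set ps \<subseteq> {1..n}"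
    and \<epsilon>: "0 < \<epsilon>" "\<epsilon> < 1" and \<delta>: "0 < \<delta>" and k: "k > 0" "16384 / \<epsilon>\<^sup>2 \<le> k"
    and R: "37 * 2 ^ 22 / (\<epsilon>\<^sup>2 * \<delta>) \<le> 2 ^ groups l"
    and e0: "\<And>X. X \<in> {0..<((2 * 2 ^ b) ^ 4) ^ counters k l} \<Longrightarrow> est X 0 = 0"
    and e: "\<And>X t. X \<in> {0..<((2 * 2 ^ b) ^ 4) ^ counters k l} \<Longrightarrow> t \<in> {1..m} \<Longrightarrow>
      \<exists>z. est X t = of_int z / k \<and> is_center l (group_sum k (counter_value b ps X t)) z"
  shows "(1 - \<delta>) * ((2 * 2 ^ b) ^ 4) ^ counters k l \<le> real (card {X \<in> {0..<((2 * 2 ^ b) ^ 4) ^ counters k l}.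
    \<forall>t\<in>{0..m}. \<bar>est X t - real (F2 n ps t)\<bar> \<le> \<epsilon> * real (F2 n ps m)})"
proof -
  define B :: int where "B = (2 * 2 ^ b) ^ 4"
  define A where "A = {0..<B ^ counters k l}"
  interpret four_wise B n "\<lambda>s x. of_int (hash_sign (2 ^ b) s (int x))"
    using four_wise_hash_sign[OF refl b] by (simp add: B_def)
  interpret stream_hash B n "\<lambda>s x. of_int (hash_sign (2 ^ b) s (int x))" ps m
    by unfold_locales (use ps in auto)
  define W where "W = {X \<in> A. \<exists>t\<le>m. groups l < 4 * card {r. r < groups l \<and>
    \<bar>grp k (dig (B ^ k) r X) t - \<tau> t\<bar> > \<epsilon> * \<tau> m}}"
  have W: "real (card W) \<le> \<delta> * B ^ counters k l"
    using tracking[OF \<epsilon> \<delta> k R] unfolding W_def A_def counters_def by (simp add: power_mult)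
  have grp: "grp k (dig (B ^ k) r X) t = of_int (group_sum k (counter_value b ps X t) r) / k" for r X t
  proof -
    have "cnt (dig B j (dig (B ^ k) r X)) t = of_int (counter_value b ps X t (r * k + j))" if "j < k" for j
      using that dig_dig[OF B, of j k r X] by (simp add: cnt_def counter_value_def B_def)
    then show ?thesis by (simp add: grp_def group_sum_def)
  qed
  define Gd where "Gd = {X \<in> A. \<forall>t\<in>{0..m}. \<bar>est X t - real (F2 n ps t)\<bar> \<le> \<epsilon> * real (F2 n ps m)}"
  have "A - W \<subseteq> Gd"
  proof
    fix X assume X: "X \<in> A - W"
    have "\<bar>est X t - real (F2 n ps t)\<bar> \<le> \<epsilon> * real (F2 n ps m)" if t: "t \<le> m" for t
    \<comment> \<open>No selection has taken place at time 0; the initial answer 0 is the value of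
      \<open>F2\<close> there.\<close>
    proof (cases "t = 0")
      case True
      then show ?thesis using e0[of X] X \<epsilon> by (simp add: A_def B_def)
    next
      case False
      then obtain z where z: "est X t = of_int z / k" "is_center l (group_sum k (counter_value b ps X t)) z"
        using e[of X t] X t by (auto simp: A_def B_def)
      have "4 * card {r. r < groups l \<and> \<bar>grp k (dig (B ^ k) r X) t - \<tau> t\<bar> > \<epsilon> * \<tau> m} \<le> groups l"
        using X t by (force simp: W_def)
      then show ?thesis unfolding z(1) using k(1) by (intro is_center_close[OF z(2)]) (simp_all add: grp)
    qed
    then show "X \<in> Gd" using X by (auto simp: Gd_def)
  qed
  moreover have fin: "finite A" "W \<subseteq> A" "Gd \<subseteq> A" by (auto simp: A_def W_def Gd_def)
  ultimately have "card A - card W \<le> card Gd"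
    using card_mono[of Gd "A - W"] by (simp add: card_Diff_subset finite_subset)
  then have "real (card A) - real (card W) \<le> real (card Gd)" by linarith
  moreover have "real (card A) = B ^ counters k l" using B by (simp add: A_def)
  ultimately have "(1 - \<delta>) * B ^ counters k l \<le> real (card Gd)" using W by (simp add: algebra_simps)
  then show ?thesis by (simp add: Gd_def A_def B_def)
qed

text \<open>\<open>Q\<close> is the number of groups that the union bound asks for. Since
  \<open>37 * 2 ^ 22 <= 2 ^ 28\<close> and \<open>\<delta>\<^sup>2 <= \<delta>\<close>, it is at
  most 28 plus twice the logarithm in \<open>resource_bound\<close>. The values of
  \<open>groups\<close> grow by factors of 8 from 128, so the least suitable one is 128 or below
  \<open>8 * Q\<close>. Rounding \<open>k\<close> up turns 16384 into 16385.\<close>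

lemma parameters:
  fixes \<epsilon> \<delta> :: real
  assumes "0 < \<epsilon>" "\<epsilon> < 1" "0 < \<delta>" "\<delta> < 1"
  obtains k l where "0 < k" "16384 / \<epsilon>\<^sup>2 \<le> real k" "37 * 2 ^ 22 / (\<epsilon>\<^sup>2 * \<delta>) \<le> 2 ^ groups l"
    "real (counters k l) \<le> 16385 * 368 * resource_bound \<epsilon> \<delta>"
proof -
  define k where "k = nat \<lceil>16384 / \<epsilon>\<^sup>2\<rceil>"
  have e2: "0 < \<epsilon>\<^sup>2" "\<epsilon>\<^sup>2 \<le> 1" using assms by (auto intro: power_le_one)
  have k: "16384 / \<epsilon>\<^sup>2 \<le> real k" unfolding k_def by linarith
  have "0 < 16384 / \<epsilon>\<^sup>2" using e2 by simp
  then have k0: "0 < k" using k by linarith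
  have "real k \<le> 16384 / \<epsilon>\<^sup>2 + 1" using e2 unfolding k_def by (simp add: of_nat_ceiling)
  also have "\<dots> \<le> 16385 / \<epsilon>\<^sup>2"
  proof -
    have "1 \<le> 1 / \<epsilon>\<^sup>2" using e2 by (simp add: le_divide_eq)
    then show ?thesis by simp
  qed
  finally have ku: "real k \<le> 16385 / \<epsilon>\<^sup>2" .
  define \<Lambda> where "\<Lambda> = log 2 (1 / (\<delta> * \<epsilon>))"
  define Q where "Q = log 2 (37 * 2 ^ 22 / (\<epsilon>\<^sup>2 * \<delta>))"
  have pos: "0 < 37 * 2 ^ 22 / (\<epsilon>\<^sup>2 * \<delta>)" using e2 assms by simp
  have "37 * 2 ^ 22 / (\<epsilon>\<^sup>2 * \<delta>) \<le> 2 ^ 28 * (1 / (\<delta> * \<epsilon>))\<^sup>2"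
  proof -
    have "\<delta>\<^sup>2 \<le> \<delta>" using assms by (simp add: power2_eq_square mult_left_le)
    then have "\<epsilon>\<^sup>2 * \<delta>\<^sup>2 \<le> \<epsilon>\<^sup>2 * \<delta>" using e2 by (intro mult_left_mono) auto
    then have "37 * 2 ^ 22 / (\<epsilon>\<^sup>2 * \<delta>) \<le> 2 ^ 28 / (\<epsilon>\<^sup>2 * \<delta>\<^sup>2)"
      using assms by (intro frac_le) auto
    then show ?thesis by (simp add: power_divide power_mult_distrib mult.commute)
  qed
  then have "Q \<le> log 2 (2 ^ 28 * (1 / (\<delta> * \<epsilon>))\<^sup>2)" unfolding Q_def using pos by (intro log_mono) auto
  also have "\<dots> = log 2 (2 ^ 28) + log 2 ((1 / (\<delta> * \<epsilon>))\<^sup>2)" using assms by (subst log_mult) auto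
  also have "log 2 (2 ^ 28) = (28 :: real)" by (subst log_nat_power) auto
  also have "log 2 ((1 / (\<delta> * \<epsilon>))\<^sup>2) = 2 * \<Lambda>" using assms unfolding \<Lambda>_def by (subst log_nat_power) auto
  finally have Q: "Q \<le> 28 + 2 * \<Lambda>" .
  have ex: "\<exists>l. Q \<le> real (groups l)"
  proof -
    obtain x where x: "Q < real x" using reals_Archimedean2 by blast
    have "x < 7 + 3 * x + 1" by simp
    also have "7 + 3 * x < groups x" unfolding groups_def by (rule less_exp)
    finally have "x \<le> groups x" by simp
    with x show ?thesis by (intro exI[of _ x]) linarith
  qed
  define l where "l = (LEAST l. Q \<le> real (groups l))"
  have l: "Q \<le> real (groups l)" unfolding l_def by (rule LeastI_ex[OF ex])
  have R: "37 * 2 ^ 22 / (\<epsilon>\<^sup>2 * \<delta>) \<le> 2 ^ groups l"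
  proof -
    have "37 * 2 ^ 22 / (\<epsilon>\<^sup>2 * \<delta>) = 2 powr Q" unfolding Q_def using pos by simp
    also have "\<dots> \<le> 2 powr real (groups l)" using l by (intro powr_mono) auto
    finally show ?thesis by (simp add: powr_realpow)
  qed
  have Ru: "real (groups l) \<le> 368 * max 1 \<Lambda>"
  proof (cases l)
    case 0
    then show ?thesis by (simp add: groups_def)
  next
    case (Suc l')
    then have "\<not> Q \<le> real (groups l')" using not_less_Least[of l' "\<lambda>l. Q \<le> real (groups l)"] unfolding l_def[symmetric] by simp
    moreover have "groups l = 8 * groups l'" by (simp add: Suc groups_def power_add)
    ultimately have "real (groups l) \<le> 8 * (28 + 2 * \<Lambda>)" using Q by simp
    moreover have "1 \<le> max 1 \<Lambda>" "\<Lambda> \<le> max 1 \<Lambda>" by auto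
    ultimately show ?thesis by argo
  qed
  have "real (counters k l) = real k * real (groups l)" by (simp add: counters_def)
  also have "\<dots> \<le> (16385 / \<epsilon>\<^sup>2) * (368 * max 1 \<Lambda>)"
    using ku Ru e2 by (intro mult_mono) auto
  also have "\<dots> = 16385 * 368 * resource_bound \<epsilon> \<delta>" by (simp add: resource_bound_def \<Lambda>_def)
  finally show ?thesis using k0 k R by (intro that)
qed

lemma pow2_bound:
  assumes "0 < w" "real w \<ge> log 2 (real x)"
  shows "x \<le> 2 ^ w"
proof (cases "x = 0")
  case False
  then have "real x = 2 powr log 2 (real x)" by simp
  also have "\<dots> \<le> 2 powr real w" using assms by (intro powr_mono) auto
  also have "\<dots> = 2 ^ w" by (simp add: powr_realpow)
  finally show ?thesis by (simp flip: of_nat_le_iff)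
qed simp

theorem theorem12:
  shows "\<exists>C::real. C > 0 \<and>
    (\<forall>(\<epsilon>::real) (\<delta>::real). 0 < \<epsilon> \<and> \<epsilon> < 1 \<and> 0 < \<delta> \<and> \<delta> < 1 \<longrightarrow>
      (\<exists>A::stream_alg. \<forall>(n::nat) (m::nat) (ps::nat list) (w::nat).
        n \<ge> 1 \<and> length ps = m \<and> set ps \<subseteq> {1..n} \<and>
        w \<ge> 1 \<and> real w \<ge> log 2 (real (max n m)) \<longrightarrow>
          lossless_spmf (run A w n ps) \<and>
          measure (measure_spmf (run A w n ps))
            {rs. \<forall>t\<in>{0..m}. \<bar>estimate (rs ! t) - real (F2 n ps t)\<bar> \<le> \<epsilon> * real (F2 n ps m)}
              \<ge> 1 - \<delta> \<and>
          (\<forall>rs\<in>set_spmf (run A w n ps).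
            (\<forall>t\<in>{0..m}. real (storage (rs ! t)) \<le> C * resource_bound \<epsilon> \<delta>) \<and>
            (\<forall>t\<in>{1..m}. real (time (rs ! t)) \<le> C * resource_bound \<epsilon> \<delta>))))"
proof (intro exI[of _ "4000000 * (16385 * 368)"] conjI allI impI)
  fix \<epsilon> \<delta> :: real
  let ?C = "4000000 * (16385 * 368) :: real"
  assume \<epsilon>\<delta>: "0 < \<epsilon> \<and> \<epsilon> < 1 \<and> 0 < \<delta> \<and> \<delta> < 1"
  then obtain k l where k: "0 < k" "16384 / \<epsilon>\<^sup>2 \<le> real k" and R: "37 * 2 ^ 22 / (\<epsilon>\<^sup>2 * \<delta>) \<le> 2 ^ groups l"
    and K: "real (counters k l) \<le> 16385 * 368 * resource_bound \<epsilon> \<delta>"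
    using parameters[of \<epsilon> \<delta>] by blast
  have bounds: "(\<forall>t\<in>{0..m}. real (storage (rs ! t)) \<le> ?C * resource_bound \<epsilon> \<delta>) \<and>
    (\<forall>t\<in>{1..m}. real (time (rs ! t)) \<le> ?C * resource_bound \<epsilon> \<delta>)" if rs: "run_bounds k l m rs" for m rs
  proof -
    have "real x \<le> ?C * resource_bound \<epsilon> \<delta>" if "x \<le> 4000000 * counters k l" for x
    proof -
      have "real x \<le> 4000000 * real (counters k l)" using that by (simp flip: of_nat_le_iff)
      also have "\<dots> \<le> 4000000 * (16385 * 368 * resource_bound \<epsilon> \<delta>)" using K by (intro mult_left_mono) auto
      finally show ?thesis by simp
    qed
    moreover have "storage (rs ! t) \<le> 4000000 * counters k l" if "t \<le> m" for t
    proof -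
      have "storage (rs ! t) \<le> 57000 * counters k l" using rs that by (simp add: run_bounds_def)
      then show ?thesis by (rule order_trans) simp
    qed
    ultimately show ?thesis using rs unfolding run_bounds_def by auto
  qed
  show "\<exists>A. \<forall>n m ps w. n \<ge> 1 \<and> length ps = m \<and> set ps \<subseteq> {1..n} \<and> w \<ge> 1 \<and> real w \<ge> log 2 (real (max n m)) \<longrightarrow>
      lossless_spmf (run A w n ps) \<and>
      measure (measure_spmf (run A w n ps))
        {rs. \<forall>t\<in>{0..m}. \<bar>estimate (rs ! t) - real (F2 n ps t)\<bar> \<le> \<epsilon> * real (F2 n ps m)} \<ge> 1 - \<delta> \<and>
      (\<forall>rs\<in>set_spmf (run A w n ps).
        (\<forall>t\<in>{0..m}. real (storage (rs ! t)) \<le> ?C * resource_bound \<epsilon> \<delta>) \<and>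
        (\<forall>t\<in>{1..m}. real (time (rs ! t)) \<le> ?C * resource_bound \<epsilon> \<delta>))"
  proof (rule exI[of _ "F2_alg k l"], intro allI impI)
    fix n m :: nat and ps :: "nat list" and w :: nat
    assume "n \<ge> 1 \<and> length ps = m \<and> set ps \<subseteq> {1..n} \<and> w \<ge> 1 \<and> real w \<ge> log 2 (real (max n m))"
    then have ps: "length ps = m" "set ps \<subseteq> {1..n}" and w: "0 < w" "max n m \<le> 2 ^ w"
      using pow2_bound[of w "max n m"] by auto
    let ?E = "{rs. \<forall>t\<in>{0..m}. \<bar>estimate (rs ! t) - real (F2 n ps t)\<bar> \<le> \<epsilon> * real (F2 n ps m)}"
    \<comment> \<open>Both modes are brought into the same form, the image of a uniform distribution
      on a finite set; for the exact mode the set has one point.\<close>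
    have "\<exists>A f. finite A \<and> A \<noteq> {} \<and> run (F2_alg k l) w n ps = map_spmf f (spmf_of_set (A :: int set)) \<and>
      (\<forall>X\<in>A. run_bounds k l m (f X)) \<and> (1 - \<delta>) * real (card A) \<le> real (card {X \<in> A. f X \<in> ?E})"
    proof (cases "n \<le> counters k l")
      case True
      then obtain rs where rs: "run (F2_alg k l) w n ps = return_spmf rs" "run_bounds k l m rs"
        "\<And>t. t \<le> m \<Longrightarrow> estimate (rs ! t) = real (F2 n ps t)"
        using run_table[OF k(1) True ps] w by auto
      have "rs \<in> ?E" using rs(3) \<epsilon>\<delta> by simp
      then have "{X \<in> {0::int}. rs \<in> ?E} = {0}" by auto
      then have "(1 - \<delta>) * real (card {0::int}) \<le> real (card {X \<in> {0::int}. rs \<in> ?E})"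
        using \<epsilon>\<delta> by (simp only:) simp
      with rs show ?thesis
        by (intro exI[of _ "{0}"] exI[of _ "\<lambda>_. rs"]) (simp add: spmf_of_set_singleton)
    next
      case False
      then have nK: "counters k l < n" by simp
      from run_sketch[OF k(1) nK ps w(1)] w obtain b f where b: "int n ^ 3 \<le> 2 ^ b"
        and run: "run (F2_alg k l) w n ps = map_spmf f (spmf_of_set {0..<((2 * 2 ^ b) ^ 4) ^ counters k l})"
        and f: "\<And>X. X \<in> {0..<((2 * 2 ^ b) ^ 4) ^ counters k l} \<Longrightarrow> run_bounds k l m (f X) \<and> estimate (f X ! 0) = 0 \<and>
          (\<forall>t\<in>{1..m}. \<exists>z. estimate (f X ! t) = of_int z / k \<and> is_center l (group_sum k (counter_value b ps X t)) z)"
        by auto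
      have "(1 - \<delta>) * ((2 * 2 ^ b) ^ 4) ^ counters k l \<le> real (card {X \<in> {0..<((2 * 2 ^ b) ^ 4) ^ counters k l}.
        \<forall>t\<in>{0..m}. \<bar>estimate (f X ! t) - real (F2 n ps t)\<bar> \<le> \<epsilon> * real (F2 n ps m)})"
        using f \<epsilon>\<delta> by (intro sketch_accurate[OF b ps _ _ _ k R]) auto
      with run f show ?thesis
        by (intro exI[of _ "{0..<((2 * 2 ^ b) ^ 4) ^ counters k l}"] exI[of _ f]) auto
    qed
    then obtain A :: "int set" and f where A: "finite A" "A \<noteq> {}" and run: "run (F2_alg k l) w n ps = map_spmf f (spmf_of_set A)"
      and f: "\<forall>X\<in>A. run_bounds k l m (f X)" "(1 - \<delta>) * real (card A) \<le> real (card {X \<in> A. f X \<in> ?E})" by blast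
    note facts = map_spmf_of_set_facts[OF A run]
    have "0 < real (card A)" using A by (simp add: card_gt_0_iff)
    then have "1 - \<delta> \<le> real (card {X \<in> A. f X \<in> ?E}) / real (card A)" using f(2) by (simp add: field_simps)
    then show "lossless_spmf (run (F2_alg k l) w n ps) \<and> measure (measure_spmf (run (F2_alg k l) w n ps)) ?E \<ge> 1 - \<delta> \<and>
      (\<forall>rs\<in>set_spmf (run (F2_alg k l) w n ps).
        (\<forall>t\<in>{0..m}. real (storage (rs ! t)) \<le> ?C * resource_bound \<epsilon> \<delta>) \<and>
        (\<forall>t\<in>{1..m}. real (time (rs ! t)) \<le> ?C * resource_bound \<epsilon> \<delta>))"
      using facts(1) facts(3)[of ?E] facts(2) f(1) bounds by auto
  qed
qed simp

end
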